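(* Let $(\mathsf{C},\otimes,I)$ be a $\mathbb{Q}_{\ge 0}$-linear symmetric monoidal category. The functors $F_1:\mathsf{BinBimon}(\mathsf{C})\to\mathsf{PermSplit}(\mathsf{C})$, $G_1:\mathsf{PermSplit}(\mathsf{C})\to\mathsf{BinBimon}(\mathsf{C})$, $F_2:\mathsf{PermSplit}(\mathsf{C})\to\mathsf{PermSplit}_1(\mathsf{C})$, $G_2:\mathsf{PermSplit}_1(\mathsf{C})\to\mathsf{PermSplit}(\mathsf{C})$, $F_3:\mathsf{PermSplit}_1(\mathsf{C})\to\mathsf{BinBimon}_1(\mathsf{C})$, $G_3:\mathsf{BinBimon}_1(\mathsf{C})\to\mathsf{PermSplit}_1(\mathsf{C})$ (defined in the context) are isomorphisms of categories, with $F_i^{-1}=G_i$ for $i=1,2,3$.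
   Context: Conventions. $f;g$ denotes composition in diagrammatic order (first $f$, then $g$); $\otimes$ binds tighter than $;$. Symmetric monoidal categories are treated as strict. $\gamma_{A,B}:A\otimes B\to B\otimes A$ is the symmetry. For $\sigma\in S_n$, $\sigma:A^{\otimes n}\to A^{\otimes n}$ denotes the natural transformation permuting tensor factors induced by the symmetry: the adjacent transposition $(a,a+1)$ acts as $\mathsf{id}_{A^{\otimes(a-1)}}\otimes\gamma_{A,A}\otimes\mathsf{id}_{A^{\otimes(n-a-1)}}$, and $\sigma;\tau$ acts as the composite. $A^{\otimes 0}=I$. A $\mathbb{Q}_{\ge 0}$-linear symmetric monoidal category is a symmetric monoidal category in which every hom-set is a module over the commutative semiring $\mathbb{Q}_{\ge 0}$, and composition and $\otimes$ of morphisms are $\mathbb{Q}_{\ge 0}$-bilinear (in particular preserve $0$ in each variable). A permutation splitting is a graded object $(A_n)_{n\ge 0}\in\mathsf{C}^{\mathbb{N}}$ with morphisms $r_n:A_1^{\otimes n}\to A_n$, $s_n:A_n\to A_1^{\otimes n}$ ($n\ge 0$) such that $r_n;s_n=\frac{1}{n!}\sum_{\sigma\in S_n}\sigma$, $s_n;r_n=\mathsf{id}_{A_n}$ for every $n$, and $r_1=s_1=\mathsf{id}_{A_1}$. A binomial bimonoid is a graded object $(A_n)_{n\ge 0}$ with maps $\nabla_{n,p}:A_n\otimes A_p\to A_{n+p}$, $\Delta_{n,p}:A_{n+p}\to A_n\otimes A_p$, $\eta:I\to A_0$, $\epsilon:A_0\to I$ such that for all $n,p,q,r\ge 0$: (i)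 $\eta\otimes\mathsf{id}_{A_n};\nabla_{0,n}=\mathsf{id}_{A_n}$; (ii) $\nabla_{n,p}\otimes\mathsf{id}_{A_q};\nabla_{n+p,q}=\mathsf{id}_{A_n}\otimes\nabla_{p,q};\nabla_{n,p+q}$; (iii) $\gamma_{A_n,A_p};\nabla_{p,n}=\nabla_{n,p}$; (iv) $\Delta_{0,n};\epsilon\otimes\mathsf{id}_{A_n}=\mathsf{id}_{A_n}$; (v) $\Delta_{n+p,q};\Delta_{n,p}\otimes\mathsf{id}_{A_q}=\Delta_{n,p+q};\mathsf{id}_{A_n}\otimes\Delta_{p,q}$; (vi) $\Delta_{n,p};\gamma_{A_n,A_p}=\Delta_{p,n}$; (vii) $\nabla_{0,0};\epsilon=\epsilon\otimes\epsilon$; (viii) $\eta;\Delta_{0,0}=\eta\otimes\eta$; (ix) $\eta;\epsilon=\mathsf{id}_I$; (x) whenever $n+p=q+r$, $\nabla_{n,p};\Delta_{q,r}=\sum\Delta_{a,b}\otimes\Delta_{c,d};\mathsf{id}_{A_a}\otimes\gamma_{A_b,A_c}\otimes\mathsf{id}_{A_d};\nabla_{a,c}\otimes\nabla_{b,d}$, sum over $a,b,c,d\ge 0$ with $a+b=n$, $c+d=p$, $a+c=q$, $b+d=r$; (xi) $\epsilon;\eta=\mathsf{id}_{A_0}$; (xii) $\Delta_{n,p};\nabla_{n,p}=\binom{n+p}{n}\mathsf{id}_{A_{n+p}}$. A morphism of binomial bimonoids $(A_n)\to(B_n)$ is a family $(f_n:A_n\to B_n)_{n\ge 0}$ with $\eta;f_0=\eta$,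 $f_0;\epsilon=\epsilon$, $f_n\otimes f_p;\nabla_{n,p}=\nabla_{n,p};f_{n+p}$ and $\Delta_{n,p};f_n\otimes f_p=f_{n+p};\Delta_{n,p}$ for all $n,p\ge 0$. A morphism of permutation splittings $(A_n)\to(B_n)$ is a family $(f_n:A_n\to B_n)_{n\ge 0}$ with $f_1^{\otimes n};r_n=r_n;f_n$ and $s_n;f_1^{\otimes n}=f_n;s_n$ for all $n\ge 0$. Categories. $\mathsf{BinBimon}(\mathsf{C})$: binomial bimonoids in $\mathsf{C}$ and morphisms of binomial bimonoids, with composition and identities as in $\mathsf{C}^{\mathbb{N}}$. $\mathsf{PermSplit}(\mathsf{C})$: permutation splittings in $\mathsf{C}$ and morphisms of permutation splittings, with composition and identities as in $\mathsf{C}^{\mathbb{N}}$. $\mathsf{BinBimon}_1(\mathsf{C})$ (resp. $\mathsf{PermSplit}_1(\mathsf{C})$): objects are binomial bimonoids (resp. permutation splittings) in $\mathsf{C}$, a morphism $(A_n)\to(B_n)$ is any morphism $A_1\to B_1$ of $\mathsf{C}$, with composition as in $\mathsf{C}$ and identity $\mathsf{id}_{A_1}$. Iterated maps: $\nabla_{n_1,\dots,n_{q+1}}:=\nabla_{n_1,\dots,n_q}\otimes\mathsf{id}_{A_{n_{q+1}}};\nabla_{n_1+\cdots+n_q,n_{q+1}}$ and $\Delta_{n_1,\dots,n_{q+1}}:=\Delta_{n_1+\cdots+n_q,n_{q+1}};\Delta_{n_1,\dots,n_q}\otimes\mathsf{id}_{A_{n_{q+1}}}$ for $q\ge 2$.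 Functors on objects (the underlying graded object is unchanged). $F_1$ and $G_3$ send a binomial bimonoid to the permutation splitting with $r_0=\eta$, $s_0=\epsilon$, $r_1=s_1=\mathsf{id}_{A_1}$, and $r_n=\nabla_{1,\dots,1}$, $s_n=\frac{1}{n!}\Delta_{1,\dots,1}$ ($n$ times $1$) for $n\ge 2$. $G_1$ and $F_3$ send a permutation splitting to the binomial bimonoid with $\eta=r_0$, $\epsilon=s_0$, $\nabla_{n,p}=s_n\otimes s_p;r_{n+p}$, $\Delta_{n,p}=\binom{n+p}{n}s_{n+p};r_n\otimes r_p$. $F_2$ and $G_2$ are the identity on objects. Functors on morphisms. $F_1,G_1,F_3,G_3$ act as the identity on morphisms. $F_2((f_n))=f_1$. $G_2(f_1)=(f_n)_{n\ge 0}$ with $f_n=s_n;f_1^{\otimes n};r_n$ for every $n\in\mathbb{N}$ (with $s_n$ that of the source and $r_n$ that of the target). *)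

theory Defs
  imports
    Complex_Main
    "HOL-Algebra.FiniteProduct"
    "HOL-Combinatorics.Permutations"
begin

no_notation monoid.mult (infixl \<open>\<otimes>\<index>\<close> 70)

text \<open>Composition is written in diagrammatic order.\<close>

record ('o, 'a) cat =
  objs :: "'o set"
  arrs :: "'a set"
  src :: "'a \<Rightarrow> 'o"
  tgt :: "'a \<Rightarrow> 'o"
  idt :: "'o \<Rightarrow> 'a" (\<open>\<i>\<d>\<index>\<close>)
  cmp :: "'a \<Rightarrow> 'a \<Rightarrow> 'a" (infixl \<open>;;\<index>\<close> 55)

definition Hom :: "('o, 'a, 'x) cat_scheme \<Rightarrow> 'o \<Rightarrow> 'o \<Rightarrow> 'a set" where
  "Hom C A B = {f \<in> arrs C. src C f = A \<and> tgt C f = B}"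

locale category =
  fixes C :: "('o, 'a, 'x) cat_scheme" (structure)
  assumes src_obj: "f \<in> arrs C \<Longrightarrow> src C f \<in> objs C"
    and tgt_obj: "f \<in> arrs C \<Longrightarrow> tgt C f \<in> objs C"
    and idt_Hom: "A \<in> objs C \<Longrightarrow> \<i>\<d> A \<in> Hom C A A"
    and cmp_Hom: "\<lbrakk>f \<in> Hom C A B; g \<in> Hom C B D\<rbrakk> \<Longrightarrow> f ;; g \<in> Hom C A D"
    and idt_cmp: "f \<in> Hom C A B \<Longrightarrow> \<i>\<d> A ;; f = f"
    and cmp_idt: "f \<in> Hom C A B \<Longrightarrow> f ;; \<i>\<d> B = f"
    and cmp_assoc: "\<lbrakk>f \<in> Hom C A B; g \<in> Hom C B D; h \<in> Hom C D E\<rbrakk>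
          \<Longrightarrow> (f ;; g) ;; h = f ;; (g ;; h)"

record ('o1, 'a1, 'o2, 'a2) fctr =
  omap :: "'o1 \<Rightarrow> 'o2"
  amap :: "'a1 \<Rightarrow> 'a2"

locale cat_functor = S: category C + T: category D
  for C :: "('o1, 'a1, 'x1) cat_scheme" and D :: "('o2, 'a2, 'x2) cat_scheme" +
  fixes F :: "('o1, 'a1, 'o2, 'a2) fctr"
  assumes omap_obj: "A \<in> objs C \<Longrightarrow> omap F A \<in> objs D"
    and amap_Hom: "f \<in> Hom C A B \<Longrightarrow> amap F f \<in> Hom D (omap F A) (omap F B)"
    and amap_idt: "A \<in> objs C \<Longrightarrow> amap F (\<i>\<d>\<^bsub>C\<^esub> A) = \<i>\<d>\<^bsub>D\<^esub> (omap F A)"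
    and amap_cmp: "\<lbrakk>f \<in> Hom C A B; g \<in> Hom C B E\<rbrakk>
          \<Longrightarrow> amap F (f ;;\<^bsub>C\<^esub> g) = amap F f ;;\<^bsub>D\<^esub> amap F g"

text \<open>\<open>F\<close> is an isomorphism of categories from \<open>C\<close> to \<open>D\<close> with inverse \<open>G\<close>; the condition is
  symmetric in \<open>(C, F)\<close> and \<open>(D, G)\<close>, so it also makes \<open>G\<close> an isomorphism with inverse \<open>F\<close>.
  Being a \<open>cat_functor\<close> includes that \<open>C\<close> and \<open>D\<close> are categories.\<close>

definition isomorphism_with_inverse ::
    "('o1, 'a1, 'x1) cat_scheme \<Rightarrow> ('o2, 'a2, 'x2) cat_scheme \<Rightarrow>
     ('o1, 'a1, 'o2, 'a2) fctr \<Rightarrow> ('o2, 'a2, 'o1, 'a1) fctr \<Rightarrow> bool" where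
  "isomorphism_with_inverse C D F G \<longleftrightarrow>
     cat_functor C D F \<and> cat_functor D C G \<and>
     (\<forall>A \<in> objs C. omap G (omap F A) = A) \<and> (\<forall>f \<in> arrs C. amap G (amap F f) = f) \<and>
     (\<forall>B \<in> objs D. omap F (omap G B) = B) \<and> (\<forall>g \<in> arrs D. amap F (amap G g) = g)"


record ('o, 'a) smcat = "('o, 'a) cat" +
  tens_ob :: "'o \<Rightarrow> 'o \<Rightarrow> 'o" (infixl \<open>\<otimes>\<^sub>o\<index>\<close> 70)
  tens :: "'a \<Rightarrow> 'a \<Rightarrow> 'a" (infixl \<open>\<otimes>\<index>\<close> 70)
  tunit :: "'o" (\<open>\<I>\<index>\<close>)
  symm :: "'o \<Rightarrow> 'o \<Rightarrow> 'a" (\<open>\<gamma>\<index>\<close>)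

locale strict_symmetric_monoidal_category = category C
  for C :: "('o, 'a, 'x) smcat_scheme" (structure) +
  assumes tunit_obj: "\<I> \<in> objs C"
    and tens_obj: "\<lbrakk>A \<in> objs C; B \<in> objs C\<rbrakk> \<Longrightarrow> A \<otimes>\<^sub>o B \<in> objs C"
    and tens_ob_assoc: "\<lbrakk>A \<in> objs C; B \<in> objs C; D \<in> objs C\<rbrakk>
          \<Longrightarrow> (A \<otimes>\<^sub>o B) \<otimes>\<^sub>o D = A \<otimes>\<^sub>o (B \<otimes>\<^sub>o D)"
    and tunit_tens_ob: "A \<in> objs C \<Longrightarrow> \<I> \<otimes>\<^sub>o A = A"
    and tens_ob_tunit: "A \<in> objs C \<Longrightarrow> A \<otimes>\<^sub>o \<I> = A"
    and tens_Hom: "\<lbrakk>f \<in> Hom C A B; g \<in> Hom C A' B'\<rbrakk>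
          \<Longrightarrow> f \<otimes> g \<in> Hom C (A \<otimes>\<^sub>o A') (B \<otimes>\<^sub>o B')"
    and tens_idt: "\<lbrakk>A \<in> objs C; B \<in> objs C\<rbrakk> \<Longrightarrow> \<i>\<d> A \<otimes> \<i>\<d> B = \<i>\<d> (A \<otimes>\<^sub>o B)"
    and tens_cmp: "\<lbrakk>f \<in> Hom C A B; g \<in> Hom C B D; f' \<in> Hom C A' B'; g' \<in> Hom C B' D'\<rbrakk>
          \<Longrightarrow> (f ;; g) \<otimes> (f' ;; g') = f \<otimes> f' ;; g \<otimes> g'"
    and tens_assoc: "\<lbrakk>f \<in> arrs C; g \<in> arrs C; h \<in> arrs C\<rbrakk>
          \<Longrightarrow> (f \<otimes> g) \<otimes> h = f \<otimes> (g \<otimes> h)"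
    and tunit_tens: "f \<in> arrs C \<Longrightarrow> \<i>\<d> \<I> \<otimes> f = f"
    and tens_tunit: "f \<in> arrs C \<Longrightarrow> f \<otimes> \<i>\<d> \<I> = f"
    and symm_Hom: "\<lbrakk>A \<in> objs C; B \<in> objs C\<rbrakk> \<Longrightarrow> \<gamma> A B \<in> Hom C (A \<otimes>\<^sub>o B) (B \<otimes>\<^sub>o A)"
    and symm_natural: "\<lbrakk>f \<in> Hom C A B; g \<in> Hom C A' B'\<rbrakk>
          \<Longrightarrow> f \<otimes> g ;; \<gamma> B B' = \<gamma> A A' ;; g \<otimes> f"
    and symm_symm: "\<lbrakk>A \<in> objs C; B \<in> objs C\<rbrakk> \<Longrightarrow> \<gamma> A B ;; \<gamma> B A = \<i>\<d> (A \<otimes>\<^sub>o B)"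
    and symm_hexagon: "\<lbrakk>A \<in> objs C; B \<in> objs C; D \<in> objs C\<rbrakk>
          \<Longrightarrow> \<gamma> A (B \<otimes>\<^sub>o D) = \<gamma> A B \<otimes> \<i>\<d> D ;; \<i>\<d> B \<otimes> \<gamma> A D"

text \<open>Scalars are nonnegative rationals: \<open>smul\<close> is only constrained (and only used) on \<open>q \<ge> 0\<close>.\<close>

record ('o, 'a) lsmcat = "('o, 'a) smcat" +
  hzero :: "'o \<Rightarrow> 'o \<Rightarrow> 'a"
  hadd :: "'a \<Rightarrow> 'a \<Rightarrow> 'a" (infixl \<open>\<oplus>\<^sub>h\<index>\<close> 65)
  smul :: "rat \<Rightarrow> 'a \<Rightarrow> 'a" (infixr \<open>\<cdot>\<index>\<close> 75)

text \<open>The additive monoid of a hom-set, written multiplicatively so that \<open>finprod\<close> provides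
  finite sums of morphisms.\<close>

definition hom_monoid :: "('o, 'a, 'x) lsmcat_scheme \<Rightarrow> 'o \<Rightarrow> 'o \<Rightarrow> 'a monoid" where
  "hom_monoid C A B = \<lparr>carrier = Hom C A B, monoid.mult = hadd C, one = hzero C A B\<rparr>"

definition hom_sum ::
    "('o, 'a, 'x) lsmcat_scheme \<Rightarrow> 'o \<Rightarrow> 'o \<Rightarrow> ('i \<Rightarrow> 'a) \<Rightarrow> 'i set \<Rightarrow> 'a" where
  "hom_sum C A B f S = finprod (hom_monoid C A B) f S"

locale linear_symmetric_monoidal_category = strict_symmetric_monoidal_category C
  for C :: "('o, 'a, 'x) lsmcat_scheme" (structure) +
  assumes hom_comm_monoid: "\<lbrakk>A \<in> objs C; B \<in> objs C\<rbrakk> \<Longrightarrow> comm_monoid (hom_monoid C A B)"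
    and smul_Hom: "\<lbrakk>0 \<le> p; f \<in> Hom C A B\<rbrakk> \<Longrightarrow> p \<cdot> f \<in> Hom C A B"
    and smul_hadd: "\<lbrakk>0 \<le> p; f \<in> Hom C A B; g \<in> Hom C A B\<rbrakk>
          \<Longrightarrow> p \<cdot> (f \<oplus>\<^sub>h g) = p \<cdot> f \<oplus>\<^sub>h p \<cdot> g"
    and smul_hzero: "\<lbrakk>0 \<le> p; A \<in> objs C; B \<in> objs C\<rbrakk> \<Longrightarrow> p \<cdot> hzero C A B = hzero C A B"
    and add_smul: "\<lbrakk>0 \<le> p; 0 \<le> q; f \<in> Hom C A B\<rbrakk> \<Longrightarrow> (p + q) \<cdot> f = p \<cdot> f \<oplus>\<^sub>h q \<cdot> f"
    and zero_smul: "f \<in> Hom C A B \<Longrightarrow> 0 \<cdot> f = hzero C A B"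
    and mult_smul: "\<lbrakk>0 \<le> p; 0 \<le> q; f \<in> Hom C A B\<rbrakk> \<Longrightarrow> (p * q) \<cdot> f = p \<cdot> q \<cdot> f"
    and one_smul: "f \<in> Hom C A B \<Longrightarrow> 1 \<cdot> f = f"
    and hadd_cmp: "\<lbrakk>f \<in> Hom C A B; f' \<in> Hom C A B; g \<in> Hom C B D\<rbrakk>
          \<Longrightarrow> (f \<oplus>\<^sub>h f') ;; g = (f ;; g) \<oplus>\<^sub>h (f' ;; g)"
    and cmp_hadd: "\<lbrakk>f \<in> Hom C A B; g \<in> Hom C B D; g' \<in> Hom C B D\<rbrakk>
          \<Longrightarrow> f ;; (g \<oplus>\<^sub>h g') = (f ;; g) \<oplus>\<^sub>h (f ;; g')"
    and hzero_cmp: "\<lbrakk>A \<in> objs C; g \<in> Hom C B D\<rbrakk> \<Longrightarrow> hzero C A B ;; g = hzero C A D"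
    and cmp_hzero: "\<lbrakk>f \<in> Hom C A B; D \<in> objs C\<rbrakk> \<Longrightarrow> f ;; hzero C B D = hzero C A D"
    and smul_cmp: "\<lbrakk>0 \<le> p; f \<in> Hom C A B; g \<in> Hom C B D\<rbrakk> \<Longrightarrow> (p \<cdot> f) ;; g = p \<cdot> (f ;; g)"
    and cmp_smul: "\<lbrakk>0 \<le> p; f \<in> Hom C A B; g \<in> Hom C B D\<rbrakk> \<Longrightarrow> f ;; (p \<cdot> g) = p \<cdot> (f ;; g)"
    and hadd_tens: "\<lbrakk>f \<in> Hom C A B; f' \<in> Hom C A B; g \<in> Hom C A' B'\<rbrakk>
          \<Longrightarrow> (f \<oplus>\<^sub>h f') \<otimes> g = (f \<otimes> g) \<oplus>\<^sub>h (f' \<otimes> g)"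
    and tens_hadd: "\<lbrakk>f \<in> Hom C A B; g \<in> Hom C A' B'; g' \<in> Hom C A' B'\<rbrakk>
          \<Longrightarrow> f \<otimes> (g \<oplus>\<^sub>h g') = (f \<otimes> g) \<oplus>\<^sub>h (f \<otimes> g')"
    and hzero_tens: "\<lbrakk>A \<in> objs C; B \<in> objs C; g \<in> Hom C A' B'\<rbrakk>
          \<Longrightarrow> hzero C A B \<otimes> g = hzero C (A \<otimes>\<^sub>o A') (B \<otimes>\<^sub>o B')"
    and tens_hzero: "\<lbrakk>f \<in> Hom C A B; A' \<in> objs C; B' \<in> objs C\<rbrakk>
          \<Longrightarrow> f \<otimes> hzero C A' B' = hzero C (A \<otimes>\<^sub>o A') (B \<otimes>\<^sub>o B')"
    and smul_tens: "\<lbrakk>0 \<le> p; f \<in> Hom C A B; g \<in> Hom C A' B'\<rbrakk>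
          \<Longrightarrow> (p \<cdot> f) \<otimes> g = p \<cdot> (f \<otimes> g)"
    and tens_smul: "\<lbrakk>0 \<le> p; f \<in> Hom C A B; g \<in> Hom C A' B'\<rbrakk>
          \<Longrightarrow> f \<otimes> (p \<cdot> g) = p \<cdot> (f \<otimes> g)"


primrec tpow_ob :: "('o, 'a, 'x) smcat_scheme \<Rightarrow> 'o \<Rightarrow> nat \<Rightarrow> 'o" where
  "tpow_ob C A 0 = \<I>\<^bsub>C\<^esub>"
| "tpow_ob C A (Suc n) = tpow_ob C A n \<otimes>\<^sub>o\<^bsub>C\<^esub> A"

primrec tpow :: "('o, 'a, 'x) smcat_scheme \<Rightarrow> 'a \<Rightarrow> nat \<Rightarrow> 'a" where
  "tpow C f 0 = \<i>\<d>\<^bsub>C\<^esub> \<I>\<^bsub>C\<^esub>"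
| "tpow C f (Suc n) = tpow C f n \<otimes>\<^bsub>C\<^esub> f"

text \<open>Tensor factors are numbered \<open>0, \<dots>, n - 1\<close>. The diagrammatic product \<open>\<sigma>;\<tau>\<close> of permutations
  is \<open>\<tau> \<circ> \<sigma>\<close>.\<close>

definition is_perm_action ::
    "('o, 'a, 'x) smcat_scheme \<Rightarrow> 'o \<Rightarrow> nat \<Rightarrow> ((nat \<Rightarrow> nat) \<Rightarrow> 'a) \<Rightarrow> bool" where
  "is_perm_action C A n \<rho> \<longleftrightarrow>
     (\<forall>\<sigma>. \<sigma> permutes {..<n} \<longrightarrow> \<rho> \<sigma> \<in> Hom C (tpow_ob C A n) (tpow_ob C A n)) \<and>
     \<rho> id = \<i>\<d>\<^bsub>C\<^esub> (tpow_ob C A n) \<and>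
     (\<forall>\<sigma> \<tau>. \<sigma> permutes {..<n} \<longrightarrow> \<tau> permutes {..<n} \<longrightarrow> \<rho> (\<tau> \<circ> \<sigma>) = \<rho> \<sigma> ;;\<^bsub>C\<^esub> \<rho> \<tau>) \<and>
     (\<forall>a. Suc a < n \<longrightarrow> \<rho> (transpose a (Suc a)) =
        \<i>\<d>\<^bsub>C\<^esub> (tpow_ob C A a) \<otimes>\<^bsub>C\<^esub> \<gamma>\<^bsub>C\<^esub> A A \<otimes>\<^bsub>C\<^esub> \<i>\<d>\<^bsub>C\<^esub> (tpow_ob C A (n - a - 2)))"

text \<open>The endomorphism of the \<open>n\<close>-th tensor power of \<open>A\<close> given by \<open>\<sigma>\<close>. By coherence a permutation
  action exists, and it is unique on permutations of \<open>{..<n}\<close> because adjacent transpositions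
  generate.\<close>

definition perm_map :: "('o, 'a, 'x) smcat_scheme \<Rightarrow> 'o \<Rightarrow> nat \<Rightarrow> (nat \<Rightarrow> nat) \<Rightarrow> 'a" where
  "perm_map C A n \<sigma> = (THE f. \<exists>\<rho>. is_perm_action C A n \<rho> \<and> f = \<rho> \<sigma>)"


record ('o, 'a) perm_split =
  psob :: "nat \<Rightarrow> 'o"
  rr :: "nat \<Rightarrow> 'a"
  ss :: "nat \<Rightarrow> 'a"

locale permutation_splitting = linear_symmetric_monoidal_category C
  for C :: "('o, 'a, 'x) lsmcat_scheme" (structure) +
  fixes P :: "('o, 'a) perm_split"
  assumes ps_obj: "psob P n \<in> objs C"
    and rr_Hom: "rr P n \<in> Hom C (tpow_ob C (psob P 1) n) (psob P n)"
    and ss_Hom: "ss P n \<in> Hom C (psob P n) (tpow_ob C (psob P 1) n)"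
    and rr_ss: "rr P n ;; ss P n =
          (1 / fact n) \<cdot> hom_sum C (tpow_ob C (psob P 1) n) (tpow_ob C (psob P 1) n)
                            (perm_map C (psob P 1) n) {\<sigma>. \<sigma> permutes {..<n}}"
    and ss_rr: "ss P n ;; rr P n = \<i>\<d> (psob P n)"
    and rr_1: "rr P 1 = \<i>\<d> (psob P 1)"
    and ss_1: "ss P 1 = \<i>\<d> (psob P 1)"

definition perm_split_morphism ::
    "('o, 'a, 'x) lsmcat_scheme \<Rightarrow> ('o, 'a) perm_split \<Rightarrow> ('o, 'a) perm_split \<Rightarrow> (nat \<Rightarrow> 'a) \<Rightarrow> bool"
    where
  "perm_split_morphism C P Q f \<longleftrightarrow>
     (\<forall>n. f n \<in> Hom C (psob P n) (psob Q n)) \<and>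
     (\<forall>n. tpow C (f 1) n ;;\<^bsub>C\<^esub> rr Q n = rr P n ;;\<^bsub>C\<^esub> f n) \<and>
     (\<forall>n. ss P n ;;\<^bsub>C\<^esub> tpow C (f 1) n = f n ;;\<^bsub>C\<^esub> ss Q n)"


record ('o, 'a) bin_bimon =
  bbob :: "nat \<Rightarrow> 'o"
  nabla :: "nat \<Rightarrow> nat \<Rightarrow> 'a"
  Delta :: "nat \<Rightarrow> nat \<Rightarrow> 'a"
  eta :: "'a"
  eps :: "'a"

locale binomial_bimonoid = linear_symmetric_monoidal_category C
  for C :: "('o, 'a, 'x) lsmcat_scheme" (structure) +
  fixes B :: "('o, 'a) bin_bimon"
  assumes bb_obj: "bbob B n \<in> objs C"
    and nabla_Hom: "nabla B n p \<in> Hom C (bbob B n \<otimes>\<^sub>o bbob B p) (bbob B (n + p))"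
    and Delta_Hom: "Delta B n p \<in> Hom C (bbob B (n + p)) (bbob B n \<otimes>\<^sub>o bbob B p)"
    and eta_Hom: "eta B \<in> Hom C \<I> (bbob B 0)"
    and eps_Hom: "eps B \<in> Hom C (bbob B 0) \<I>"
    and nabla_unit: "eta B \<otimes> \<i>\<d> (bbob B n) ;; nabla B 0 n = \<i>\<d> (bbob B n)"
    and nabla_assoc: "nabla B n p \<otimes> \<i>\<d> (bbob B q) ;; nabla B (n + p) q =
          \<i>\<d> (bbob B n) \<otimes> nabla B p q ;; nabla B n (p + q)"
    and nabla_comm: "\<gamma> (bbob B n) (bbob B p) ;; nabla B p n = nabla B n p"
    and Delta_counit: "Delta B 0 n ;; eps B \<otimes> \<i>\<d> (bbob B n) = \<i>\<d> (bbob B n)"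
    and Delta_coassoc: "Delta B (n + p) q ;; Delta B n p \<otimes> \<i>\<d> (bbob B q) =
          Delta B n (p + q) ;; \<i>\<d> (bbob B n) \<otimes> Delta B p q"
    and Delta_cocomm: "Delta B n p ;; \<gamma> (bbob B n) (bbob B p) = Delta B p n"
    and nabla_eps: "nabla B 0 0 ;; eps B = eps B \<otimes> eps B"
    and eta_Delta: "eta B ;; Delta B 0 0 = eta B \<otimes> eta B"
    and eta_eps: "eta B ;; eps B = \<i>\<d> \<I>"
    and nabla_Delta: "n + p = q + r \<Longrightarrow> nabla B n p ;; Delta B q r =
          hom_sum C (bbob B n \<otimes>\<^sub>o bbob B p) (bbob B q \<otimes>\<^sub>o bbob B r)
            (\<lambda>(a, b, c, d). Delta B a b \<otimes> Delta B c d ;;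
               \<i>\<d> (bbob B a) \<otimes> \<gamma> (bbob B b) (bbob B c) \<otimes> \<i>\<d> (bbob B d) ;;
               nabla B a c \<otimes> nabla B b d)
            {(a, b, c, d). a + b = n \<and> c + d = p \<and> a + c = q \<and> b + d = r}"
    and eps_eta: "eps B ;; eta B = \<i>\<d> (bbob B 0)"
    and Delta_nabla: "Delta B n p ;; nabla B n p = of_nat ((n + p) choose n) \<cdot> \<i>\<d> (bbob B (n + p))"

definition bin_bimon_morphism ::
    "('o, 'a, 'x) lsmcat_scheme \<Rightarrow> ('o, 'a) bin_bimon \<Rightarrow> ('o, 'a) bin_bimon \<Rightarrow> (nat \<Rightarrow> 'a) \<Rightarrow> bool"
    where
  "bin_bimon_morphism C A B f \<longleftrightarrow>
     (\<forall>n. f n \<in> Hom C (bbob A n) (bbob B n)) \<and>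
     eta A ;;\<^bsub>C\<^esub> f 0 = eta B \<and>
     f 0 ;;\<^bsub>C\<^esub> eps B = eps A \<and>
     (\<forall>n p. f n \<otimes>\<^bsub>C\<^esub> f p ;;\<^bsub>C\<^esub> nabla B n p = nabla A n p ;;\<^bsub>C\<^esub> f (n + p)) \<and>
     (\<forall>n p. Delta A n p ;;\<^bsub>C\<^esub> f n \<otimes>\<^bsub>C\<^esub> f p = f (n + p) ;;\<^bsub>C\<^esub> Delta B n p)"

text \<open>The iterated (co)multiplications with the \<open>k + 2\<close> indices \<open>ns 0, \<dots>, ns (k + 1)\<close>.\<close>

primrec nabla_iter ::
    "('o, 'a, 'x) lsmcat_scheme \<Rightarrow> ('o, 'a) bin_bimon \<Rightarrow> (nat \<Rightarrow> nat) \<Rightarrow> nat \<Rightarrow> 'a" where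
  "nabla_iter C B ns 0 = nabla B (ns 0) (ns 1)"
| "nabla_iter C B ns (Suc k) =
     nabla_iter C B ns k \<otimes>\<^bsub>C\<^esub> \<i>\<d>\<^bsub>C\<^esub> (bbob B (ns (k + 2))) ;;\<^bsub>C\<^esub>
     nabla B (\<Sum>i<k + 2. ns i) (ns (k + 2))"

primrec Delta_iter ::
    "('o, 'a, 'x) lsmcat_scheme \<Rightarrow> ('o, 'a) bin_bimon \<Rightarrow> (nat \<Rightarrow> nat) \<Rightarrow> nat \<Rightarrow> 'a" where
  "Delta_iter C B ns 0 = Delta B (ns 0) (ns 1)"
| "Delta_iter C B ns (Suc k) =
     Delta B (\<Sum>i<k + 2. ns i) (ns (k + 2)) ;;\<^bsub>C\<^esub>
     Delta_iter C B ns k \<otimes>\<^bsub>C\<^esub> \<i>\<d>\<^bsub>C\<^esub> (bbob B (ns (k + 2)))"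


text \<open>Arrows carry their source and target, so that the hom-sets of a category built from
  structured objects are disjoint.\<close>

datatype ('x, 'm) arrow = Arrow (arrow_src: 'x) (arrow_tgt: 'x) (arrow_map: 'm)

definition struct_cat ::
    "'x set \<Rightarrow> ('x \<Rightarrow> 'x \<Rightarrow> 'm \<Rightarrow> bool) \<Rightarrow> ('x \<Rightarrow> 'm) \<Rightarrow> ('m \<Rightarrow> 'm \<Rightarrow> 'm) \<Rightarrow> ('x, ('x, 'm) arrow) cat" where
  "struct_cat Obs mor idm cmpm =
     \<lparr>objs = Obs,
      arrs = {Arrow X Y f | X Y f. X \<in> Obs \<and> Y \<in> Obs \<and> mor X Y f},
      src = arrow_src,
      tgt = arrow_tgt,
      idt = (\<lambda>X. Arrow X X (idm X)),
      cmp = (\<lambda>u v. Arrow (arrow_src u) (arrow_tgt v) (cmpm (arrow_map u) (arrow_map v)))\<rparr>"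

definition BinBimon ::
    "('o, 'a, 'x) lsmcat_scheme \<Rightarrow> (('o, 'a) bin_bimon, (('o, 'a) bin_bimon, nat \<Rightarrow> 'a) arrow) cat"
    where
  "BinBimon C = struct_cat {B. binomial_bimonoid C B} (bin_bimon_morphism C)
     (\<lambda>B n. \<i>\<d>\<^bsub>C\<^esub> (bbob B n)) (\<lambda>f g n. f n ;;\<^bsub>C\<^esub> g n)"

definition PermSplit ::
    "('o, 'a, 'x) lsmcat_scheme \<Rightarrow> (('o, 'a) perm_split, (('o, 'a) perm_split, nat \<Rightarrow> 'a) arrow) cat"
    where
  "PermSplit C = struct_cat {P. permutation_splitting C P} (perm_split_morphism C)
     (\<lambda>P n. \<i>\<d>\<^bsub>C\<^esub> (psob P n)) (\<lambda>f g n. f n ;;\<^bsub>C\<^esub> g n)"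

definition BinBimon1 ::
    "('o, 'a, 'x) lsmcat_scheme \<Rightarrow> (('o, 'a) bin_bimon, (('o, 'a) bin_bimon, 'a) arrow) cat" where
  "BinBimon1 C = struct_cat {B. binomial_bimonoid C B} (\<lambda>A B f. f \<in> Hom C (bbob A 1) (bbob B 1))
     (\<lambda>B. \<i>\<d>\<^bsub>C\<^esub> (bbob B 1)) (cmp C)"

definition PermSplit1 ::
    "('o, 'a, 'x) lsmcat_scheme \<Rightarrow> (('o, 'a) perm_split, (('o, 'a) perm_split, 'a) arrow) cat" where
  "PermSplit1 C = struct_cat {P. permutation_splitting C P} (\<lambda>P Q f. f \<in> Hom C (psob P 1) (psob Q 1))
     (\<lambda>P. \<i>\<d>\<^bsub>C\<^esub> (psob P 1)) (cmp C)"


definition bb_to_ps :: "('o, 'a, 'x) lsmcat_scheme \<Rightarrow> ('o, 'a) bin_bimon \<Rightarrow> ('o, 'a) perm_split" where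
  "bb_to_ps C B =
     \<lparr>psob = bbob B,
      rr = (\<lambda>n. case n of 0 \<Rightarrow> eta B
                 | Suc 0 \<Rightarrow> \<i>\<d>\<^bsub>C\<^esub> (bbob B 1)
                 | Suc (Suc k) \<Rightarrow> nabla_iter C B (\<lambda>_. 1) k),
      ss = (\<lambda>n. case n of 0 \<Rightarrow> eps B
                 | Suc 0 \<Rightarrow> \<i>\<d>\<^bsub>C\<^esub> (bbob B 1)
                 | Suc (Suc k) \<Rightarrow> (1 / fact n) \<cdot>\<^bsub>C\<^esub> Delta_iter C B (\<lambda>_. 1) k)\<rparr>"

definition ps_to_bb :: "('o, 'a, 'x) lsmcat_scheme \<Rightarrow> ('o, 'a) perm_split \<Rightarrow> ('o, 'a) bin_bimon" where
  "ps_to_bb C P =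
     \<lparr>bbob = psob P,
      nabla = (\<lambda>n p. ss P n \<otimes>\<^bsub>C\<^esub> ss P p ;;\<^bsub>C\<^esub> rr P (n + p)),
      Delta = (\<lambda>n p. of_nat ((n + p) choose n) \<cdot>\<^bsub>C\<^esub> (ss P (n + p) ;;\<^bsub>C\<^esub> rr P n \<otimes>\<^bsub>C\<^esub> rr P p)),
      eta = rr P 0,
      eps = ss P 0\<rparr>"

definition struct_functor ::
    "('x \<Rightarrow> 'y) \<Rightarrow> ('x \<Rightarrow> 'x \<Rightarrow> 'm \<Rightarrow> 'n) \<Rightarrow> ('x, ('x, 'm) arrow, 'y, ('y, 'n) arrow) fctr" where
  "struct_functor \<Phi> \<phi> =
     \<lparr>omap = \<Phi>,
      amap = (\<lambda>u. Arrow (\<Phi> (arrow_src u)) (\<Phi> (arrow_tgt u))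
                    (\<phi> (arrow_src u) (arrow_tgt u) (arrow_map u)))\<rparr>"

definition F1 :: "('o, 'a, 'x) lsmcat_scheme \<Rightarrow>
    (('o, 'a) bin_bimon, (('o, 'a) bin_bimon, nat \<Rightarrow> 'a) arrow,
     ('o, 'a) perm_split, (('o, 'a) perm_split, nat \<Rightarrow> 'a) arrow) fctr" where
  "F1 C = struct_functor (bb_to_ps C) (\<lambda>A B f. f)"

definition G1 :: "('o, 'a, 'x) lsmcat_scheme \<Rightarrow>
    (('o, 'a) perm_split, (('o, 'a) perm_split, nat \<Rightarrow> 'a) arrow,
     ('o, 'a) bin_bimon, (('o, 'a) bin_bimon, nat \<Rightarrow> 'a) arrow) fctr" where
  "G1 C = struct_functor (ps_to_bb C) (\<lambda>P Q f. f)"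

definition F2 :: "('o, 'a, 'x) lsmcat_scheme \<Rightarrow>
    (('o, 'a) perm_split, (('o, 'a) perm_split, nat \<Rightarrow> 'a) arrow,
     ('o, 'a) perm_split, (('o, 'a) perm_split, 'a) arrow) fctr" where
  "F2 C = struct_functor (\<lambda>P. P) (\<lambda>P Q f. f 1)"

definition G2 :: "('o, 'a, 'x) lsmcat_scheme \<Rightarrow>
    (('o, 'a) perm_split, (('o, 'a) perm_split, 'a) arrow,
     ('o, 'a) perm_split, (('o, 'a) perm_split, nat \<Rightarrow> 'a) arrow) fctr" where
  "G2 C = struct_functor (\<lambda>P. P) (\<lambda>P Q f n. ss P n ;;\<^bsub>C\<^esub> tpow C f n ;;\<^bsub>C\<^esub> rr Q n)"

definition F3 :: "('o, 'a, 'x) lsmcat_scheme \<Rightarrow>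
    (('o, 'a) perm_split, (('o, 'a) perm_split, 'a) arrow,
     ('o, 'a) bin_bimon, (('o, 'a) bin_bimon, 'a) arrow) fctr" where
  "F3 C = struct_functor (ps_to_bb C) (\<lambda>P Q f. f)"

definition G3 :: "('o, 'a, 'x) lsmcat_scheme \<Rightarrow>
    (('o, 'a) bin_bimon, (('o, 'a) bin_bimon, 'a) arrow,
     ('o, 'a) perm_split, (('o, 'a) perm_split, 'a) arrow) fctr" where
  "G3 C = struct_functor (bb_to_ps C) (\<lambda>A B f. f)"

end

theory Submission
  imports Defs
begin

text \<open>Given a splitting \<open>r, s\<close> of the symmetrizers, \<open>r\<close> and \<open>s\<close> absorb every permutation, and all bimonoid
  axioms except the bialgebra law follow at once. For that law, \<open>r\<^sub>N;s\<^sub>N\<close> followed by \<open>r\<^sub>q \<otimes> r\<^sub>r\<close> is, up to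
  the factor \<open>N choose q\<close>, the sum of all \<open>(q, r)\<close>-unshuffles followed by \<open>r\<^sub>q \<otimes> r\<^sub>r\<close>. Cutting the source
  into blocks of length \<open>n\<close> and \<open>p\<close> writes an unshuffle as a pair of unshuffles followed by a block swap
  (the Vandermonde argument), which is the right-hand side of the law.

  Conversely, the bialgebra law with \<open>p = 1\<close> shows that the \<open>n\<close>-fold multiplication followed by the
  \<open>n\<close>-fold comultiplication satisfies the recursion \<open>x\<^sub>n\<^sub>+\<^sub>1 = x\<^sub>n \<otimes> id; z\<^sub>n\<close>, where \<open>z\<^sub>n\<close> is the sum over all
  ways to insert the last factor. The sum of all permutations satisfies the same recursion, by
  decomposing a permutation according to the image of its last point.

  A morphism of permutation splittings is determined by its component \<open>f\<^sub>1\<close> because \<open>s;r = id\<close>, and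
  every \<open>f\<^sub>1\<close> extends because its tensor powers commute with the symmetrizers.\<close>

text \<open>The morphism \<open>perm_map\<close> is a definite description, so nothing can be
  computed until a permutation action has been exhibited. Rather than presenting the symmetric group
  by relations, \<open>pm\<close> is defined outright, by recursion on the decomposition of a
  permutation into a cycle moving the last point and a permutation of the other points;
  multiplicativity is then checked against adjacent transpositions only. The same decomposition
  yields the recursion of the symmetrizers, so that later arguments handle insertion sums
  \<open>ins_sum\<close> rather than single permutations. Scalars are the other obstacle. The
  comultiplication of a splitting is a binomial multiple of an average; \<open>unsh_R\<close> trades
  it for an unweighted sum of unshuffles, so the bialgebra law becomes a coefficient-free identity
  between sums of arrows, with the Pascal rule hidden in the recursion of
  \<open>unsh\<close>.\<close>

context category
begin

lemma HomD: "f \<in> Hom C A B \<Longrightarrow> f \<in> arrs C" "f \<in> Hom C A B \<Longrightarrow> src C f = A"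
    "f \<in> Hom C A B \<Longrightarrow> tgt C f = B"
    "f \<in> Hom C A B \<Longrightarrow> A \<in> objs C" "f \<in> Hom C A B \<Longrightarrow> B \<in> objs C"
  using src_obj tgt_obj by (auto simp: Hom_def)

lemma Hom_iff: "f \<in> Hom C A B \<longleftrightarrow> f \<in> arrs C \<and> src C f = A \<and> tgt C f = B"
  by (simp add: Hom_def)

lemma src_tgt_obj [simp]: "f \<in> arrs C \<Longrightarrow> src C f \<in> objs C" "f \<in> arrs C \<Longrightarrow> tgt C f \<in> objs C"
  by (simp_all add: src_obj tgt_obj)

lemma idt_arr [simp]: "A \<in> objs C \<Longrightarrow> \<i>\<d> A \<in> arrs C" "A \<in> objs C \<Longrightarrow> src C (\<i>\<d> A) = A"
    "A \<in> objs C \<Longrightarrow> tgt C (\<i>\<d> A) = A"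
  using idt_Hom[of A] by (auto simp: Hom_def)

lemma cmp_arr [simp]:
  assumes "f \<in> arrs C" "g \<in> arrs C" "tgt C f = src C g"
  shows "f ;; g \<in> arrs C" "src C (f ;; g) = src C f" "tgt C (f ;; g) = tgt C g"
  using cmp_Hom[of f "src C f" "tgt C f" g "tgt C g"] assms by (auto simp: Hom_def)

lemma idt_cmp_arr [simp]: "f \<in> arrs C \<Longrightarrow> src C f = A \<Longrightarrow> \<i>\<d> A ;; f = f"
  by (rule idt_cmp[of f A "tgt C f"]) (simp add: Hom_def)

lemma cmp_idt_arr [simp]: "f \<in> arrs C \<Longrightarrow> tgt C f = A \<Longrightarrow> f ;; \<i>\<d> A = f"
  by (rule cmp_idt[of f "src C f"]) (simp add: Hom_def)

text \<open>The axioms type arrows by \<open>Hom C A B\<close>, whose objects do not occur in the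
  conclusion. Stated through \<open>src\<close> and \<open>tgt\<close>, the side conditions are
  equations that the simplifier can discharge, and right-nested composition becomes a normal
  form.\<close>

lemma cmp_assoc_arr [simp]:
  "f \<in> arrs C \<Longrightarrow> g \<in> arrs C \<Longrightarrow> h \<in> arrs C \<Longrightarrow> tgt C f = src C g \<Longrightarrow> tgt C g = src C h \<Longrightarrow>
     (f ;; g) ;; h = f ;; (g ;; h)"
  by (rule cmp_assoc[of f "src C f" "tgt C f" g "tgt C g" h "tgt C h"]) (simp_all add: Hom_def)

text \<open>In right-nested form the left side of an equation for \<open>f ;; g\<close> does not
  occur in a longer composite; this supplies the version followed by an arbitrary
  \<open>h\<close>.\<close>

lemma cmp_eq_ext:
  assumes "f ;; g = k" "f \<in> arrs C" "g \<in> arrs C" "h \<in> arrs C" "tgt C f = src C g"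
    "tgt C g = src C h"
  shows "f ;; (g ;; h) = k ;; h"
  using assms by (simp flip: cmp_assoc_arr)

end

section \<open>Interchange and coherence of the symmetry\<close>

context strict_symmetric_monoidal_category
begin

declare tunit_obj [simp] tens_obj [simp] tens_ob_assoc [simp] tunit_tens_ob [simp]
  tens_ob_tunit [simp] tens_idt [simp] tens_assoc [simp] tunit_tens [simp] tens_tunit [simp]
  symm_symm [simp]

lemma tens_arr [simp]:
  assumes "f \<in> arrs C" "g \<in> arrs C"
  shows "f \<otimes> g \<in> arrs C" "src C (f \<otimes> g) = src C f \<otimes>\<^sub>o src C g"
    "tgt C (f \<otimes> g) = tgt C f \<otimes>\<^sub>o tgt C g"
  using tens_Hom[of f "src C f" "tgt C f" g "src C g" "tgt C g"] assms by (auto simp: Hom_def)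

lemma symm_arr [simp]:
  assumes "A \<in> objs C" "B \<in> objs C"
  shows "\<gamma> A B \<in> arrs C" "src C (\<gamma> A B) = A \<otimes>\<^sub>o B" "tgt C (\<gamma> A B) = B \<otimes>\<^sub>o A"
  using symm_Hom[OF assms] by (auto simp: Hom_def)

lemma tens_idt_ext [simp]:
  "A \<in> objs C \<Longrightarrow> B \<in> objs C \<Longrightarrow> f \<in> arrs C \<Longrightarrow> \<i>\<d> A \<otimes> (\<i>\<d> B \<otimes> f) = \<i>\<d> (A \<otimes>\<^sub>o B) \<otimes> f"
  by (simp flip: tens_assoc tens_idt)

text \<open>Oriented towards a tensor of composites. It stays out of the simpset because
  \<open>whisker\<close> rewrites the other way, and both directions are used.\<close>

lemma interchange:
  assumes "f \<in> arrs C" "g \<in> arrs C" "f' \<in> arrs C" "g' \<in> arrs C"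
    "tgt C f = src C g" "tgt C f' = src C g'"
  shows "f \<otimes> f' ;; g \<otimes> g' = (f ;; g) \<otimes> (f' ;; g')"
  using assms
  by (intro tens_cmp[symmetric, of f "src C f" "tgt C f" g "tgt C g" f' "src C f'" "tgt C f'" g' "tgt C g'"])
     (auto simp: Hom_def)

lemma interchange_ext:
  assumes "f \<in> arrs C" "g \<in> arrs C" "f' \<in> arrs C" "g' \<in> arrs C" "h \<in> arrs C"
    "tgt C f = src C g" "tgt C f' = src C g'" "tgt C g \<otimes>\<^sub>o tgt C g' = src C h"
  shows "f \<otimes> f' ;; (g \<otimes> g' ;; h) = (f ;; g) \<otimes> (f' ;; g') ;; h"
  using assms interchange[of f g f' g'] by (simp flip: cmp_assoc_arr)

lemmas ichg = interchange interchange_ext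

lemma whisker:
  assumes "f \<in> arrs C" "g \<in> arrs C" "tgt C f = src C g" "A \<in> objs C"
  shows "\<i>\<d> A \<otimes> (f ;; g) = \<i>\<d> A \<otimes> f ;; \<i>\<d> A \<otimes> g"
    "(f ;; g) \<otimes> \<i>\<d> A = f \<otimes> \<i>\<d> A ;; g \<otimes> \<i>\<d> A"
  using assms by (simp_all add: interchange)

lemma symm_natural_arr:
  assumes "f \<in> arrs C" "g \<in> arrs C"
  shows "f \<otimes> g ;; \<gamma> (tgt C f) (tgt C g) = \<gamma> (src C f) (src C g) ;; g \<otimes> f"
  using assms by (intro symm_natural) (auto simp: Hom_def)

text \<open>Only one hexagon is an axiom. By that axiom the right-hand side is a right inverse of
  \<open>\<gamma> D (A \<otimes>\<^sub>o B)\<close>, whose inverse is the left-hand side.\<close>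

lemma symm_hexagon':
  assumes [simp]: "A \<in> objs C" "B \<in> objs C" "D \<in> objs C"
  shows "\<gamma> (A \<otimes>\<^sub>o B) D = \<i>\<d> A \<otimes> \<gamma> B D ;; \<gamma> A D \<otimes> \<i>\<d> B"
proof -
  have h: "\<gamma> D (A \<otimes>\<^sub>o B) ;; (\<i>\<d> A \<otimes> \<gamma> B D ;; \<gamma> A D \<otimes> \<i>\<d> B) = \<i>\<d> (D \<otimes>\<^sub>o (A \<otimes>\<^sub>o B))"
    by (simp add: symm_hexagon ichg)
  have "\<gamma> (A \<otimes>\<^sub>o B) D = \<gamma> (A \<otimes>\<^sub>o B) D ;; (\<gamma> D (A \<otimes>\<^sub>o B) ;; (\<i>\<d> A \<otimes> \<gamma> B D ;; \<gamma> A D \<otimes> \<i>\<d> B))"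
    by (subst h) simp
  also have "\<dots> = (\<gamma> (A \<otimes>\<^sub>o B) D ;; \<gamma> D (A \<otimes>\<^sub>o B)) ;; (\<i>\<d> A \<otimes> \<gamma> B D ;; \<gamma> A D \<otimes> \<i>\<d> B)"
    by (subst cmp_assoc_arr) simp_all
  also have "\<dots> = \<i>\<d> A \<otimes> \<gamma> B D ;; \<gamma> A D \<otimes> \<i>\<d> B"
    by (subst symm_symm) simp_all
  finally show ?thesis .
qed

text \<open>The hexagon with two unit objects makes \<open>\<gamma> A \<I>\<close> idempotent, and
  an invertible idempotent is an identity.\<close>

lemma symm_tunit [simp]:
  assumes [simp]: "A \<in> objs C"
  shows "\<gamma> A \<I> = \<i>\<d> A" "\<gamma> \<I> A = \<i>\<d> A"
proof -
  have *: "\<gamma> A \<I> = \<gamma> A \<I> ;; \<gamma> A \<I>"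
    using symm_hexagon[of A \<I> \<I>] by simp
  have "\<gamma> A \<I> = \<gamma> A \<I> ;; (\<gamma> A \<I> ;; \<gamma> \<I> A)"
    by (subst symm_symm) simp_all
  also have "\<dots> = (\<gamma> A \<I> ;; \<gamma> A \<I>) ;; \<gamma> \<I> A"
    by (subst cmp_assoc_arr) simp_all
  also have "\<dots> = \<i>\<d> A"
    by (subst *[symmetric]) simp
  finally show 1: "\<gamma> A \<I> = \<i>\<d> A" .
  show "\<gamma> \<I> A = \<i>\<d> A"
    using symm_symm[of \<I> A] by (simp add: 1)
qed

end

section \<open>Tensor powers, adjacent transpositions and insertion cycles\<close>

locale smc_power = strict_symmetric_monoidal_category C
  for C :: "('o, 'a, 'x) smcat_scheme" (structure) +
  fixes A :: 'o
  assumes base_obj: "A \<in> objs C"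
begin

text \<open>A constant of its own, so that the recursion of \<open>tpow_ob\<close> does not unfold
  and objects built from powers of \<open>A\<close> normalize to a single \<open>pw k\<close> by
  \<open>pw_add\<close>.\<close>

definition pw :: "nat \<Rightarrow> 'o" where "pw n = tpow_ob C A n"

abbreviation J :: "nat \<Rightarrow> 'a" where "J n \<equiv> \<i>\<d> (pw n)"

lemma pw_0: "pw 0 = \<I>" and pw_1: "pw (Suc 0) = A"
  by (simp_all add: pw_def base_obj)

lemma pw_obj [simp]: "pw n \<in> objs C"
  unfolding pw_def by (induction n) (simp_all add: base_obj)

lemma pw_add [simp]: "pw m \<otimes>\<^sub>o pw n = pw (m + n)"
proof (induction n)
  case (Suc n)
  then show ?case
    using base_obj pw_obj[of n] pw_obj[of m] unfolding pw_def by (simp flip: tens_ob_assoc)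
qed (simp add: pw_0)

lemma pw_add_ext [simp]: "X \<in> objs C \<Longrightarrow> pw m \<otimes>\<^sub>o (pw n \<otimes>\<^sub>o X) = pw (m + n) \<otimes>\<^sub>o X"
  by (simp flip: tens_ob_assoc)

lemma J_0_tens [simp]: "f \<in> arrs C \<Longrightarrow> J 0 \<otimes> f = f" "f \<in> arrs C \<Longrightarrow> f \<otimes> J 0 = f"
  by (simp_all add: pw_0)

lemma symm_pw_0 [simp]: "X \<in> objs C \<Longrightarrow> \<gamma> X (pw 0) = \<i>\<d> X" "X \<in> objs C \<Longrightarrow> \<gamma> (pw 0) X = \<i>\<d> X"
  by (simp_all add: pw_0)

lemma symm_pw_add1: "X \<in> objs C \<Longrightarrow> \<gamma> (pw (m + n)) X = J m \<otimes> \<gamma> (pw n) X ;; \<gamma> (pw m) X \<otimes> J n"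
  using symm_hexagon'[of "pw m" "pw n" X] by simp

lemma symm_pw_add2: "X \<in> objs C \<Longrightarrow> \<gamma> X (pw (m + n)) = \<gamma> X (pw m) \<otimes> J n ;; J m \<otimes> \<gamma> X (pw n)"
  using symm_hexagon[of X "pw m" "pw n"] by simp

text \<open>Writing the ambient length as a sum of the three block lengths avoids truncated subtraction.\<close>

definition tr :: "nat \<Rightarrow> nat \<Rightarrow> 'a" where
  "tr a b = J a \<otimes> (\<gamma> (pw (Suc 0)) (pw (Suc 0)) \<otimes> J b)"

definition cyc :: "nat \<Rightarrow> nat \<Rightarrow> 'a" where
  "cyc k m = J k \<otimes> \<gamma> (pw m) (pw (Suc 0))"

lemma tr_arr [simp]: "tr a b \<in> arrs C" "src C (tr a b) = pw (Suc (Suc (a + b)))"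
    "tgt C (tr a b) = pw (Suc (Suc (a + b)))"
  by (simp_all add: tr_def)

lemma cyc_arr [simp]: "cyc k m \<in> arrs C" "src C (cyc k m) = pw (Suc (k + m))"
    "tgt C (cyc k m) = pw (Suc (k + m))"
  by (simp_all add: cyc_def)

lemma tr_tens [simp]: "tr a b \<otimes> J c = tr a (b + c)" "J c \<otimes> tr a b = tr (c + a) b"
  by (simp_all add: tr_def)

lemma cyc_0 [simp]: "cyc k 0 = J (Suc k)"
  by (simp add: cyc_def)

lemma tr_tr [simp]: "tr a b ;; tr a b = J (Suc (Suc (a + b)))"
  by (simp add: tr_def ichg)

text \<open>The last factor moves left past \<open>m + 1\<close> factors; one adjacent swap is split
  off, here the final one, in \<open>cyc_Suc'\<close> the initial one.\<close>

lemma cyc_Suc: "cyc k (Suc m) = cyc (Suc k) m ;; tr k m"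
  using symm_pw_add1[of "pw (Suc 0)" "Suc 0" m] by (simp add: tr_def cyc_def whisker)

lemma cyc_Suc': "cyc k (Suc m) = tr (k + m) 0 ;; cyc k m \<otimes> J (Suc 0)"
  using symm_pw_add1[of "pw (Suc 0)" m "Suc 0"] by (simp add: tr_def cyc_def whisker)

text \<open>The swap lies strictly left of the insertion point, so the two arrows act on disjoint
  factors.\<close>

lemma cyc_tr_less:
  "cyc (Suc (Suc (a + b))) m ;; tr a (Suc (b + m)) = tr a (b + m) \<otimes> J (Suc 0) ;; cyc (Suc (Suc (a + b))) m"
proof -
  have "tr a (Suc (b + m)) = tr a b \<otimes> J (Suc m)" "tr a (b + m) \<otimes> J (Suc 0) = tr a b \<otimes> J (Suc m)"
    by simp_all
  then show ?thesis
    by (simp add: cyc_def ichg del: tr_tens)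
qed

text \<open>The swap lies among the factors that the inserted one jumps over; naturality of the
  symmetry carries it across and shifts its position by one.\<close>

lemma cyc_tr_greater:
  "cyc k (Suc (Suc (a + b))) ;; tr (Suc (k + a)) b = tr (k + a) b \<otimes> J (Suc 0) ;; cyc k (Suc (Suc (a + b)))"
proof -
  have 1: "tr (Suc (k + a)) b = J k \<otimes> (J (Suc 0) \<otimes> tr a b)"
    and 2: "tr (k + a) b \<otimes> J (Suc 0) = J k \<otimes> (tr a b \<otimes> J (Suc 0))"
    by simp_all
  have 3: "tr a b \<otimes> J (Suc 0) ;; \<gamma> (pw (Suc (Suc (a + b)))) (pw (Suc 0)) =
      \<gamma> (pw (Suc (Suc (a + b)))) (pw (Suc 0)) ;; J (Suc 0) \<otimes> tr a b"
    using symm_natural_arr[of "tr a b" "J (Suc 0)"] by simp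
  show ?thesis
    unfolding cyc_def 1 2
    by (subst (1 2) interchange) (simp_all only: 3, simp_all)
qed

end

section \<open>The symmetric groups acting on tensor powers\<close>

text \<open>The cycle realized by \<open>cyc k (n - k)\<close>: the last point \<open>n\<close> goes
  to \<open>k\<close> and the points from \<open>k\<close> on move up. For \<open>k > n\<close> it
  is the identity, which keeps \<open>ins_perm_permutes\<close> unconditional.\<close>

definition ins_perm :: "nat \<Rightarrow> nat \<Rightarrow> nat \<Rightarrow> nat" where
  "ins_perm n k i = (if i = n \<and> k \<le> n then k else if k \<le> i \<and> i < n then Suc i else i)"

lemma ins_perm_permutes: "ins_perm n k permutes {..n}"
proof (rule bij_imp_permutes)
  have "inj (ins_perm n k)"
    by (rule injI) (auto simp: ins_perm_def split: if_splits)
  then have "inj_on (ins_perm n k) {..n}"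
    by (rule inj_on_subset) simp
  moreover have "ins_perm n k ` {..n} \<subseteq> {..n}"
    by (auto simp: ins_perm_def)
  ultimately show "bij_betw (ins_perm n k) {..n} {..n}"
    by (simp add: bij_betw_def endo_inj_surj)
qed (auto simp: ins_perm_def)

lemma ins_perm_bij [simp]: "bij (ins_perm n k)"
  using ins_perm_permutes permutes_bij by blast

lemma ins_perm_last [simp]: "k \<le> n \<Longrightarrow> ins_perm n k n = k"
  by (simp add: ins_perm_def)

lemma ins_perm_self: "ins_perm n n = id"
  by (auto simp: ins_perm_def fun_eq_iff)

lemma ins_perm_Suc: "k < n \<Longrightarrow> ins_perm n k = transpose k (Suc k) \<circ> ins_perm n (Suc k)"
  by (auto simp: ins_perm_def fun_eq_iff transpose_def)

lemma ins_perm_Suc': "k < n \<Longrightarrow> ins_perm n (Suc k) = transpose k (Suc k) \<circ> ins_perm n k"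
  by (simp add: ins_perm_Suc flip: comp_assoc)

lemma transpose_ins_perm_less:
  "Suc a < k \<Longrightarrow> k \<le> n \<Longrightarrow> transpose a (Suc a) \<circ> ins_perm n k = ins_perm n k \<circ> transpose a (Suc a)"
  by (auto simp: ins_perm_def fun_eq_iff transpose_def)

lemma transpose_ins_perm_greater:
  "k \<le> a \<Longrightarrow> Suc a < n \<Longrightarrow>
     transpose (Suc a) (Suc (Suc a)) \<circ> ins_perm n k = ins_perm n k \<circ> transpose a (Suc a)"
  by (auto simp: ins_perm_def fun_eq_iff transpose_def)

text \<open>The other factor of the coset decomposition: what remains of a permutation of
  \<open>{..n}\<close> once the cycle carrying \<open>n\<close> to \<open>\<sigma> n\<close> is
  undone. It fixes \<open>n\<close>.\<close>

definition perm_del :: "nat \<Rightarrow> (nat \<Rightarrow> nat) \<Rightarrow> nat \<Rightarrow> nat" where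
  "perm_del n \<sigma> = inv_into UNIV (ins_perm n (\<sigma> n)) \<circ> \<sigma>"

lemma perm_del_eqI: "\<sigma> = ins_perm n (\<sigma> n) \<circ> \<tau> \<Longrightarrow> perm_del n \<sigma> = \<tau>"
  unfolding perm_del_def by (metis ins_perm_bij bij_is_inj fun.map_comp id_comp inv_o_cancel)

lemma ins_perm_perm_del: "ins_perm n (\<sigma> n) \<circ> perm_del n \<sigma> = \<sigma>"
  unfolding perm_del_def comp_assoc[symmetric]
  using ins_perm_bij by (metis bij_is_surj comp_id id_comp surj_iff)

lemma permutes_le:
  assumes "\<sigma> permutes {..<Suc n}" shows "\<sigma> n \<le> n"
  using permutes_in_image[OF assms, of n] by simp

lemma perm_del_permutes:
  assumes "\<sigma> permutes {..<Suc n}"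
  shows "perm_del n \<sigma> permutes {..<n}"
proof (rule permutes_superset[where S = "{..n}"])
  show "perm_del n \<sigma> permutes {..n}"
    unfolding perm_del_def using assms ins_perm_permutes
    by (intro permutes_compose permutes_inv) (simp_all add: lessThan_Suc_atMost)
  fix x assume "x \<in> {..n} - {..<n}"
  then have "x = n" by auto
  then show "perm_del n \<sigma> x = x"
    using permutes_le[OF assms] by (auto simp: perm_del_def bij_is_inj inv_f_eq)
qed

lemma permutes_lessThan_Suc: "\<sigma> permutes {..<n} \<Longrightarrow> \<sigma> permutes {..<Suc n}"
  by (rule permutes_subset) auto

lemma ins_perm_comp_permutes: "\<tau> permutes {..<n} \<Longrightarrow> ins_perm n k \<circ> \<tau> permutes {..<Suc n}"
  using permutes_compose[OF permutes_lessThan_Suc ins_perm_permutes[of n k, folded lessThan_Suc_atMost]] .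

lemma permutes_fixes: "\<tau> permutes {..<n} \<Longrightarrow> \<tau> n = n" for n :: nat
  using permutes_not_in by fastforce

lemma perm_del_ins_perm:
  assumes "\<tau> permutes {..<n}" "k \<le> n"
  shows "(ins_perm n k \<circ> \<tau>) n = k" "perm_del n (ins_perm n k \<circ> \<tau>) = \<tau>"
  using assms by (auto simp: permutes_fixes intro!: perm_del_eqI)

lemma permutes_Suc_eq:
  "{\<sigma>. \<sigma> permutes {..<Suc n}} =
     (\<lambda>(\<tau>, k). ins_perm n k \<circ> \<tau>) ` ({\<tau>. \<tau> permutes {..<n}} \<times> {..n})"
  (is "?L = ?f ` ?R")
proof (intro subset_antisym subsetI)
  fix \<sigma> assume "\<sigma> \<in> ?L"
  then have "\<sigma> = ?f (perm_del n \<sigma>, \<sigma> n)" "perm_del n \<sigma> permutes {..<n}" "\<sigma> n \<le> n"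
    using ins_perm_perm_del perm_del_permutes permutes_le by auto
  then show "\<sigma> \<in> ?f ` ?R"
    by blast
qed (auto intro: ins_perm_comp_permutes)

lemma inj_on_ins_perm:
  "inj_on (\<lambda>(\<tau>, k). ins_perm n k \<circ> \<tau>) ({\<tau>. \<tau> permutes {..<n}} \<times> {..n})"
  by (rule inj_onI) (clarsimp, metis perm_del_ins_perm)

lemma transpose_Suc_permutes: "Suc a < n \<Longrightarrow> transpose a (Suc a) permutes {..<n}"
  by (intro permutes_swap_id) auto

text \<open>After the cycle at the last point is peeled off, \<open>ins_perm_Suc\<close> resolves
  that cycle into adjacent transpositions. The step multiplies on the left, matching
  \<open>pm_transpose_comp\<close>.\<close>

lemma adjacent_induct [consumes 1, case_names id step]:
  assumes "\<sigma> permutes {..<n}" "P id"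
    and "\<And>a \<tau>. Suc a < n \<Longrightarrow> \<tau> permutes {..<n} \<Longrightarrow> P \<tau> \<Longrightarrow> P (transpose a (Suc a) \<circ> \<tau>)"
  shows "P \<sigma>"
  using assms
proof (induction n arbitrary: \<sigma>)
  case (Suc n)
  let ?\<tau> = "perm_del n \<sigma>" and ?k = "\<sigma> n"
  have \<tau>: "?\<tau> permutes {..<n}" by (rule perm_del_permutes) fact
  have "P ?\<tau>" using \<tau>
    by (rule Suc.IH[OF _ Suc.prems(2)]) (rule Suc.prems(3), simp_all add: permutes_lessThan_Suc)
  \<comment> \<open>Descend from \<open>k = n\<close>, where the cycle is trivial, to
    \<open>k = \<sigma> n\<close>, one transposition at a time.\<close>
  have "P (ins_perm n k \<circ> ?\<tau>)" if "k \<le> n" for k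
    using that
  proof (induction rule: inc_induct)
    case base
    show "P (ins_perm n n \<circ> ?\<tau>)" using \<open>P ?\<tau>\<close> by (simp add: ins_perm_self)
  next
    case (step k)
    have "P (transpose k (Suc k) \<circ> (ins_perm n (Suc k) \<circ> ?\<tau>))"
      using step.hyps by (intro Suc.prems(3)[OF _ ins_perm_comp_permutes[OF \<tau>] step.IH]) simp
    then show "P (ins_perm n k \<circ> ?\<tau>)"
      using step by (simp add: ins_perm_Suc[of k] comp_assoc)
  qed
  from this[of ?k] show ?case
    using permutes_le[OF Suc.prems(1)] by (simp add: ins_perm_perm_del)
qed simp

section \<open>The permutation action on tensor powers\<close>

context smc_power
begin

text \<open>Recursion over the cosets of the stabilizer of the last point: act on the first
  \<open>n\<close> factors, then insert the last one. No word in transpositions is chosen, so there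
  is no well-definedness to prove.\<close>

primrec pm :: "nat \<Rightarrow> (nat \<Rightarrow> nat) \<Rightarrow> 'a" where
  "pm 0 \<sigma> = J 0"
| "pm (Suc n) \<sigma> = pm n (perm_del n \<sigma>) \<otimes> J (Suc 0) ;; cyc (\<sigma> n) (n - \<sigma> n)"

lemma pm_arr_aux: "\<sigma> permutes {..<n} \<Longrightarrow> pm n \<sigma> \<in> arrs C \<and> src C (pm n \<sigma>) = pw n \<and> tgt C (pm n \<sigma>) = pw n"
proof (induction n arbitrary: \<sigma>)
  case (Suc n)
  then show ?case
    using perm_del_permutes[OF Suc.prems] permutes_le[OF Suc.prems] by simp
qed simp

lemma pm_arr [simp]:
  assumes "\<sigma> permutes {..<n}"
  shows "pm n \<sigma> \<in> arrs C" "src C (pm n \<sigma>) = pw n" "tgt C (pm n \<sigma>) = pw n"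
  using pm_arr_aux[OF assms] by auto

lemma pm_ins_perm:
  "\<tau> permutes {..<n} \<Longrightarrow> k \<le> n \<Longrightarrow> pm (Suc n) (ins_perm n k \<circ> \<tau>) = pm n \<tau> \<otimes> J (Suc 0) ;; cyc k (n - k)"
  using perm_del_ins_perm by simp

declare pm.simps(2) [simp del]

lemma pm_id [simp]: "pm n id = J n"
proof (induction n)
  case (Suc n)
  have "pm n id = J n" by (rule Suc)
  then have "pm (Suc n) (ins_perm n n \<circ> id) = J (Suc n)"
    by (simp add: pm_ins_perm permutes_id del: comp_id)
  then show "pm (Suc n) id = J (Suc n)"
    by (simp only: ins_perm_self comp_id)
qed simp

text \<open>The cases compare the transposition with the image \<open>k\<close> of the last point.
  Away from \<open>k\<close> it slides through the insertion cycle and becomes a transposition of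
  the first \<open>n\<close> factors, where the induction hypothesis applies. Next to
  \<open>k\<close> it only lengthens or shortens the cycle.\<close>

lemma pm_transpose_comp:
  "\<sigma> permutes {..<n} \<Longrightarrow> Suc a < n \<Longrightarrow>
     pm n (transpose a (Suc a) \<circ> \<sigma>) = pm n \<sigma> ;; tr a (n - a - 2)"
proof (induction n arbitrary: \<sigma> a)
  case (Suc n)
  define k \<tau> where "k = \<sigma> n" and "\<tau> = perm_del n \<sigma>"
  have \<tau> [simp]: "\<tau> permutes {..<n}" and k: "k \<le> n" and \<sigma>: "\<sigma> = ins_perm n k \<circ> \<tau>"
    using Suc.prems perm_del_permutes permutes_le ins_perm_perm_del by (auto simp: k_def \<tau>_def)
  let ?s = "transpose a (Suc a)"
  consider "Suc a < k" | "Suc a = k" | "a = k" | "k < a" by linarith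
  then show "pm (Suc n) (?s \<circ> \<sigma>) = pm (Suc n) \<sigma> ;; tr a (Suc n - a - 2)"
  proof cases
    case 1
    then obtain b where b: "k = Suc (Suc (a + b))" using that[of "k - a - 2"] by simp
    obtain m where m: "n = k + m" using k le_Suc_ex by blast
    have "?s \<circ> \<sigma> = ins_perm n k \<circ> (?s \<circ> \<tau>)"
      using transpose_ins_perm_less[OF 1 k] by (simp add: \<sigma> comp_assoc[symmetric])
    moreover have "?s \<circ> \<tau> permutes {..<n}"
      using 1 k by (intro permutes_compose \<tau> transpose_Suc_permutes) simp
    moreover have "pm n (?s \<circ> \<tau>) = pm n \<tau> ;; tr a (n - a - 2)"
      using 1 k by (intro Suc.IH \<tau>) simp
    ultimately have "pm (Suc n) (?s \<circ> \<sigma>) = (pm n \<tau> ;; tr a (b + m)) \<otimes> J (Suc 0) ;; cyc k m"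
      using k by (simp add: pm_ins_perm m b)
    also have "\<dots> = pm n \<tau> \<otimes> J (Suc 0) ;; (tr a (b + m) \<otimes> J (Suc 0) ;; cyc k m)"
      by (simp add: whisker m b add.assoc \<tau>[unfolded m b, simplified add_Suc add.assoc])
    also have "\<dots> = pm n \<tau> \<otimes> J (Suc 0) ;; (cyc k m ;; tr a (Suc (b + m)))"
      by (simp only: cyc_tr_less b)
    also have "\<dots> = pm (Suc n) \<sigma> ;; tr a (Suc n - a - 2)"
      using k by (simp add: pm_ins_perm \<sigma> m b add.assoc \<tau>[unfolded m b, simplified add_Suc add.assoc])
    finally show "pm (Suc n) (?s \<circ> \<sigma>) = pm (Suc n) \<sigma> ;; tr a (Suc n - a - 2)" .
  next
    case 2
    obtain m where m: "n = k + m" using k le_Suc_ex by blast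
    have "?s \<circ> \<sigma> = ins_perm n a \<circ> \<tau>"
      using ins_perm_Suc[of a n] k 2 by (simp add: \<sigma> comp_assoc[symmetric])
    then show "pm (Suc n) (?s \<circ> \<sigma>) = pm (Suc n) \<sigma> ;; tr a (Suc n - a - 2)"
      using cyc_Suc[of a m] k \<tau> unfolding \<sigma> m 2[symmetric]
      by (simp add: pm_ins_perm)
  next
    case 3
    then obtain m where m: "n = Suc k + m" using Suc.prems(2) that[of "n - k - 1"] by simp
    have "?s \<circ> \<sigma> = ins_perm n (Suc k) \<circ> \<tau>"
      using ins_perm_Suc'[of a n] m 3 by (simp add: \<sigma> comp_assoc[symmetric])
    \<comment> \<open>The swap cancels against the final one in \<open>cyc_Suc\<close>; involutivity
      of the symmetry enters here, through \<open>tr_tr\<close>.\<close>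
    moreover have "cyc k (Suc m) ;; tr k m = cyc (Suc k) m"
      by (simp add: cyc_Suc)
    ultimately show "pm (Suc n) (?s \<circ> \<sigma>) = pm (Suc n) \<sigma> ;; tr a (Suc n - a - 2)"
      using 3 \<tau> unfolding \<sigma> by (simp add: pm_ins_perm m)
  next
    case 4
    then obtain c where c: "a = Suc (k + c)" using that[of "a - k - 1"] by simp
    then obtain b where b: "n = k + Suc (Suc (c + b))"
      using Suc.prems(2) that[of "n - k - c - 2"] by simp
    have "?s \<circ> \<sigma> = ins_perm n k \<circ> (transpose (k + c) (Suc (k + c)) \<circ> \<tau>)"
      using transpose_ins_perm_greater[of k "k + c" n] by (simp add: \<sigma> comp_assoc[symmetric] b c)
    moreover have "transpose (k + c) (Suc (k + c)) \<circ> \<tau> permutes {..<n}"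
      using b by (intro permutes_compose \<tau> transpose_Suc_permutes) simp
    moreover have "pm n (transpose (k + c) (Suc (k + c)) \<circ> \<tau>) = pm n \<tau> ;; tr (k + c) (n - (k + c) - 2)"
      using b by (intro Suc.IH \<tau>) simp
    ultimately show "pm (Suc n) (?s \<circ> \<sigma>) = pm (Suc n) \<sigma> ;; tr a (Suc n - a - 2)"
      using cyc_tr_greater[of k c b] k \<tau> unfolding \<sigma>
      by (simp add: pm_ins_perm b c whisker add.assoc)
  qed
qed simp

lemma transpose_split: "Suc a < n \<Longrightarrow> \<exists>b. n = Suc (Suc (a + b))"
  by presburger

lemma pm_transpose: "Suc a < n \<Longrightarrow> pm n (transpose a (Suc a)) = tr a (n - a - 2)"
  using pm_transpose_comp[of id n a] transpose_split[of a n] by (auto simp: permutes_id)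

lemma pm_comp:
  assumes "\<sigma> permutes {..<n}" "\<tau> permutes {..<n}"
  shows "pm n (\<tau> \<circ> \<sigma>) = pm n \<sigma> ;; pm n \<tau>"
  using assms(2)
proof (induction rule: adjacent_induct)
  case id
  show "pm n (id \<circ> \<sigma>) = pm n \<sigma> ;; pm n id" using assms by simp
next
  case (step a \<tau>)
  have IH: "pm n (\<tau> \<circ> \<sigma>) = pm n \<sigma> ;; pm n \<tau>" by (rule step.IH)
  obtain b where "n = Suc (Suc (a + b))" using step.hyps transpose_split by blast
  then show "pm n (transpose a (Suc a) \<circ> \<tau> \<circ> \<sigma>) = pm n \<sigma> ;; pm n (transpose a (Suc a) \<circ> \<tau>)"
    using assms(1) step.hyps IH by (simp add: comp_assoc pm_transpose_comp permutes_compose)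
qed

lemma tr_defs_form:
  "\<i>\<d> (tpow_ob C A a) \<otimes> \<gamma> A A \<otimes> \<i>\<d> (tpow_ob C A b) = tr a b"
  using base_obj pw_obj by (simp add: tr_def pw_1 flip: pw_def)

lemma is_perm_action_pm: "is_perm_action C A n (pm n)"
  unfolding is_perm_action_def tr_defs_form
  by (simp add: pm_transpose pm_comp Hom_iff flip: pw_def)

lemma is_perm_action_unique:
  assumes "is_perm_action C A n \<rho>" "\<sigma> permutes {..<n}"
  shows "\<rho> \<sigma> = pm n \<sigma>"
  using assms(2)
proof (induction rule: adjacent_induct)
  case id
  show "\<rho> id = pm n id" using assms(1) by (simp add: is_perm_action_def pw_def)
next
  case (step a \<tau>)
  have "\<rho> (transpose a (Suc a) \<circ> \<tau>) = \<rho> \<tau> ;; \<rho> (transpose a (Suc a))"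
    "\<rho> (transpose a (Suc a)) = tr a (n - a - 2)"
    using assms(1) step.hyps transpose_Suc_permutes unfolding is_perm_action_def tr_defs_form by auto
  then show "\<rho> (transpose a (Suc a) \<circ> \<tau>) = pm n (transpose a (Suc a) \<circ> \<tau>)"
    using step.hyps step.IH by (simp add: pm_transpose_comp)
qed

lemma perm_map_eq: "\<sigma> permutes {..<n} \<Longrightarrow> perm_map C A n \<sigma> = pm n \<sigma>"
  unfolding perm_map_def using is_perm_action_pm is_perm_action_unique by (intro the_equality) blast+

text \<open>The monoid generated by adjacent transpositions. Invariance of an arrow is checked on
  generators and then holds for cycles, block symmetries and whiskered permutations, without naming
  the underlying permutations.\<close>

inductive_set gen :: "nat \<Rightarrow> 'a set" for n where
  id: "J n \<in> gen n"
| tr: "f \<in> gen n \<Longrightarrow> n = Suc (Suc (a + b)) \<Longrightarrow> f ;; tr a b \<in> gen n"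

lemma gen_arr_aux: "f \<in> gen n \<Longrightarrow> f \<in> arrs C \<and> src C f = pw n \<and> tgt C f = pw n"
  by (induction rule: gen.induct) auto

lemma gen_arr [simp]:
  assumes "f \<in> gen n" shows "f \<in> arrs C" "src C f = pw n" "tgt C f = pw n"
  using gen_arr_aux[OF assms] by auto

lemma gen_cmp:
  assumes "g \<in> gen n" "f \<in> gen n" shows "f ;; g \<in> gen n"
  using assms
  by (induction rule: gen.induct) (auto simp flip: cmp_assoc_arr intro: gen.tr)

lemma gen_tr: "tr a b \<in> gen (Suc (Suc (a + b)))"
  using gen.tr[OF gen.id refl, of a b] by simp

lemma gen_whisker: "f \<in> gen n \<Longrightarrow> J a \<otimes> f \<otimes> J b \<in> gen (a + n + b)"
proof (induction rule: gen.induct)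
  case id
  then show ?case by (simp add: gen.id)
next
  case (tr f c d)
  have "(J a \<otimes> f \<otimes> J b) ;; tr (a + c) (d + b) \<in> gen (a + n + b)"
    by (rule gen.tr) (use tr in auto)
  moreover have "tr (a + c) (d + b) = J a \<otimes> (tr c d \<otimes> J b)"
    by simp
  ultimately show ?case
    using tr by (simp add: ichg del: tr_tens)
qed

lemma gen_whisker_right: "f \<in> gen n \<Longrightarrow> f \<otimes> J b \<in> gen (n + b)"
  using gen_whisker[of f n 0 b] by simp

lemma gen_cyc: "cyc k m \<in> gen (Suc (k + m))"
proof (induction m arbitrary: k)
  case 0
  then show ?case using gen.id by simp
next
  case (Suc m)
  then show ?case
    using gen_cmp[OF gen_tr[of k m] Suc[of "Suc k", simplified]] by (simp add: cyc_Suc)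
qed

text \<open>Induction on the right block: the hexagon passes one further factor across the left
  block, and that is a cycle.\<close>

lemma gen_symm: "\<gamma> (pw m) (pw n) \<in> gen (m + n)"
proof (induction n)
  case 0
  then show ?case using gen.id by simp
next
  case (Suc n)
  have "\<gamma> (pw m) (pw n) \<otimes> J (Suc 0) \<in> gen (Suc (m + n))" "cyc n m \<in> gen (Suc (m + n))"
    using gen_whisker_right[OF Suc, of "Suc 0"] gen_cyc[of n m] by (simp_all add: add.commute)
  from gen_cmp[OF this(2,1)] show ?case
    using symm_pw_add2[of "pw m" n "Suc 0"] by (simp add: cyc_def)
qed

lemma gen_pm: "\<sigma> permutes {..<n} \<Longrightarrow> pm n \<sigma> \<in> gen n"
proof (induction rule: adjacent_induct)
  case (step a \<tau>)
  obtain b where "n = Suc (Suc (a + b))" using step.hyps transpose_split by blast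
  then show "pm n (transpose a (Suc a) \<circ> \<tau>) \<in> gen n"
    using gen.tr[of "pm n \<tau>" n a b] step.hyps step.IH by (simp add: pm_transpose_comp)
next
  case id
  show "pm n id \<in> gen n" by (simp add: gen.id)
qed

lemma gen_absorb_right:
  assumes "f \<in> gen n" "g \<in> arrs C" "src C g = pw n"
    and "\<And>a b. n = Suc (Suc (a + b)) \<Longrightarrow> tr a b ;; g = g"
  shows "f ;; g = g"
  using assms by (induction rule: gen.induct) simp_all

lemma gen_absorb_left:
  assumes "f \<in> gen n" "g \<in> arrs C" "tgt C g = pw n"
    and "\<And>a b. n = Suc (Suc (a + b)) \<Longrightarrow> g ;; tr a b = g"
  shows "g ;; f = g"
  using assms by (induction rule: gen.induct) (simp_all flip: cmp_assoc_arr)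

end

section \<open>Finite sums of morphisms\<close>

context linear_symmetric_monoidal_category
begin

lemma hom_monoid_simps [simp]:
  "carrier (hom_monoid C A B) = Hom C A B"
  "monoid.mult (hom_monoid C A B) = hadd C"
  "one (hom_monoid C A B) = hzero C A B"
  by (simp_all add: hom_monoid_def)

lemma hadd_Hom: "f \<in> Hom C A B \<Longrightarrow> g \<in> Hom C A B \<Longrightarrow> f \<oplus>\<^sub>h g \<in> Hom C A B"
  using comm_monoid.axioms(1)[OF hom_comm_monoid, of A B] HomD(4,5)[of f A B]
    monoid.m_closed[of "hom_monoid C A B" f g] by simp

lemma hzero_Hom: "A \<in> objs C \<Longrightarrow> B \<in> objs C \<Longrightarrow> hzero C A B \<in> Hom C A B"
  using comm_monoid.axioms(1)[OF hom_comm_monoid, of A B] monoid.one_closed[of "hom_monoid C A B"]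
  by simp

lemma hadd_arr [simp]:
  assumes "f \<in> arrs C" "g \<in> arrs C" "src C f = src C g" "tgt C f = tgt C g"
  shows "f \<oplus>\<^sub>h g \<in> arrs C" "src C (f \<oplus>\<^sub>h g) = src C g" "tgt C (f \<oplus>\<^sub>h g) = tgt C g"
  using hadd_Hom[of f "src C g" "tgt C g" g] assms by (auto simp: Hom_def)

lemma smul_arr [simp]:
  assumes "0 \<le> p" "f \<in> arrs C"
  shows "p \<cdot> f \<in> arrs C" "src C (p \<cdot> f) = src C f" "tgt C (p \<cdot> f) = tgt C f"
  using smul_Hom[of p f "src C f" "tgt C f"] assms by (auto simp: Hom_def)

lemma smul_cmp_arr [simp]:
  assumes "0 \<le> p" "f \<in> arrs C" "g \<in> arrs C" "tgt C f = src C g"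
  shows "(p \<cdot> f) ;; g = p \<cdot> (f ;; g)" "f ;; (p \<cdot> g) = p \<cdot> (f ;; g)"
  using smul_cmp[of p f "src C f" "tgt C f" g "tgt C g"]
    cmp_smul[of p f "src C f" "tgt C f" g "tgt C g"] assms by (auto simp: Hom_def)

lemma smul_tens_arr [simp]:
  assumes "0 \<le> p" "f \<in> arrs C" "g \<in> arrs C"
  shows "(p \<cdot> f) \<otimes> g = p \<cdot> (f \<otimes> g)" "f \<otimes> (p \<cdot> g) = p \<cdot> (f \<otimes> g)"
  using smul_tens[of p f "src C f" "tgt C f" g "src C g" "tgt C g"]
    tens_smul[of p f "src C f" "tgt C f" g "src C g" "tgt C g"] assms by (auto simp: Hom_def)

lemma smul_smul [simp]:
  "0 \<le> p \<Longrightarrow> 0 \<le> q \<Longrightarrow> f \<in> arrs C \<Longrightarrow> p \<cdot> (q \<cdot> f) = (p * q) \<cdot> f"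
  using mult_smul[of p q f "src C f" "tgt C f"] by (auto simp: Hom_def)

lemma one_smul_arr [simp]: "f \<in> arrs C \<Longrightarrow> 1 \<cdot> f = f"
  using one_smul[of f "src C f" "tgt C f"] by (auto simp: Hom_def)

lemma smul_hadd_arr:
  "0 \<le> p \<Longrightarrow> f \<in> arrs C \<Longrightarrow> g \<in> arrs C \<Longrightarrow> src C f = src C g \<Longrightarrow> tgt C f = tgt C g \<Longrightarrow>
     p \<cdot> (f \<oplus>\<^sub>h g) = p \<cdot> f \<oplus>\<^sub>h p \<cdot> g"
  using smul_hadd[of p f "src C f" "tgt C f" g] by (auto simp: Hom_def)

lemma hadd_cmp_arr:
  "f \<in> arrs C \<Longrightarrow> f' \<in> arrs C \<Longrightarrow> g \<in> arrs C \<Longrightarrow> src C f = src C f' \<Longrightarrow> tgt C f = tgt C f' \<Longrightarrow>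
     tgt C f' = src C g \<Longrightarrow> (f \<oplus>\<^sub>h f') ;; g = (f ;; g) \<oplus>\<^sub>h (f' ;; g)"
  using hadd_cmp[of f "src C f" "tgt C f" f' g "tgt C g"] by (auto simp: Hom_def)

lemma cmp_hadd_arr:
  "f \<in> arrs C \<Longrightarrow> g \<in> arrs C \<Longrightarrow> g' \<in> arrs C \<Longrightarrow> src C g = src C g' \<Longrightarrow> tgt C g = tgt C g' \<Longrightarrow>
     tgt C f = src C g' \<Longrightarrow> f ;; (g \<oplus>\<^sub>h g') = (f ;; g) \<oplus>\<^sub>h (f ;; g')"
  using cmp_hadd[of f "src C f" "tgt C f" g "tgt C g" g'] by (auto simp: Hom_def)

lemma hom_sum_Hom:
  assumes "A \<in> objs C" "B \<in> objs C" "\<And>i. i \<in> S \<Longrightarrow> f i \<in> Hom C A B"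
  shows "hom_sum C A B f S \<in> Hom C A B"
  unfolding hom_sum_def
  using comm_monoid.finprod_closed[OF hom_comm_monoid[OF assms(1,2)], of f S] assms(3) by auto

lemma hom_sum_empty: "A \<in> objs C \<Longrightarrow> B \<in> objs C \<Longrightarrow> hom_sum C A B f {} = hzero C A B"
  unfolding hom_sum_def using comm_monoid.finprod_empty[OF hom_comm_monoid] by simp

lemma hom_sum_insert:
  assumes "A \<in> objs C" "B \<in> objs C" "\<And>i. i \<in> insert x S \<Longrightarrow> f i \<in> Hom C A B" "finite S" "x \<notin> S"
  shows "hom_sum C A B f (insert x S) = f x \<oplus>\<^sub>h hom_sum C A B f S"
  unfolding hom_sum_def
  using comm_monoid.finprod_insert[OF hom_comm_monoid[OF assms(1,2)] assms(4,5), of f] assms(3)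
  by auto

lemma hom_sum_cong:
  assumes "A \<in> objs C" "B \<in> objs C" "S = T" "\<And>i. i \<in> T \<Longrightarrow> f i = g i"
    "\<And>i. i \<in> T \<Longrightarrow> g i \<in> Hom C A B"
  shows "hom_sum C A B f S = hom_sum C A B g T"
  unfolding hom_sum_def
  using comm_monoid.finprod_cong'[OF hom_comm_monoid[OF assms(1,2)] assms(3), of g f] assms(4,5)
  by auto

lemma hom_sum_reindex:
  assumes "A \<in> objs C" "B \<in> objs C" "inj_on h S" "\<And>i. i \<in> S \<Longrightarrow> f (h i) \<in> Hom C A B"
  shows "hom_sum C A B f (h ` S) = hom_sum C A B (\<lambda>i. f (h i)) S"
  unfolding hom_sum_def
  using comm_monoid.finprod_reindex[OF hom_comm_monoid[OF assms(1,2)] _ assms(3), of f] assms(4)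
  by auto

lemma hom_sum_Un:
  assumes "A \<in> objs C" "B \<in> objs C" "finite S" "finite T" "S \<inter> T = {}"
    "\<And>i. i \<in> S \<union> T \<Longrightarrow> f i \<in> Hom C A B"
  shows "hom_sum C A B f (S \<union> T) = hom_sum C A B f S \<oplus>\<^sub>h hom_sum C A B f T"
  unfolding hom_sum_def
  using comm_monoid.finprod_Un_disjoint[OF hom_comm_monoid[OF assms(1,2)] assms(3,4,5), of f] assms(6)
  by auto

lemma hzero_hadd:
  assumes "f \<in> Hom C A B"
  shows "hzero C A B \<oplus>\<^sub>h f = f" "f \<oplus>\<^sub>h hzero C A B = f"
  using comm_monoid.axioms(1)[OF hom_comm_monoid, of A B] HomD[OF assms] assms
    monoid.l_one[of "hom_monoid C A B" f] monoid.r_one[of "hom_monoid C A B" f] by auto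

lemma hom_sum_singleton:
  assumes "f x \<in> Hom C A B"
  shows "hom_sum C A B f {x} = f x"
proof -
  have "A \<in> objs C" "B \<in> objs C" using HomD[OF assms] by auto
  then show ?thesis
    using hom_sum_insert[of A B x "{}" f] assms by (simp add: hom_sum_empty hzero_hadd)
qed

text \<open>Composition and tensoring, on either side, are additive maps between hom-sets;
  distributivity over finite sums is proved once and instantiated four times.\<close>

lemma hom_sum_hom:
  assumes "A \<in> objs C" "B \<in> objs C" "A' \<in> objs C" "B' \<in> objs C" "finite S"
    "\<And>i. i \<in> S \<Longrightarrow> f i \<in> Hom C A B"
    "\<And>f. f \<in> Hom C A B \<Longrightarrow> h f \<in> Hom C A' B'"
    "\<And>f g. f \<in> Hom C A B \<Longrightarrow> g \<in> Hom C A B \<Longrightarrow> h (f \<oplus>\<^sub>h g) = h f \<oplus>\<^sub>h h g"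
    "h (hzero C A B) = hzero C A' B'"
  shows "h (hom_sum C A B f S) = hom_sum C A' B' (\<lambda>i. h (f i)) S"
  using assms(5,6)
proof (induction S rule: finite_induct)
  case (insert x S)
  have "hom_sum C A B f S \<in> Hom C A B"
    using insert assms by (intro hom_sum_Hom) auto
  then have "h (f x \<oplus>\<^sub>h hom_sum C A B f S) = h (f x) \<oplus>\<^sub>h h (hom_sum C A B f S)"
    using insert by (intro assms(8)) auto
  then show ?case
    using insert assms(1-4,7) by (subst (1 2) hom_sum_insert) auto
qed (use assms in \<open>simp add: hom_sum_empty\<close>)

lemma hom_sum_cmp:
  assumes "A \<in> objs C" "g \<in> Hom C B D" "finite S" "\<And>i. i \<in> S \<Longrightarrow> f i \<in> Hom C A B"
  shows "hom_sum C A B f S ;; g = hom_sum C A D (\<lambda>i. f i ;; g) S"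
  using assms HomD(4,5)[OF assms(2)]
  by (intro hom_sum_hom) (auto intro: cmp_Hom hadd_cmp hzero_cmp)

lemma cmp_hom_sum:
  assumes "D \<in> objs C" "g \<in> Hom C A B" "finite S" "\<And>i. i \<in> S \<Longrightarrow> f i \<in> Hom C B D"
  shows "g ;; hom_sum C B D f S = hom_sum C A D (\<lambda>i. g ;; f i) S"
  using assms HomD(4,5)[OF assms(2)]
  by (intro hom_sum_hom) (auto intro: cmp_Hom cmp_hadd cmp_hzero)

lemma hom_sum_tens:
  assumes "A \<in> objs C" "B \<in> objs C" "g \<in> Hom C A' B'" "finite S" "\<And>i. i \<in> S \<Longrightarrow> f i \<in> Hom C A B"
  shows "hom_sum C A B f S \<otimes> g = hom_sum C (A \<otimes>\<^sub>o A') (B \<otimes>\<^sub>o B') (\<lambda>i. f i \<otimes> g) S"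
  using assms HomD(4,5)[OF assms(3)]
  by (intro hom_sum_hom) (auto intro: tens_Hom hadd_tens hzero_tens)

lemma tens_hom_sum:
  assumes "A' \<in> objs C" "B' \<in> objs C" "g \<in> Hom C A B" "finite S" "\<And>i. i \<in> S \<Longrightarrow> f i \<in> Hom C A' B'"
  shows "g \<otimes> hom_sum C A' B' f S = hom_sum C (A \<otimes>\<^sub>o A') (B \<otimes>\<^sub>o B') (\<lambda>i. g \<otimes> f i) S"
  using assms HomD(4,5)[OF assms(3)]
  by (intro hom_sum_hom) (auto intro: tens_Hom tens_hadd tens_hzero)

lemma hom_sum_const:
  assumes "g \<in> Hom C A B" "finite S"
  shows "hom_sum C A B (\<lambda>_. g) S = of_nat (card S) \<cdot> g"
  using assms(2)
proof (induction S rule: finite_induct)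
  case empty
  then show ?case using zero_smul[OF assms(1)] HomD[OF assms(1)] by (simp add: hom_sum_empty)
next
  case (insert x S)
  then show ?case
    using add_smul[of 1 "of_nat (card S)" g A B] HomD[OF assms(1)] assms(1)
    by (simp add: hom_sum_insert)
qed

lemma hom_sum_hadd:
  assumes "A \<in> objs C" "B \<in> objs C" "\<And>i. i \<in> S \<Longrightarrow> f i \<in> Hom C A B" "\<And>i. i \<in> S \<Longrightarrow> g i \<in> Hom C A B"
  shows "hom_sum C A B (\<lambda>i. f i \<oplus>\<^sub>h g i) S = hom_sum C A B f S \<oplus>\<^sub>h hom_sum C A B g S"
  unfolding hom_sum_def
  using comm_monoid.finprod_multf[OF hom_comm_monoid[OF assms(1,2)], of f S g] assms(3,4) by auto

lemma hom_sum_neutral: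
  assumes "A \<in> objs C" "B \<in> objs C" "finite T" "S \<subseteq> T"
    "\<And>i. i \<in> T - S \<Longrightarrow> f i = hzero C A B" "\<And>i. i \<in> S \<Longrightarrow> f i = g i"
    "\<And>i. i \<in> S \<Longrightarrow> g i \<in> Hom C A B"
  shows "hom_sum C A B f T = hom_sum C A B g S"
proof -
  have "\<And>i. i \<in> T \<Longrightarrow> f i \<in> Hom C A B"
    using assms hzero_Hom by (metis Diff_iff)
  then show ?thesis
    unfolding hom_sum_def
    using comm_monoid.finprod_mono_neutral_cong_right[OF hom_comm_monoid[OF assms(1,2)] assms(3,4), of f g]
      assms(5,6) by auto
qed

lemma hom_sum_Sigma:
  assumes "A \<in> objs C" "B \<in> objs C" "finite S" "finite T"
    "\<And>i j. i \<in> S \<Longrightarrow> j \<in> T \<Longrightarrow> f i j \<in> Hom C A B"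
  shows "hom_sum C A B (\<lambda>i. hom_sum C A B (f i) T) S = hom_sum C A B (\<lambda>(i, j). f i j) (S \<times> T)"
  using assms(3,5)
proof (induction S rule: finite_induct)
  case (insert x S)
  have "hom_sum C A B (\<lambda>(i, j). f i j) (insert x S \<times> T) =
      hom_sum C A B (\<lambda>(i, j). f i j) ((\<lambda>j. (x, j)) ` T \<union> S \<times> T)"
    by (rule arg_cong[where f = "hom_sum C A B _"]) auto
  also have "\<dots> = hom_sum C A B (\<lambda>(i, j). f i j) ((\<lambda>j. (x, j)) ` T) \<oplus>\<^sub>h
      hom_sum C A B (\<lambda>(i, j). f i j) (S \<times> T)"
    using insert assms by (intro hom_sum_Un) auto
  also have "hom_sum C A B (\<lambda>(i, j). f i j) ((\<lambda>j. (x, j)) ` T) = hom_sum C A B (f x) T"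
    using insert assms by (subst hom_sum_reindex) (auto simp: inj_on_def)
  finally show ?case
    using insert assms by (subst hom_sum_insert) (auto intro: hom_sum_Hom)
qed (use assms in \<open>simp add: hom_sum_empty\<close>)

end

section \<open>Symmetrizers and unshuffles\<close>

locale lin_power = linear_symmetric_monoidal_category C + smc_power C A
  for C :: "('o, 'a, 'x) lsmcat_scheme" (structure) and A :: 'o
begin

definition psum :: "nat \<Rightarrow> 'a" where
  "psum n = hom_sum C (pw n) (pw n) (pm n) {\<sigma>. \<sigma> permutes {..<n}}"

definition ins_sum :: "nat \<Rightarrow> 'a" where
  "ins_sum n = hom_sum C (pw (Suc n)) (pw (Suc n)) (\<lambda>k. cyc k (n - k)) {..n}"

lemma finite_perms [simp]: "finite {\<sigma>. \<sigma> permutes {..<n::nat}}"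
  by (rule finite_permutations) simp

lemma pm_Hom: "\<sigma> permutes {..<n} \<Longrightarrow> pm n \<sigma> \<in> Hom C (pw n) (pw n)"
  by (simp add: Hom_iff)

lemma psum_Hom: "psum n \<in> Hom C (pw n) (pw n)"
  unfolding psum_def by (rule hom_sum_Hom) (auto intro: pm_Hom)

lemma psum_arr [simp]: "psum n \<in> arrs C" "src C (psum n) = pw n" "tgt C (psum n) = pw n"
  using HomD[OF psum_Hom] by auto

lemma ins_sum_Hom: "ins_sum n \<in> Hom C (pw (Suc n)) (pw (Suc n))"
  unfolding ins_sum_def by (rule hom_sum_Hom) (auto simp: Hom_iff)

lemma ins_sum_arr [simp]: "ins_sum n \<in> arrs C" "src C (ins_sum n) = pw (Suc n)"
    "tgt C (ins_sum n) = pw (Suc n)"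
  using HomD[OF ins_sum_Hom] by auto

lemma perm_sum_eq_psum:
  "hom_sum C (tpow_ob C A n) (tpow_ob C A n) (perm_map C A n) {\<sigma>. \<sigma> permutes {..<n}} = psum n"
  unfolding psum_def pw_def[symmetric]
  by (rule hom_sum_cong) (auto simp: perm_map_eq pm_Hom)

lemma psum_0: "psum 0 = J 0"
  unfolding psum_def by (simp add: hom_sum_singleton Hom_iff)

lemma psum_Suc: "psum (Suc n) = psum n \<otimes> J (Suc 0) ;; ins_sum n"
proof -
  let ?H = "hom_sum C (pw (Suc n)) (pw (Suc n))" and ?S = "{\<tau>. \<tau> permutes {..<n}}"
  have mem: "pm n \<tau> \<otimes> J (Suc 0) ;; cyc k (n - k) \<in> Hom C (pw (Suc n)) (pw (Suc n))"
    if "\<tau> permutes {..<n}" "k \<le> n" for \<tau> k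
    using that by (simp add: Hom_iff)
  have "psum (Suc n) = ?H (\<lambda>p. pm (Suc n) ((\<lambda>(\<tau>, k). ins_perm n k \<circ> \<tau>) p)) (?S \<times> {..n})"
    unfolding psum_def permutes_Suc_eq using mem
    by (subst hom_sum_reindex) (auto simp: inj_on_ins_perm pm_ins_perm)
  also have "\<dots> = ?H (\<lambda>(\<tau>, k). pm n \<tau> \<otimes> J (Suc 0) ;; cyc k (n - k)) (?S \<times> {..n})"
    using mem by (intro hom_sum_cong) (auto simp: pm_ins_perm)
  also have "\<dots> = ?H (\<lambda>\<tau>. ?H (\<lambda>k. pm n \<tau> \<otimes> J (Suc 0) ;; cyc k (n - k)) {..n}) ?S"
    using mem by (subst hom_sum_Sigma) auto
  also have "\<dots> = ?H (\<lambda>\<tau>. pm n \<tau> \<otimes> J (Suc 0) ;; ins_sum n) ?S"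
  proof (rule hom_sum_cong)
    fix \<tau> assume "\<tau> \<in> ?S"
    then show "?H (\<lambda>k. pm n \<tau> \<otimes> J (Suc 0) ;; cyc k (n - k)) {..n} = pm n \<tau> \<otimes> J (Suc 0) ;; ins_sum n"
      unfolding ins_sum_def by (subst cmp_hom_sum) (auto simp: Hom_iff)
  qed (auto simp: Hom_iff)
  also have "\<dots> = ?H (\<lambda>\<tau>. pm n \<tau> \<otimes> J (Suc 0)) ?S ;; ins_sum n"
    by (rule hom_sum_cmp[symmetric]) (auto simp: Hom_iff)
  also have "?H (\<lambda>\<tau>. pm n \<tau> \<otimes> J (Suc 0)) ?S = psum n \<otimes> J (Suc 0)"
    unfolding psum_def by (subst hom_sum_tens) (auto simp: Hom_iff)
  finally show ?thesis .
qed

lemma ins_sum_0: "ins_sum 0 = J (Suc 0)"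
  unfolding ins_sum_def by (simp add: hom_sum_singleton Hom_iff)

text \<open>The insertion that leaves the last factor in place is split off; every other one begins
  by swapping the last two factors. This is the shape in which the bialgebra law delivers its two
  terms in \<open>nabla_Delta_Suc_1\<close>.\<close>

lemma ins_sum_Suc:
  "ins_sum (Suc n) = J (Suc (Suc n)) \<oplus>\<^sub>h (tr n 0 ;; ins_sum n \<otimes> J (Suc 0))"
proof -
  let ?H = "hom_sum C (pw (Suc (Suc n))) (pw (Suc (Suc n)))"
  have "ins_sum (Suc n) = ?H (\<lambda>k. cyc k (Suc n - k)) (insert (Suc n) {..n})"
    unfolding ins_sum_def atMost_Suc ..
  also have "\<dots> = J (Suc (Suc n)) \<oplus>\<^sub>h ?H (\<lambda>k. cyc k (Suc n - k)) {..n}"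
    by (subst hom_sum_insert) (auto simp: Hom_iff)
  also have "?H (\<lambda>k. cyc k (Suc n - k)) {..n} = ?H (\<lambda>k. tr n 0 ;; cyc k (n - k) \<otimes> J (Suc 0)) {..n}"
    by (rule hom_sum_cong) (auto simp: Suc_diff_le cyc_Suc' Hom_iff)
  also have "\<dots> = tr n 0 ;; ?H (\<lambda>k. cyc k (n - k) \<otimes> J (Suc 0)) {..n}"
    by (rule cmp_hom_sum[symmetric]) (auto simp: Hom_iff)
  also have "?H (\<lambda>k. cyc k (n - k) \<otimes> J (Suc 0)) {..n} = ins_sum n \<otimes> J (Suc 0)"
    unfolding ins_sum_def by (subst hom_sum_tens) (auto simp: Hom_iff)
  finally show ?thesis .
qed

text \<open>Left and right translation by a transposition are involutions on the set of
  permutations, so they merely reorder the sum.\<close>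

lemma tr_psum [simp]: "tr a b ;; psum (Suc (Suc (a + b))) = psum (Suc (Suc (a + b)))"
  and psum_tr [simp]: "psum (Suc (Suc (a + b))) ;; tr a b = psum (Suc (Suc (a + b)))"
proof -
  let ?n = "Suc (Suc (a + b))" and ?t = "transpose a (Suc a)"
  let ?S = "{\<sigma>. \<sigma> permutes {..<?n}}"
  have t: "?t permutes {..<?n}" by (rule transpose_Suc_permutes) simp
  have tr: "pm ?n ?t = tr a b" by (subst pm_transpose) simp_all
  have tt: "?t \<circ> (?t \<circ> \<sigma>) = \<sigma>" "(\<sigma> \<circ> ?t) \<circ> ?t = \<sigma>" for \<sigma> :: "nat \<Rightarrow> nat"
    by (simp_all add: fun_eq_iff)
  have inj: "inj_on (\<lambda>\<sigma>. ?t \<circ> \<sigma>) ?S" "inj_on (\<lambda>\<sigma>. \<sigma> \<circ> ?t) ?S"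
    by (rule inj_on_inverseI, rule tt)+
  have "(\<lambda>\<sigma>. ?t \<circ> \<sigma>) ` ?S \<subseteq> ?S" "(\<lambda>\<sigma>. \<sigma> \<circ> ?t) ` ?S \<subseteq> ?S"
    using t by (auto intro: permutes_compose)
  then have img: "(\<lambda>\<sigma>. ?t \<circ> \<sigma>) ` ?S = ?S" "(\<lambda>\<sigma>. \<sigma> \<circ> ?t) ` ?S = ?S"
    using inj by (simp_all add: endo_inj_surj)
  have "psum ?n ;; tr a b = hom_sum C (pw ?n) (pw ?n) (\<lambda>\<sigma>. pm ?n \<sigma> ;; tr a b) ?S"
    unfolding psum_def by (rule hom_sum_cmp) (auto simp: Hom_iff)
  also have "\<dots> = hom_sum C (pw ?n) (pw ?n) (\<lambda>\<sigma>. pm ?n (?t \<circ> \<sigma>)) ?S"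
    using t by (intro hom_sum_cong) (auto simp: pm_comp tr pm_Hom permutes_compose Hom_iff)
  also have "\<dots> = psum ?n"
    unfolding psum_def using t
    by (subst hom_sum_reindex[symmetric, OF _ _ inj(1)]) (auto simp: img pm_Hom permutes_compose)
  finally show "psum ?n ;; tr a b = psum ?n" .
  have "tr a b ;; psum ?n = hom_sum C (pw ?n) (pw ?n) (\<lambda>\<sigma>. tr a b ;; pm ?n \<sigma>) ?S"
    unfolding psum_def by (rule cmp_hom_sum) (auto simp: Hom_iff)
  also have "\<dots> = hom_sum C (pw ?n) (pw ?n) (\<lambda>\<sigma>. pm ?n (\<sigma> \<circ> ?t)) ?S"
    using t by (intro hom_sum_cong) (auto simp: pm_comp tr pm_Hom permutes_compose Hom_iff)
  also have "\<dots> = psum ?n"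
    unfolding psum_def using t
    by (subst hom_sum_reindex[symmetric, OF _ _ inj(2)]) (auto simp: img pm_Hom permutes_compose)
  finally show "tr a b ;; psum ?n = psum ?n" .
qed

text \<open>Every whiskered permutation lies in \<open>gen (a + n + b)\<close>, so the sum consists
  of \<open>n!\<close> copies of \<open>g\<close>.\<close>

lemma psum_absorb_right:
  assumes "g \<in> arrs C" "src C g = pw (a + n + b)"
    and abs: "\<And>f. f \<in> gen (a + n + b) \<Longrightarrow> f ;; g = g"
  shows "(J a \<otimes> psum n \<otimes> J b) ;; g = fact n \<cdot> g"
proof -
  let ?S = "{\<sigma>. \<sigma> permutes {..<n}}"
  have *: "J a \<otimes> psum n \<otimes> J b = hom_sum C (pw (a + n + b)) (pw (a + n + b)) (\<lambda>\<sigma>. J a \<otimes> pm n \<sigma> \<otimes> J b) ?S"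
    unfolding psum_def
    by (subst tens_hom_sum[where A = "pw a" and B = "pw a"], simp_all add: Hom_iff)
       (subst hom_sum_tens, auto simp: Hom_iff add.assoc)
  have "(J a \<otimes> psum n \<otimes> J b) ;; g = hom_sum C (pw (a + n + b)) (tgt C g) (\<lambda>\<sigma>. (J a \<otimes> pm n \<sigma> \<otimes> J b) ;; g) ?S"
    unfolding * using assms(1,2) by (intro hom_sum_cmp) (auto simp: Hom_iff add.assoc)
  also have "\<dots> = hom_sum C (pw (a + n + b)) (tgt C g) (\<lambda>\<sigma>. g) ?S"
  proof (rule hom_sum_cong)
    fix \<sigma> assume "\<sigma> \<in> ?S"
    then show "(J a \<otimes> pm n \<sigma> \<otimes> J b) ;; g = g"
      by (intro abs gen_whisker gen_pm) simp
  qed (use assms(1,2) in \<open>auto simp: Hom_iff\<close>)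
  also have "\<dots> = fact n \<cdot> g"
    using assms(1,2) by (subst hom_sum_const) (auto simp: Hom_iff card_permutations[of "{..<n}" n])
  finally show ?thesis .
qed

lemma psum_absorb_left:
  assumes "g \<in> arrs C" "tgt C g = pw (a + n + b)"
    and abs: "\<And>f. f \<in> gen (a + n + b) \<Longrightarrow> g ;; f = g"
  shows "g ;; (J a \<otimes> psum n \<otimes> J b) = fact n \<cdot> g"
proof -
  let ?S = "{\<sigma>. \<sigma> permutes {..<n}}"
  have *: "J a \<otimes> psum n \<otimes> J b = hom_sum C (pw (a + n + b)) (pw (a + n + b)) (\<lambda>\<sigma>. J a \<otimes> pm n \<sigma> \<otimes> J b) ?S"
    unfolding psum_def
    by (subst tens_hom_sum[where A = "pw a" and B = "pw a"], simp_all add: Hom_iff)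
       (subst hom_sum_tens, auto simp: Hom_iff add.assoc)
  have "g ;; (J a \<otimes> psum n \<otimes> J b) = hom_sum C (src C g) (pw (a + n + b)) (\<lambda>\<sigma>. g ;; (J a \<otimes> pm n \<sigma> \<otimes> J b)) ?S"
    unfolding * using assms(1,2) by (intro cmp_hom_sum) (auto simp: Hom_iff add.assoc)
  also have "\<dots> = hom_sum C (src C g) (pw (a + n + b)) (\<lambda>\<sigma>. g) ?S"
  proof (rule hom_sum_cong)
    fix \<sigma> assume "\<sigma> \<in> ?S"
    then show "g ;; (J a \<otimes> pm n \<sigma> \<otimes> J b) = g"
      by (intro abs gen_whisker gen_pm) simp
  qed (use assms(1,2) in \<open>auto simp: Hom_iff\<close>)
  also have "\<dots> = fact n \<cdot> g"
    using assms(1,2) by (subst hom_sum_const) (auto simp: Hom_iff card_permutations[of "{..<n}" n])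
  finally show ?thesis .
qed

text \<open>Think of \<open>q\<close> as the boundary of two blocks: \<open>g\<close> absorbs all
  swaps except the one straddling it. For \<open>q \<le> k\<close> the inserted factor never crosses
  the boundary.\<close>

lemma cyc_absorb_ge:
  assumes "g \<in> arrs C" "src C g = pw (Suc (k + m))" "q \<le> k"
    and "\<And>a b. Suc (Suc (a + b)) = Suc (k + m) \<Longrightarrow> Suc a \<noteq> q \<Longrightarrow> tr a b ;; g = g"
  shows "cyc k m ;; g = g"
  using assms
proof (induction m arbitrary: k)
  case (Suc m)
  have "tr k m ;; g = g" using Suc.prems by (intro Suc.prems(4)) auto
  moreover have "cyc (Suc k) m ;; g = g" using Suc.prems by (intro Suc.IH) auto
  ultimately show ?case using Suc.prems by (simp add: cyc_Suc)
qed simp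

text \<open>Here the first block has length \<open>k + j + 1\<close>. Insertion points inside it are
  equivalent modulo \<open>g\<close>; the chosen representative puts the factor last in that
  block.\<close>

lemma cyc_absorb_less:
  assumes "g \<in> arrs C" "src C g = pw (Suc (k + j + r))"
    and "\<And>a b. Suc (Suc (a + b)) = Suc (k + j + r) \<Longrightarrow> Suc a \<noteq> Suc (k + j) \<Longrightarrow> tr a b ;; g = g"
  shows "cyc k (j + r) ;; g = cyc (k + j) r ;; g"
  using assms
proof (induction j arbitrary: k)
  case (Suc j)
  have "tr k (j + r) ;; g = g" using Suc.prems by (intro Suc.prems(3)) auto
  moreover have "cyc (Suc k) (j + r) ;; g = cyc (Suc k + j) r ;; g"
    using Suc.prems by (intro Suc.IH) auto
  ultimately show ?case using Suc.prems by (simp add: cyc_Suc add.assoc)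
qed simp

text \<open>Count the insertion points by block: \<open>q + 1\<close> in the first, which all agree
  after \<open>g\<close>, and \<open>r\<close> in the second, where the insertion is
  absorbed.\<close>

lemma ins_sum_absorb:
  assumes g: "g \<in> arrs C" "src C g = pw (Suc (q + r))"
    and tr: "\<And>a b. a + b + 1 = q + r \<Longrightarrow> a \<noteq> q \<Longrightarrow> tr a b ;; g = g"
  shows "ins_sum (q + r) ;; g = of_nat (Suc q) \<cdot> (cyc q r ;; g) \<oplus>\<^sub>h of_nat r \<cdot> g"
proof -
  let ?n = "q + r"
  let ?H = "hom_sum C (pw (Suc ?n)) (tgt C g)"
  have "ins_sum ?n ;; g = ?H (\<lambda>k. cyc k (?n - k) ;; g) {..?n}"
    unfolding ins_sum_def using g by (intro hom_sum_cmp) (auto simp: Hom_iff)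
  also have "{..?n} = {..q} \<union> {Suc q..?n}"
    by auto
  also have "?H (\<lambda>k. cyc k (?n - k) ;; g) \<dots> =
      ?H (\<lambda>k. cyc k (?n - k) ;; g) {..q} \<oplus>\<^sub>h ?H (\<lambda>k. cyc k (?n - k) ;; g) {Suc q..?n}"
    using g by (intro hom_sum_Un) (auto simp: Hom_iff)
  also have "?H (\<lambda>k. cyc k (?n - k) ;; g) {..q} = ?H (\<lambda>_. cyc q r ;; g) {..q}"
  proof (rule hom_sum_cong)
    fix k assume "k \<in> {..q}"
    then obtain j where "q = k + j" using le_Suc_ex by auto
    then show "cyc k (?n - k) ;; g = cyc q r ;; g"
      using cyc_absorb_less[of g k j r] g tr by (auto simp: add.assoc)
  qed (use g in \<open>auto simp: Hom_iff\<close>)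
  also have "\<dots> = of_nat (Suc q) \<cdot> (cyc q r ;; g)"
    using g by (subst hom_sum_const) (auto simp: Hom_iff)
  also have "?H (\<lambda>k. cyc k (?n - k) ;; g) {Suc q..?n} = ?H (\<lambda>_. g) {Suc q..?n}"
    using g tr by (intro hom_sum_cong cyc_absorb_ge[where q = "Suc q"]) (auto simp: Hom_iff)
  also have "\<dots> = of_nat r \<cdot> g"
    using g by (subst hom_sum_const) (auto simp: Hom_iff)
  finally show ?thesis .
qed

text \<open>The case of an empty first block, which \<open>ins_sum_absorb\<close> excludes by giving
  that block length \<open>q + 1\<close>.\<close>

lemma ins_sum_absorb_all:
  assumes g: "g \<in> arrs C" "src C g = pw (Suc n)"
    and tr: "\<And>a b. a + b + 1 = n \<Longrightarrow> tr a b ;; g = g"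
  shows "ins_sum n ;; g = of_nat (Suc n) \<cdot> g"
proof -
  let ?H = "hom_sum C (pw (Suc n)) (tgt C g)"
  have "ins_sum n ;; g = ?H (\<lambda>k. cyc k (n - k) ;; g) {..n}"
    unfolding ins_sum_def using g by (intro hom_sum_cmp) (auto simp: Hom_iff)
  also have "\<dots> = ?H (\<lambda>_. g) {..n}"
    using g tr by (intro hom_sum_cong cyc_absorb_ge[where q = 0]) (auto simp: Hom_iff)
  also have "\<dots> = of_nat (Suc n) \<cdot> g"
    using g by (subst hom_sum_const) (auto simp: Hom_iff)
  finally show ?thesis .
qed

text \<open>Sum over all \<open>(q, r)\<close>-unshuffles, split according to the block receiving the last factor.\<close>

fun unsh :: "nat \<Rightarrow> nat \<Rightarrow> 'a" where
  "unsh 0 r = J r"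
| "unsh (Suc q) 0 = J (Suc q)"
| "unsh (Suc q) (Suc r) = (unsh q (Suc r) \<otimes> J (Suc 0) ;; cyc q (Suc r)) \<oplus>\<^sub>h unsh (Suc q) r \<otimes> J (Suc 0)"

lemma unsh_arr_aux: "unsh q r \<in> arrs C \<and> src C (unsh q r) = pw (q + r) \<and> tgt C (unsh q r) = pw (q + r)"
  by (induction q r rule: unsh.induct) simp_all

lemma unsh_arr [simp]: "unsh q r \<in> arrs C" "src C (unsh q r) = pw (q + r)" "tgt C (unsh q r) = pw (q + r)"
  using unsh_arr_aux by auto

lemma unsh_0 [simp]: "unsh q 0 = J q"
  by (cases q) simp_all

text \<open>The Pascal recursion made uniform: a zero arrow stands in when a block is empty, so that
  sums over splittings can be treated without boundary cases.\<close>

lemma unsh_rec: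
  assumes "q + r = Suc n"
  shows "unsh q r =
     (case q of 0 \<Rightarrow> hzero C (pw (Suc n)) (pw (Suc n)) | Suc q' \<Rightarrow> unsh q' r \<otimes> J (Suc 0) ;; cyc q' r) \<oplus>\<^sub>h
     (case r of 0 \<Rightarrow> hzero C (pw (Suc n)) (pw (Suc n)) | Suc r' \<Rightarrow> unsh q r' \<otimes> J (Suc 0))"
  using assms
  by (auto split: nat.splits simp: hzero_hadd Hom_iff)

definition blk :: "nat \<Rightarrow> nat \<Rightarrow> nat \<Rightarrow> nat \<Rightarrow> 'a" where
  "blk a b c d = J a \<otimes> (\<gamma> (pw b) (pw c) \<otimes> J d)"

lemma blk_arr [simp]: "blk a b c d \<in> arrs C" "src C (blk a b c d) = pw (a + b + c + d)"
    "tgt C (blk a b c d) = pw (a + c + b + d)"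
  by (simp_all add: blk_def add_ac)

text \<open>Both sides bring blocks of lengths \<open>a, b, c, d, 1\<close> into the order
  \<open>a, c, 1, b, d\<close>. The equality is the two hexagons, together with the fact that the
  swaps of \<open>b, c\<close> and of \<open>d, 1\<close> act on disjoint factors.\<close>

lemma cyc_blk:
  "J (a + b) \<otimes> cyc c d ;; blk a b (Suc c) d = blk a b c d \<otimes> J (Suc 0) ;; cyc (a + c) (b + d)"
proof -
  have 1: "\<gamma> (pw b) (pw (Suc c)) = \<gamma> (pw b) (pw c) \<otimes> J (Suc 0) ;; J c \<otimes> \<gamma> (pw b) (pw (Suc 0))"
    using symm_pw_add2[of "pw b" c "Suc 0"] by simp
  have 2: "\<gamma> (pw (b + d)) (pw (Suc 0)) = J b \<otimes> \<gamma> (pw d) (pw (Suc 0)) ;; \<gamma> (pw b) (pw (Suc 0)) \<otimes> J d"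
    using symm_pw_add1[of "pw (Suc 0)" b d] by simp
  have 3: "J (b + c) \<otimes> \<gamma> (pw d) (pw (Suc 0)) ;; \<gamma> (pw b) (pw c) \<otimes> J (Suc d) =
      \<gamma> (pw b) (pw c) \<otimes> J (Suc d) ;; J (b + c) \<otimes> \<gamma> (pw d) (pw (Suc 0))"
    using interchange[of "J (b + c)" "\<gamma> (pw b) (pw c)" "\<gamma> (pw d) (pw (Suc 0))" "J (Suc d)"]
      interchange[of "\<gamma> (pw b) (pw c)" "J (c + b)" "J (Suc d)" "\<gamma> (pw d) (pw (Suc 0))"]
    by (simp add: add_ac)
  have 4: "J (b + c) \<otimes> \<gamma> (pw d) (pw (Suc 0)) ;; (\<gamma> (pw b) (pw (Suc c)) \<otimes> J d) =
      \<gamma> (pw b) (pw c) \<otimes> J (Suc d) ;; J c \<otimes> \<gamma> (pw (b + d)) (pw (Suc 0))"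
    using cmp_eq_ext[OF 3, of "J c \<otimes> (\<gamma> (pw b) (pw (Suc 0)) \<otimes> J d)"]
    by (simp add: 1 2 whisker add_ac)
  have "J a \<otimes> (J (b + c) \<otimes> \<gamma> (pw d) (pw (Suc 0)) ;; (\<gamma> (pw b) (pw (Suc c)) \<otimes> J d)) =
      J a \<otimes> (\<gamma> (pw b) (pw c) \<otimes> J (Suc d) ;; J c \<otimes> \<gamma> (pw (b + d)) (pw (Suc 0)))"
    by (simp only: 4)
  then show ?thesis
    by (simp add: cyc_def blk_def whisker add_ac)
qed

definition bisplits :: "nat \<Rightarrow> nat \<Rightarrow> nat \<Rightarrow> nat \<Rightarrow> (nat \<times> nat \<times> nat \<times> nat) set" where
  "bisplits n p q r = {(a, b, c, d). a + b = n \<and> c + d = p \<and> a + c = q \<and> b + d = r}"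

lemma bisplits_iff:
  "(a, b, c, d) \<in> bisplits n p q r \<longleftrightarrow> a + b = n \<and> c + d = p \<and> a + c = q \<and> b + d = r"
  by (simp add: bisplits_def)

lemma finite_bisplits [simp]: "finite (bisplits n p q r)"
proof (rule finite_subset)
  show "bisplits n p q r \<subseteq> {..n} \<times> {..n} \<times> {..p} \<times> {..p}"
    by (auto simp: bisplits_def)
qed simp

definition unsh_blk :: "nat \<times> nat \<times> nat \<times> nat \<Rightarrow> 'a" where
  "unsh_blk = (\<lambda>(a, b, c, d). unsh a b \<otimes> unsh c d ;; blk a b c d)"

lemma unsh_blk_arr [simp]:
  "unsh_blk (a, b, c, d) \<in> arrs C" "src C (unsh_blk (a, b, c, d)) = pw (a + b + c + d)"
  "tgt C (unsh_blk (a, b, c, d)) = pw (a + b + c + d)"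
  by (simp_all add: unsh_blk_def add_ac)

lemma unsh_blk_left:
  "unsh a b \<otimes> (unsh c d \<otimes> J (Suc 0) ;; cyc c d) ;; blk a b (Suc c) d =
     unsh_blk (a, b, c, d) \<otimes> J (Suc 0) ;; cyc (a + c) (b + d)"
proof -
  have "unsh a b \<otimes> (unsh c d \<otimes> J (Suc 0) ;; cyc c d) ;; blk a b (Suc c) d =
      (unsh a b \<otimes> (unsh c d \<otimes> J (Suc 0)) ;; J (a + b) \<otimes> cyc c d) ;; blk a b (Suc c) d"
    by (simp add: interchange)
  also have "\<dots> = unsh a b \<otimes> (unsh c d \<otimes> J (Suc 0)) ;; (J (a + b) \<otimes> cyc c d ;; blk a b (Suc c) d)"
    by (simp add: add_ac)
  also have "\<dots> = unsh_blk (a, b, c, d) \<otimes> J (Suc 0) ;; cyc (a + c) (b + d)"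
    unfolding cyc_blk by (simp add: unsh_blk_def whisker add_ac)
  finally show ?thesis .
qed

lemma unsh_blk_right:
  "unsh a b \<otimes> (unsh c d \<otimes> J (Suc 0)) ;; blk a b c (Suc d) = unsh_blk (a, b, c, d) \<otimes> J (Suc 0)"
  by (simp add: unsh_blk_def whisker add_ac blk_def)

text \<open>The last source factor lies in the second block, so the recursion of
  \<open>unsh c d\<close> carries over to the whole summand; \<open>cyc_blk\<close> moves the
  insertion behind the block swap.\<close>

lemma unsh_blk_rec:
  assumes "c + d = Suc p" "a + b + Suc p = Suc m"
  shows "unsh_blk (a, b, c, d) =
     (case c of 0 \<Rightarrow> hzero C (pw (Suc m)) (pw (Suc m))
        | Suc c' \<Rightarrow> unsh_blk (a, b, c', d) \<otimes> J (Suc 0) ;; cyc (a + c') (b + d)) \<oplus>\<^sub>h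
     (case d of 0 \<Rightarrow> hzero C (pw (Suc m)) (pw (Suc m)) | Suc d' \<Rightarrow> unsh_blk (a, b, c, d') \<otimes> J (Suc 0))"
proof -
  let ?f = "case c of 0 \<Rightarrow> hzero C (pw (Suc p)) (pw (Suc p)) | Suc c' \<Rightarrow> unsh c' d \<otimes> J (Suc 0) ;; cyc c' d"
  let ?g = "case d of 0 \<Rightarrow> hzero C (pw (Suc p)) (pw (Suc p)) | Suc d' \<Rightarrow> unsh c d' \<otimes> J (Suc 0)"
  have fg: "?f \<in> Hom C (pw (Suc p)) (pw (Suc p))" "?g \<in> Hom C (pw (Suc p)) (pw (Suc p))"
    using assms by (auto split: nat.split simp: Hom_iff hzero_Hom[unfolded Hom_iff])
  have u: "unsh a b \<in> Hom C (pw (a + b)) (pw (a + b))" by (simp add: Hom_iff)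
  have m: "Suc m = a + b + Suc p" using assms by simp
  have blk: "blk a b c d \<in> Hom C (pw (Suc m)) (pw (Suc m))"
    using assms by (auto simp: Hom_iff add_ac intro!: arg_cong[where f = pw])
  have "unsh_blk (a, b, c, d) = unsh a b \<otimes> (?f \<oplus>\<^sub>h ?g) ;; blk a b c d"
    unfolding unsh_blk_def using unsh_rec[OF assms(1)] by simp
  also have "\<dots> = (unsh a b \<otimes> ?f \<oplus>\<^sub>h unsh a b \<otimes> ?g) ;; blk a b c d"
    by (subst tens_hadd[OF u fg]) (rule refl)
  also have "\<dots> = (unsh a b \<otimes> ?f ;; blk a b c d) \<oplus>\<^sub>h (unsh a b \<otimes> ?g ;; blk a b c d)"
    using tens_Hom[OF u fg(1)] tens_Hom[OF u fg(2)] blk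
    by (intro hadd_cmp) (simp_all add: m)
  also have "unsh a b \<otimes> ?f ;; blk a b c d = (case c of 0 \<Rightarrow> hzero C (pw (Suc m)) (pw (Suc m))
        | Suc c' \<Rightarrow> unsh_blk (a, b, c', d) \<otimes> J (Suc 0) ;; cyc (a + c') (b + d))"
  proof (cases c)
    case 0
    then show ?thesis
      using tens_hzero[OF u, of "pw (Suc p)" "pw (Suc p)"] hzero_cmp[OF _ blk, of "pw (Suc m)"]
      by (simp add: m)
  next
    case (Suc c')
    then show ?thesis by (simp add: unsh_blk_left)
  qed
  also have "unsh a b \<otimes> ?g ;; blk a b c d =
      (case d of 0 \<Rightarrow> hzero C (pw (Suc m)) (pw (Suc m)) | Suc d' \<Rightarrow> unsh_blk (a, b, c, d') \<otimes> J (Suc 0))"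
  proof (cases d)
    case 0
    then show ?thesis
      using tens_hzero[OF u, of "pw (Suc p)" "pw (Suc p)"] hzero_cmp[OF _ blk, of "pw (Suc m)"]
      by (simp add: m)
  next
    case (Suc d')
    then show ?thesis by (simp add: unsh_blk_right)
  qed
  finally show ?thesis .
qed

text \<open>Induction on the length \<open>p\<close> of the second source block. Both sides obey the
  same recursion according to which target block receives the last factor; in the sum this lowers
  either \<open>c\<close> or \<open>d\<close> by one.\<close>

lemma unsh_decomp:
  "q + r = n + p \<Longrightarrow> unsh q r = hom_sum C (pw (n + p)) (pw (n + p)) unsh_blk (bisplits n p q r)"
proof (induction p arbitrary: q r)
  case 0
  then have n: "n = q + r" by simp
  have 1: "bisplits (q + r) 0 q r = {(q, r, 0, 0)}"
    by (auto simp: bisplits_def)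
  have 2: "unsh_blk (q, r, 0, 0) = unsh q r"
    by (simp add: unsh_blk_def blk_def)
  have "hom_sum C (pw (q + r)) (pw (q + r)) unsh_blk {(q, r, 0, 0)} = unsh_blk (q, r, 0, 0)"
    by (rule hom_sum_singleton) (simp add: 2 Hom_iff)
  then show ?case
    unfolding n by (simp only: 1 2 add_0_right)
next
  case (Suc p)
  let ?m = "n + p" and ?N = "pw (Suc (n + p))"
  let ?Z = "hzero C ?N ?N" and ?S = "bisplits n (Suc p) q r"
  let ?L = "\<lambda>(a, b, c, d). case c of 0 \<Rightarrow> ?Z
      | Suc c' \<Rightarrow> unsh_blk (a, b, c', d) \<otimes> J (Suc 0) ;; cyc (a + c') (b + d)"
  let ?R = "\<lambda>(a, b, c, d). case d of 0 \<Rightarrow> ?Z | Suc d' \<Rightarrow> unsh_blk (a, b, c, d') \<otimes> J (Suc 0)"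
  have L: "?L i \<in> Hom C ?N ?N" and R: "?R i \<in> Hom C ?N ?N" if "i \<in> ?S" for i
    using that by (cases i; auto split: nat.split simp: bisplits_iff Hom_iff hzero_Hom[unfolded Hom_iff] add_ac
        intro!: arg_cong[where f = pw])+
  have "hom_sum C ?N ?N unsh_blk ?S = hom_sum C ?N ?N (\<lambda>i. ?L i \<oplus>\<^sub>h ?R i) ?S"
  proof (rule hom_sum_cong)
    fix i assume i: "i \<in> ?S"
    then show "unsh_blk i = ?L i \<oplus>\<^sub>h ?R i"
      by (cases i) (auto simp: bisplits_iff intro!: unsh_blk_rec)
    show "?L i \<oplus>\<^sub>h ?R i \<in> Hom C ?N ?N"
      using L[OF i] R[OF i] by (rule hadd_Hom)
  qed simp_all
  also have "\<dots> = hom_sum C ?N ?N ?L ?S \<oplus>\<^sub>h hom_sum C ?N ?N ?R ?S"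
    using L R by (intro hom_sum_hadd) auto
  also have "hom_sum C ?N ?N ?L ?S =
      (case q of 0 \<Rightarrow> ?Z | Suc q' \<Rightarrow> unsh q' r \<otimes> J (Suc 0) ;; cyc q' r)"
  proof (cases q)
    case 0
    then have "hom_sum C ?N ?N ?L ?S = hom_sum C ?N ?N ?L {}"
      by (intro hom_sum_neutral) (auto simp: bisplits_iff)
    then show ?thesis by (simp add: 0 hom_sum_empty)
  next
    case q: (Suc q')
    let ?h = "\<lambda>(a, b, c, d). (a, b, Suc c, d)"
    \<comment> \<open>Splittings with \<open>c = 0\<close> contribute zero; the others are those of
      the smaller problem with \<open>c\<close> raised by one.\<close>
    have "hom_sum C ?N ?N ?L ?S = hom_sum C ?N ?N ?L (?h ` bisplits n p q' r)"
    proof (rule hom_sum_neutral)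
      show "?h ` bisplits n p q' r \<subseteq> ?S" by (auto simp: bisplits_iff q)
      then show "\<And>i. i \<in> ?h ` bisplits n p q' r \<Longrightarrow> ?L i \<in> Hom C ?N ?N"
        using L by blast
      show "?L i = ?Z" if "i \<in> ?S - ?h ` bisplits n p q' r" for i
      proof -
        obtain a b c d where i: "i = (a, b, c, d)" by (cases i) auto
        have "c = 0"
        proof (rule ccontr)
          assume "c \<noteq> 0"
          then have "i = ?h (a, b, c - 1, d)" "(a, b, c - 1, d) \<in> bisplits n p q' r"
            using that by (auto simp: i bisplits_iff q)
          with that show False by blast
        qed
        then show ?thesis by (simp add: i)
      qed
    qed simp_all
    also have "\<dots> = hom_sum C ?N ?N (\<lambda>i. ?L (?h i)) (bisplits n p q' r)"
      by (rule hom_sum_reindex) (auto simp: inj_on_def bisplits_iff Hom_iff add_ac)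
    also have "\<dots> = hom_sum C ?N ?N (\<lambda>i. unsh_blk i \<otimes> J (Suc 0) ;; cyc q' r) (bisplits n p q' r)"
      by (rule hom_sum_cong) (auto simp: bisplits_iff Hom_iff add_ac)
    also have "\<dots> = hom_sum C ?N ?N (\<lambda>i. unsh_blk i \<otimes> J (Suc 0)) (bisplits n p q' r) ;; cyc q' r"
      using Suc.prems q by (intro hom_sum_cmp[symmetric]) (auto simp: bisplits_iff Hom_iff add_ac)
    also have "hom_sum C ?N ?N (\<lambda>i. unsh_blk i \<otimes> J (Suc 0)) (bisplits n p q' r) =
        hom_sum C (pw ?m) (pw ?m) unsh_blk (bisplits n p q' r) \<otimes> J (Suc 0)"
      by (subst hom_sum_tens) (auto simp: bisplits_iff Hom_iff add_ac)
    also have "hom_sum C (pw ?m) (pw ?m) unsh_blk (bisplits n p q' r) = unsh q' r"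
      using Suc.prems q by (intro Suc.IH[symmetric]) simp
    finally show ?thesis by (simp add: q)
  qed
  also have "hom_sum C ?N ?N ?R ?S = (case r of 0 \<Rightarrow> ?Z | Suc r' \<Rightarrow> unsh q r' \<otimes> J (Suc 0))"
  proof (cases r)
    case 0
    then have "hom_sum C ?N ?N ?R ?S = hom_sum C ?N ?N ?R {}"
      by (intro hom_sum_neutral) (auto simp: bisplits_iff)
    then show ?thesis by (simp add: 0 hom_sum_empty)
  next
    case r: (Suc r')
    let ?h = "\<lambda>(a, b, c, d). (a, b, c, Suc d)"
    have "hom_sum C ?N ?N ?R ?S = hom_sum C ?N ?N ?R (?h ` bisplits n p q r')"
    proof (rule hom_sum_neutral)
      show "?h ` bisplits n p q r' \<subseteq> ?S" by (auto simp: bisplits_iff r)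
      then show "\<And>i. i \<in> ?h ` bisplits n p q r' \<Longrightarrow> ?R i \<in> Hom C ?N ?N"
        using R by blast
      show "?R i = ?Z" if "i \<in> ?S - ?h ` bisplits n p q r'" for i
      proof -
        obtain a b c d where i: "i = (a, b, c, d)" by (cases i) auto
        have "d = 0"
        proof (rule ccontr)
          assume "d \<noteq> 0"
          then have "i = ?h (a, b, c, d - 1)" "(a, b, c, d - 1) \<in> bisplits n p q r'"
            using that by (auto simp: i bisplits_iff r)
          with that show False by blast
        qed
        then show ?thesis by (simp add: i)
      qed
    qed simp_all
    also have "\<dots> = hom_sum C ?N ?N (\<lambda>i. ?R (?h i)) (bisplits n p q r')"
      by (rule hom_sum_reindex) (auto simp: inj_on_def bisplits_iff Hom_iff add_ac)
    also have "\<dots> = hom_sum C ?N ?N (\<lambda>i. unsh_blk i \<otimes> J (Suc 0)) (bisplits n p q r')"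
      by (rule hom_sum_cong) (auto simp: bisplits_iff Hom_iff add_ac)
    also have "\<dots> = hom_sum C (pw ?m) (pw ?m) unsh_blk (bisplits n p q r') \<otimes> J (Suc 0)"
      by (subst hom_sum_tens) (auto simp: bisplits_iff Hom_iff add_ac)
    also have "hom_sum C (pw ?m) (pw ?m) unsh_blk (bisplits n p q r') = unsh q r'"
      using Suc.prems r by (intro Suc.IH[symmetric]) simp
    finally show ?thesis by (simp add: r)
  qed
  finally show ?case
    using unsh_rec[of q r "n + p"] Suc.prems by simp
qed

end

section \<open>From permutation splittings to binomial bimonoids\<close>

text \<open>The base object \<open>A\<close> is a separate parameter: the tensor powers \<open>pw\<close> depend on it, so with
  \<open>ob 1\<close> in its place the equation \<open>ob 1 = pw 1\<close> could not be used for rewriting.\<close>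

locale splitting = lin_power C A
  for C :: "('o, 'a, 'x) lsmcat_scheme" (structure) and A :: 'o +
  fixes ob :: "nat \<Rightarrow> 'o" and R :: "nat \<Rightarrow> 'a" and S :: "nat \<Rightarrow> 'a"
  assumes ob_obj [simp]: "ob n \<in> objs C"
    and R_Hom: "R n \<in> Hom C (pw n) (ob n)"
    and S_Hom: "S n \<in> Hom C (ob n) (pw n)"
    and R_S: "R n ;; S n = (1 / fact n) \<cdot> psum n"
    and S_R [simp]: "S n ;; R n = \<i>\<d> (ob n)"
    and ob_1: "ob (Suc 0) = pw (Suc 0)"
    and R_1: "R (Suc 0) = J (Suc 0)"
    and S_1: "S (Suc 0) = J (Suc 0)"
begin

lemma R_arr [simp]: "R n \<in> arrs C" "src C (R n) = pw n" "tgt C (R n) = ob n"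
  using HomD[OF R_Hom] by auto

lemma S_arr [simp]: "S n \<in> arrs C" "src C (S n) = ob n" "tgt C (S n) = pw n"
  using HomD[OF S_Hom] by auto

lemma R_S_ext: "h \<in> arrs C \<Longrightarrow> src C h = pw n \<Longrightarrow> R n ;; (S n ;; h) = (1 / fact n) \<cdot> (psum n ;; h)"
  using cmp_eq_ext[OF R_S] by simp

lemma S_R_ext [simp]: "h \<in> arrs C \<Longrightarrow> src C h = ob n \<Longrightarrow> S n ;; (R n ;; h) = h"
  using cmp_eq_ext[OF S_R] by simp

lemma psum_R: "(1 / fact n) \<cdot> (psum n ;; R n) = R n"
  using R_S_ext[of "R n" n] by simp

lemma S_psum: "(1 / fact n) \<cdot> (S n ;; psum n) = S n"
proof -
  have "S n ;; (R n ;; S n) = S n" by simp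
  then show ?thesis unfolding R_S by simp
qed

text \<open>By \<open>S_R\<close>, \<open>R\<close> equals its own symmetrization
  (\<open>psum_R\<close>), and the symmetrizer swallows transpositions.\<close>

lemma tr_R: "tr a b ;; R (Suc (Suc (a + b))) = R (Suc (Suc (a + b)))"
proof -
  let ?n = "Suc (Suc (a + b))"
  have "tr a b ;; ((1 / fact ?n) \<cdot> (psum ?n ;; R ?n)) = (1 / fact ?n) \<cdot> ((tr a b ;; psum ?n) ;; R ?n)"
    by (subst cmp_assoc_arr) (simp_all del: tr_psum fact_Suc)
  then show ?thesis by (simp only: tr_psum psum_R)
qed

lemma S_tr: "S (Suc (Suc (a + b))) ;; tr a b = S (Suc (Suc (a + b)))"
proof -
  let ?n = "Suc (Suc (a + b))"
  have "((1 / fact ?n) \<cdot> (S ?n ;; psum ?n)) ;; tr a b = (1 / fact ?n) \<cdot> (S ?n ;; (psum ?n ;; tr a b))"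
    by (simp del: psum_tr fact_Suc)
  then show ?thesis by (simp only: psum_tr S_psum)
qed

lemma gen_R: "f \<in> gen n \<Longrightarrow> f ;; R n = R n"
  by (erule gen_absorb_right) (auto simp: tr_R)

lemma gen_S: "f \<in> gen n \<Longrightarrow> S n ;; f = S n"
  by (erule gen_absorb_left) (auto simp: S_tr)

text \<open>Symmetrizing a sub-block is invisible to a map invariant under the whole symmetric
  group; the \<open>n!\<close> of \<open>psum_absorb_right\<close> cancels the
  normalization.\<close>

lemma RS_whisker_R: "(J a \<otimes> (R n ;; S n) \<otimes> J b) ;; R (a + n + b) = R (a + n + b)"
  using psum_absorb_right[of "R (a + n + b)" a n b] gen_R
  by (simp add: R_S add.assoc)

lemma RS_Suc: "R n \<otimes> J (Suc 0) ;; (S n \<otimes> J (Suc 0) ;; R (Suc n)) = R (Suc n)"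
  using RS_whisker_R[of 0 n "Suc 0"] by (simp add: whisker)

lemma S_RS_whisker: "S (a + n + b) ;; (J a \<otimes> (R n ;; S n) \<otimes> J b) = S (a + n + b)"
  using psum_absorb_left[of "S (a + n + b)" a n b] gen_S
  by (simp add: R_S add.assoc)

lemma RS_tens_R: "(R m ;; S m) \<otimes> (R n ;; S n) ;; R (m + n) = R (m + n)"
proof -
  have "(R m ;; S m) \<otimes> (R n ;; S n) = (R m ;; S m) \<otimes> J n ;; J m \<otimes> (R n ;; S n)"
    by (simp add: interchange)
  then show ?thesis
    using RS_whisker_R[of 0 m n] RS_whisker_R[of m n 0] by simp
qed

lemma R_S_0: "R 0 ;; S 0 = J 0"
  by (simp add: R_S psum_0)

lemma symm_R: "\<gamma> (pw m) (pw n) ;; R (n + m) = R (m + n)"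
  using gen_R[OF gen_symm[of m n]] by (simp add: add.commute)

lemma S_symm: "S (m + n) ;; \<gamma> (pw m) (pw n) = S (n + m)"
  using gen_S[OF gen_symm[of m n]] by (simp add: add.commute)

text \<open>Averaging over all permutations of the source is averaging over unshuffles, because
  \<open>R q \<otimes> R r\<close> already absorbs permutations within the two blocks.\<close>

lemma unsh_R:
  "unsh q r ;; R q \<otimes> R r = of_nat ((q + r) choose q) \<cdot> (R (q + r) ;; (S (q + r) ;; R q \<otimes> R r))"
proof (induction "q + r" arbitrary: q r)
  case 0
  then show ?case
    using R_S_ext[of "R 0 \<otimes> R 0" 0] by (simp add: psum_0)
next
  case (Suc N)
  let ?g = "R q \<otimes> R r" and ?e = "R N ;; S N"
  \<comment> \<open>The recursion \<open>psum_Suc\<close> in normalized form: average over the first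
    \<open>N\<close> factors, then over the \<open>N + 1\<close> insertion points.\<close>
  have e_Suc: "R (Suc N) ;; (S (Suc N) ;; h) = (1 / of_nat (Suc N)) \<cdot> (?e \<otimes> J (Suc 0) ;; (ins_sum N ;; h))"
    if "h \<in> arrs C" "src C h = pw (Suc N)" for h
    using that by (simp add: R_S R_S_ext psum_Suc)
  \<comment> \<open>\<open>RS_Suc\<close> factors \<open>R r\<close> through
    \<open>R r' \<otimes> J (Suc 0)\<close>, which exposes the shorter pair \<open>(q, r')\<close>
    to the induction hypothesis.\<close>
  have right: "unsh q r' \<otimes> J (Suc 0) ;; ?g = of_nat (N choose q) \<cdot> (?e \<otimes> J (Suc 0) ;; ?g)"
    if r: "r = Suc r'" for r'
  proof -
    have g: "?g = (R q \<otimes> R r') \<otimes> J (Suc 0) ;; \<i>\<d> (ob q) \<otimes> (S r' \<otimes> J (Suc 0) ;; R r)"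
      by (simp add: interchange RS_Suc r)
    have IH: "unsh q r' ;; R q \<otimes> R r' = of_nat (N choose q) \<cdot> (?e ;; R q \<otimes> R r')"
      using Suc.hyps(1)[of q r'] Suc.hyps(2) by (simp add: r)
    have "unsh q r' \<otimes> J (Suc 0) ;; ?g =
        (unsh q r' ;; R q \<otimes> R r') \<otimes> J (Suc 0) ;; \<i>\<d> (ob q) \<otimes> (S r' \<otimes> J (Suc 0) ;; R r)"
      by (subst g) (simp add: whisker r)
    also have "\<dots> = of_nat (N choose q) \<cdot> (?e \<otimes> J (Suc 0) ;; ?g)"
      by (subst g, subst IH) (use Suc.hyps(2) in \<open>simp add: whisker r\<close>)
    finally show ?thesis .
  qed
  \<comment> \<open>The same for the first block, whose new factor sits in the middle: naturality
    pulls the symmetry of \<open>cyc q' r\<close> through \<open>R r\<close>, so that the factor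
    stays last in front of it.\<close>
  have left: "unsh q' r \<otimes> J (Suc 0) ;; (cyc q' r ;; ?g) =
      of_nat (N choose q') \<cdot> (?e \<otimes> J (Suc 0) ;; (cyc q' r ;; ?g))"
    if q: "q = Suc q'" for q'
  proof -
    have "?g = (R q' \<otimes> J (Suc 0)) \<otimes> R r ;; (S q' \<otimes> J (Suc 0) ;; R q) \<otimes> \<i>\<d> (ob r)"
      by (subst interchange) (simp_all add: RS_Suc q)
    then have "?g = R q' \<otimes> (J (Suc 0) \<otimes> R r) ;; (S q' \<otimes> J (Suc 0) ;; R q) \<otimes> \<i>\<d> (ob r)"
      by simp
    moreover have "cyc q' r ;; R q' \<otimes> (J (Suc 0) \<otimes> R r) =
        (R q' \<otimes> R r) \<otimes> J (Suc 0) ;; \<i>\<d> (ob q') \<otimes> \<gamma> (ob r) (pw (Suc 0))"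
      using symm_natural_arr[of "R r" "J (Suc 0)"] by (simp add: cyc_def interchange)
    ultimately have g: "cyc q' r ;; ?g = (R q' \<otimes> R r) \<otimes> J (Suc 0) ;;
        (\<i>\<d> (ob q') \<otimes> \<gamma> (ob r) (pw (Suc 0)) ;; (S q' \<otimes> J (Suc 0) ;; R q) \<otimes> \<i>\<d> (ob r))"
      using cmp_eq_ext[of "cyc q' r" "R q' \<otimes> (J (Suc 0) \<otimes> R r)" _
          "(S q' \<otimes> J (Suc 0) ;; R q) \<otimes> \<i>\<d> (ob r)"]
      by (simp add: q)
    have IH: "unsh q' r ;; R q' \<otimes> R r = of_nat (N choose q') \<cdot> (?e ;; R q' \<otimes> R r)"
      using Suc.hyps(1)[of q' r] Suc.hyps(2) by (simp add: q)
    let ?k = "\<i>\<d> (ob q') \<otimes> \<gamma> (ob r) (pw (Suc 0)) ;; (S q' \<otimes> J (Suc 0) ;; R q) \<otimes> \<i>\<d> (ob r)"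
    have "unsh q' r \<otimes> J (Suc 0) ;; (cyc q' r ;; ?g) = (unsh q' r ;; R q' \<otimes> R r) \<otimes> J (Suc 0) ;; ?k"
      by (subst g) (simp add: whisker q)
    also have "\<dots> = of_nat (N choose q') \<cdot> (?e \<otimes> J (Suc 0) ;; (cyc q' r ;; ?g))"
      by (subst g, subst IH) (use Suc.hyps(2) in \<open>simp add: whisker q\<close>)
    finally show ?thesis .
  qed
  \<comment> \<open>Swaps inside one of the two blocks are absorbed; \<open>Suc a = q\<close> would
    straddle them.\<close>
  have tr_g: "tr a b ;; ?g = ?g" if "a + b + 1 = N" "Suc a \<noteq> q" for a b
  proof (cases "Suc a < q")
    case True
    then have "q = Suc (Suc (a + (q - a - 2)))" by simp
    then obtain c where q: "q = Suc (Suc (a + c))" by blast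
    then have "b = c + r" using that Suc.hyps(2) by simp
    then have "tr a b = tr a c \<otimes> J r" by simp
    then show ?thesis by (simp add: interchange tr_R q del: tr_tens)
  next
    case False
    then have "a = q + (a - q)" using that(2) by simp
    then obtain c where "a = q + c" by blast
    moreover from this have "r = Suc (Suc (c + b))" using that(1) Suc.hyps(2) by simp
    ultimately show ?thesis by (simp add: interchange tr_R flip: tr_tens(2))
  qed
  show ?case
  proof (cases q)
    case 0
    then have "ins_sum N ;; ?g = of_nat (Suc N) \<cdot> ?g"
      using tr_g Suc.hyps(2) by (intro ins_sum_absorb_all) auto
    moreover have "?e \<otimes> J (Suc 0) ;; ?g = ?g"
      using right[of N] Suc.hyps(2) 0 by simp
    ultimately show ?thesis
      using e_Suc[of ?g] Suc.hyps(2) 0 by simp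
  next
    case (Suc q')
    have N: "N = q' + r" using Suc Suc.hyps(2) by simp
    have "ins_sum N ;; ?g = of_nat (Suc q') \<cdot> (cyc q' r ;; ?g) \<oplus>\<^sub>h of_nat r \<cdot> ?g"
      using tr_g Suc N by (simp add: ins_sum_absorb)
    then have "of_nat (Suc N choose q) \<cdot> (R (Suc N) ;; (S (Suc N) ;; ?g)) =
        (of_nat (Suc N choose q) / of_nat (Suc N)) \<cdot>
          (?e \<otimes> J (Suc 0) ;; (of_nat (Suc q') \<cdot> (cyc q' r ;; ?g) \<oplus>\<^sub>h of_nat r \<cdot> ?g))"
      using e_Suc[of ?g] Suc N by simp
    also have "\<dots> = (of_nat (Suc N choose q) / of_nat (Suc N) * of_nat (Suc q')) \<cdot> (?e \<otimes> J (Suc 0) ;; (cyc q' r ;; ?g))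
        \<oplus>\<^sub>h (of_nat (Suc N choose q) / of_nat (Suc N) * of_nat r) \<cdot> (?e \<otimes> J (Suc 0) ;; ?g)"
      using Suc N by (simp add: cmp_hadd_arr smul_hadd_arr del: of_nat_Suc)
    \<comment> \<open>The two coefficients are the Pascal summands of \<open>Suc N choose q\<close>:
      a fraction \<open>q / (N + 1)\<close> of the unshuffles puts the last factor into the first
      block, a fraction \<open>r / (N + 1)\<close> into the second.\<close>
    also have "of_nat (Suc N choose q) / of_nat (Suc N) * of_nat (Suc q') = (of_nat (N choose q') :: rat)"
      using Suc_times_binomial_eq[of N q'] Suc
      by (simp add: field_simps del: of_nat_Suc binomial_Suc_Suc flip: of_nat_mult)
    also have "of_nat (Suc N choose q) / of_nat (Suc N) * of_nat r = (of_nat (N choose q) :: rat)"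
      using binomial_absorb_comp[of "Suc N" q] Suc N
      by (simp add: field_simps del: of_nat_Suc binomial_Suc_Suc flip: of_nat_mult)
    also have "of_nat (N choose q') \<cdot> (?e \<otimes> J (Suc 0) ;; (cyc q' r ;; ?g)) =
        unsh q' r \<otimes> J (Suc 0) ;; (cyc q' r ;; ?g)"
      using left Suc by simp
    finally have *: "of_nat (Suc N choose q) \<cdot> (R (Suc N) ;; (S (Suc N) ;; ?g)) =
        (unsh q' r \<otimes> J (Suc 0) ;; (cyc q' r ;; ?g)) \<oplus>\<^sub>h of_nat (N choose q) \<cdot> (?e \<otimes> J (Suc 0) ;; ?g)" .
    show ?thesis
    proof (cases r)
      case 0
      \<comment> \<open>Since \<open>q = N + 1\<close> the coefficient vanishes, in agreement with
        the missing second summand of \<open>unsh q 0\<close>.\<close>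
      then have "of_nat (N choose q) \<cdot> (?e \<otimes> J (Suc 0) ;; ?g) = hzero C (pw (Suc N)) (ob q \<otimes>\<^sub>o ob r)"
        using N Suc zero_smul[of "?e \<otimes> J (Suc 0) ;; ?g" "pw (Suc N)" "ob q \<otimes>\<^sub>o ob r"]
        by (simp add: Hom_iff binomial_eq_0)
      then show ?thesis
        using * 0 Suc N by (simp add: hzero_hadd Hom_iff)
    next
      case r: (Suc r')
      then have "of_nat (N choose q) \<cdot> (?e \<otimes> J (Suc 0) ;; ?g) = unsh q r' \<otimes> J (Suc 0) ;; ?g"
        using right by simp
      then have "of_nat (Suc N choose q) \<cdot> (R (Suc N) ;; (S (Suc N) ;; ?g)) = unsh q r ;; ?g"
        using * Suc N r by (simp add: hadd_cmp_arr)
      then show ?thesis using Suc.hyps(2) by simp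
    qed
  qed
qed

section \<open>The bimonoid operations of a splitting and their laws\<close>

definition nab :: "nat \<Rightarrow> nat \<Rightarrow> 'a" where
  "nab n p = S n \<otimes> S p ;; R (n + p)"

definition Del :: "nat \<Rightarrow> nat \<Rightarrow> 'a" where
  "Del n p = of_nat ((n + p) choose n) \<cdot> (S (n + p) ;; R n \<otimes> R p)"

lemma nab_arr [simp]: "nab n p \<in> arrs C" "src C (nab n p) = ob n \<otimes>\<^sub>o ob p" "tgt C (nab n p) = ob (n + p)"
  by (simp_all add: nab_def)

lemma Del_arr [simp]: "Del n p \<in> arrs C" "src C (Del n p) = ob (n + p)" "tgt C (Del n p) = ob n \<otimes>\<^sub>o ob p"
  by (simp_all add: Del_def)

lemma RS_left: "(R m ;; S m) \<otimes> J q ;; R (m + q) = R (m + q)"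
  and RS_right: "J m \<otimes> (R q ;; S q) ;; R (m + q) = R (m + q)"
  using RS_whisker_R[of 0 m q] RS_whisker_R[of m q 0] by simp_all

lemma S_RS_left: "S (m + q) ;; (R m ;; S m) \<otimes> J q = S (m + q)"
  and S_RS_right: "S (m + q) ;; J m \<otimes> (R q ;; S q) = S (m + q)"
  using S_RS_whisker[of 0 m q] S_RS_whisker[of m q 0] by simp_all

text \<open>The inner \<open>R ;; S\<close> symmetrizes a sub-block and is absorbed by the outer
  \<open>R\<close>. With \<open>nab_right\<close>, both bracketings reduce to one ternary product,
  which is associativity.\<close>

lemma nab_left: "nab n p \<otimes> \<i>\<d> (ob q) ;; nab (n + p) q = (S n \<otimes> S p) \<otimes> S q ;; R (n + p + q)"
proof -
  have "nab n p \<otimes> \<i>\<d> (ob q) ;; S (n + p) \<otimes> S q = (S n \<otimes> S p) \<otimes> S q ;; (R (n + p) ;; S (n + p)) \<otimes> J q"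
    unfolding nab_def by (subst (1 2) interchange) simp_all
  from cmp_eq_ext[OF this, of "R (n + p + q)"]
  have "nab n p \<otimes> \<i>\<d> (ob q) ;; nab (n + p) q =
      ((S n \<otimes> S p) \<otimes> S q ;; (R (n + p) ;; S (n + p)) \<otimes> J q) ;; R (n + p + q)"
    by (simp add: nab_def[of "n + p" q] del: cmp_assoc_arr tens_assoc)
  also have "\<dots> = (S n \<otimes> S p) \<otimes> S q ;; ((R (n + p) ;; S (n + p)) \<otimes> J q ;; R (n + p + q))"
    by (rule cmp_assoc_arr) (simp_all add: add.assoc)
  finally show ?thesis
    by (simp only: RS_left)
qed

lemma nab_right: "\<i>\<d> (ob n) \<otimes> nab p q ;; nab n (p + q) = S n \<otimes> (S p \<otimes> S q) ;; R (n + p + q)"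
proof -
  have "\<i>\<d> (ob n) \<otimes> nab p q ;; S n \<otimes> S (p + q) = S n \<otimes> (S p \<otimes> S q) ;; J n \<otimes> (R (p + q) ;; S (p + q))"
    unfolding nab_def by (subst (1 2) interchange) simp_all
  from cmp_eq_ext[OF this, of "R (n + (p + q))"]
  have "\<i>\<d> (ob n) \<otimes> nab p q ;; nab n (p + q) =
      (S n \<otimes> (S p \<otimes> S q) ;; J n \<otimes> (R (p + q) ;; S (p + q))) ;; R (n + (p + q))"
    by (simp add: nab_def[of n "p + q"] del: cmp_assoc_arr)
  also have "\<dots> = S n \<otimes> (S p \<otimes> S q) ;; (J n \<otimes> (R (p + q) ;; S (p + q)) ;; R (n + (p + q)))"
    by (rule cmp_assoc_arr) simp_all
  finally show ?thesis
    by (simp only: RS_right add.assoc)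
qed

text \<open>The coefficient is the multinomial coefficient of \<open>n, p, q\<close>, as is the one
  in \<open>Del_right\<close>; \<open>choose_mult\<close> identifies the two products.\<close>

lemma Del_left:
  "Del (n + p) q ;; Del n p \<otimes> \<i>\<d> (ob q) =
     of_nat (((n + p + q) choose (n + p)) * ((n + p) choose n)) \<cdot> (S (n + p + q) ;; (R n \<otimes> R p) \<otimes> R q)"
proof -
  have "R (n + p) \<otimes> R q ;; (S (n + p) ;; R n \<otimes> R p) \<otimes> \<i>\<d> (ob q) =
      (R (n + p) ;; S (n + p)) \<otimes> J q ;; (R n \<otimes> R p) \<otimes> R q"
    by (subst (1 2) interchange) simp_all
  then have "(S (n + p + q) ;; R (n + p) \<otimes> R q) ;; (S (n + p) ;; R n \<otimes> R p) \<otimes> \<i>\<d> (ob q) =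
      (S (n + p + q) ;; (R (n + p) ;; S (n + p)) \<otimes> J q) ;; (R n \<otimes> R p) \<otimes> R q"
    by (subst (1 2) cmp_assoc_arr) (simp_all add: add.assoc)
  then have "(S (n + p + q) ;; R (n + p) \<otimes> R q) ;; (S (n + p) ;; R n \<otimes> R p) \<otimes> \<i>\<d> (ob q) =
      S (n + p + q) ;; (R n \<otimes> R p) \<otimes> R q"
    by (simp only: S_RS_left)
  then show ?thesis
    unfolding Del_def by (simp add: add.assoc mult.commute)
qed

lemma Del_right:
  "Del n (p + q) ;; \<i>\<d> (ob n) \<otimes> Del p q =
     of_nat (((n + p + q) choose n) * ((p + q) choose p)) \<cdot> (S (n + p + q) ;; R n \<otimes> (R p \<otimes> R q))"
proof -
  have "R n \<otimes> R (p + q) ;; \<i>\<d> (ob n) \<otimes> (S (p + q) ;; R p \<otimes> R q) =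
      J n \<otimes> (R (p + q) ;; S (p + q)) ;; R n \<otimes> (R p \<otimes> R q)"
    by (subst (1 2) interchange) simp_all
  then have "(S (n + (p + q)) ;; R n \<otimes> R (p + q)) ;; \<i>\<d> (ob n) \<otimes> (S (p + q) ;; R p \<otimes> R q) =
      (S (n + (p + q)) ;; J n \<otimes> (R (p + q) ;; S (p + q))) ;; R n \<otimes> (R p \<otimes> R q)"
    by (subst (1 2) cmp_assoc_arr) simp_all
  then have "(S (n + (p + q)) ;; R n \<otimes> R (p + q)) ;; \<i>\<d> (ob n) \<otimes> (S (p + q) ;; R p \<otimes> R q) =
      S (n + (p + q)) ;; R n \<otimes> (R p \<otimes> R q)"
    by (simp only: S_RS_right)
  then show ?thesis
    unfolding Del_def by (simp add: add.assoc mult.commute)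
qed

lemma nab_unit: "R 0 \<otimes> \<i>\<d> (ob n) ;; nab 0 n = \<i>\<d> (ob n)"
proof -
  have "R 0 \<otimes> \<i>\<d> (ob n) ;; S 0 \<otimes> S n = (R 0 ;; S 0) \<otimes> S n"
    by (subst interchange) simp_all
  then show ?thesis
    using cmp_eq_ext[of "R 0 \<otimes> \<i>\<d> (ob n)" "S 0 \<otimes> S n" _ "R n"]
    by (simp add: nab_def R_S_0 pw_0)
qed

lemma Del_counit: "Del 0 n ;; S 0 \<otimes> \<i>\<d> (ob n) = \<i>\<d> (ob n)"
proof -
  have "R 0 \<otimes> R n ;; S 0 \<otimes> \<i>\<d> (ob n) = (R 0 ;; S 0) \<otimes> R n"
    by (subst interchange) simp_all
  then show ?thesis
    by (simp add: Del_def R_S_0)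
qed

lemma nab_comm: "\<gamma> (ob n) (ob p) ;; nab p n = nab n p"
proof -
  have "\<gamma> (ob n) (ob p) ;; S p \<otimes> S n = S n \<otimes> S p ;; \<gamma> (pw n) (pw p)"
    using symm_natural_arr[of "S n" "S p"] by simp
  then show ?thesis
    using cmp_eq_ext[of "\<gamma> (ob n) (ob p)" "S p \<otimes> S n" _ "R (p + n)"] symm_R[of n p]
    by (simp add: nab_def add.commute)
qed

lemma Del_cocomm: "Del n p ;; \<gamma> (ob n) (ob p) = Del p n"
proof -
  have "R n \<otimes> R p ;; \<gamma> (ob n) (ob p) = \<gamma> (pw n) (pw p) ;; R p \<otimes> R n"
    using symm_natural_arr[of "R n" "R p"] by simp
  moreover have "S (n + p) ;; (\<gamma> (pw n) (pw p) ;; R p \<otimes> R n) = S (p + n) ;; R p \<otimes> R n"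
    using cmp_eq_ext[OF S_symm[of n p], of "R p \<otimes> R n"] by (simp add: add.commute)
  moreover have "(n + p) choose n = (p + n) choose p"
    using binomial_symmetric[of n "n + p"] by (simp add: add.commute)
  ultimately show ?thesis
    by (simp add: Del_def)
qed

lemma Del_nab: "Del n p ;; nab n p = of_nat ((n + p) choose n) \<cdot> \<i>\<d> (ob (n + p))"
proof -
  have "R n \<otimes> R p ;; S n \<otimes> S p = (R n ;; S n) \<otimes> (R p ;; S p)"
    by (subst interchange) simp_all
  then have "R n \<otimes> R p ;; (S n \<otimes> S p ;; R (n + p)) = R (n + p)"
    using cmp_eq_ext[of "R n \<otimes> R p" "S n \<otimes> S p" _ "R (n + p)"] RS_tens_R by simp
  then show ?thesis
    by (simp add: Del_def nab_def)
qed

text \<open>The binomial coefficient disappears into the sum of unshuffles, which makes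
  \<open>bialgebra_summand\<close> free of scalars.\<close>

lemma Del_unsh: "Del a b = S (a + b) ;; (unsh a b ;; R a \<otimes> R b)"
  by (simp add: Del_def unsh_R)

text \<open>Naturality turns the swap of graded pieces into a swap of tensor powers
  (\<open>G\<close>), and the pairs \<open>R ;; S\<close> that then meet are absorbed
  (\<open>E\<close>). Two unshuffles followed by a block swap remain, one term of
  \<open>unsh_decomp\<close>.\<close>

lemma bialgebra_summand:
  "Del a b \<otimes> Del c d ;; (\<i>\<d> (ob a) \<otimes> (\<gamma> (ob b) (ob c) \<otimes> \<i>\<d> (ob d)) ;; nab a c \<otimes> nab b d) =
    S (a + b) \<otimes> S (c + d) ;; (unsh_blk (a, b, c, d) ;; R (a + c) \<otimes> R (b + d))"
proof -
  let ?RR = "R a \<otimes> (R b \<otimes> (R c \<otimes> R d))" and ?RR' = "R a \<otimes> (R c \<otimes> (R b \<otimes> R d))"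
    and ?SS' = "S a \<otimes> (S c \<otimes> (S b \<otimes> S d))"
  let ?G = "\<i>\<d> (ob a) \<otimes> (\<gamma> (ob b) (ob c) \<otimes> \<i>\<d> (ob d))"
  have D: "Del a b \<otimes> Del c d = S (a + b) \<otimes> S (c + d) ;; (unsh a b \<otimes> unsh c d ;; ?RR)"
  proof -
    have "Del a b \<otimes> Del c d = S (a + b) \<otimes> S (c + d) ;; (unsh a b \<otimes> unsh c d ;; (R a \<otimes> R b) \<otimes> (R c \<otimes> R d))"
      by (simp add: Del_unsh interchange del: tens_assoc)
    then show ?thesis by simp
  qed
  have G: "?RR ;; ?G = blk a b c d ;; ?RR'"
  proof -
    have "R b \<otimes> R c ;; \<gamma> (ob b) (ob c) = \<gamma> (pw b) (pw c) ;; R c \<otimes> R b"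
      using symm_natural_arr[of "R b" "R c"] by simp
    then have "R a \<otimes> ((R b \<otimes> R c) \<otimes> R d) ;; ?G = blk a b c d ;; R a \<otimes> ((R c \<otimes> R b) \<otimes> R d)"
      unfolding blk_def by (simp add: interchange del: tens_assoc)
    then show ?thesis by simp
  qed
  have N: "nab a c \<otimes> nab b d = ?SS' ;; R (a + c) \<otimes> R (b + d)"
  proof -
    have "nab a c \<otimes> nab b d = (S a \<otimes> S c) \<otimes> (S b \<otimes> S d) ;; R (a + c) \<otimes> R (b + d)"
      by (simp add: nab_def interchange del: tens_assoc)
    then show ?thesis by simp
  qed
  have E: "?RR' ;; (?SS' ;; R (a + c) \<otimes> R (b + d)) = R (a + c) \<otimes> R (b + d)"
  proof -
    have "(R a \<otimes> R c) \<otimes> (R b \<otimes> R d) ;; ((S a \<otimes> S c) \<otimes> (S b \<otimes> S d) ;; R (a + c) \<otimes> R (b + d)) =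
        ((R a ;; S a) \<otimes> (R c ;; S c) ;; R (a + c)) \<otimes> ((R b ;; S b) \<otimes> (R d ;; S d) ;; R (b + d))"
      by (simp add: ichg del: tens_assoc)
    then show ?thesis
      using RS_tens_R[of a c] RS_tens_R[of b d] by simp
  qed
  have "Del a b \<otimes> Del c d ;; (?G ;; nab a c \<otimes> nab b d) =
      S (a + b) \<otimes> S (c + d) ;; (unsh a b \<otimes> unsh c d ;; ((?RR ;; ?G) ;; (?SS' ;; R (a + c) \<otimes> R (b + d))))"
    unfolding D N by (simp add: add_ac)
  also have "\<dots> = S (a + b) \<otimes> S (c + d) ;; (unsh a b \<otimes> unsh c d ;; (blk a b c d ;; (?RR' ;; (?SS' ;; R (a + c) \<otimes> R (b + d)))))"
    unfolding G by (simp add: add_ac)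
  also have "\<dots> = S (a + b) \<otimes> S (c + d) ;; (unsh_blk (a, b, c, d) ;; R (a + c) \<otimes> R (b + d))"
    unfolding E unsh_blk_def by (simp add: add_ac)
  finally show ?thesis .
qed

lemma nab_Del:
  assumes "n + p = q + r"
  shows "nab n p ;; Del q r = hom_sum C (ob n \<otimes>\<^sub>o ob p) (ob q \<otimes>\<^sub>o ob r)
    (\<lambda>(a, b, c, d). Del a b \<otimes> Del c d ;; \<i>\<d> (ob a) \<otimes> \<gamma> (ob b) (ob c) \<otimes> \<i>\<d> (ob d) ;; nab a c \<otimes> nab b d)
    (bisplits n p q r)"
proof -
  let ?N = "pw (n + p)"
  have mem: "unsh_blk i \<in> Hom C ?N ?N" if "i \<in> bisplits n p q r" for i
    using that by (cases i) (auto simp: bisplits_iff Hom_iff add_ac)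
  have SS: "S n \<otimes> S p \<in> Hom C (ob n \<otimes>\<^sub>o ob p) ?N" by (simp add: Hom_iff)
  have RR: "R q \<otimes> R r \<in> Hom C ?N (ob q \<otimes>\<^sub>o ob r)" using assms by (simp add: Hom_iff)
  have "nab n p ;; Del q r = S n \<otimes> S p ;; (of_nat ((q + r) choose q) \<cdot> (R (q + r) ;; (S (q + r) ;; R q \<otimes> R r)))"
    using assms by (simp add: nab_def Del_def)
  also have "\<dots> = S n \<otimes> S p ;; (unsh q r ;; R q \<otimes> R r)"
    by (simp only: unsh_R)
  also have "\<dots> = S n \<otimes> S p ;; (hom_sum C ?N ?N unsh_blk (bisplits n p q r) ;; R q \<otimes> R r)"
    using unsh_decomp[of q r n p] assms by simp
  also have "\<dots> = S n \<otimes> S p ;; hom_sum C ?N (ob q \<otimes>\<^sub>o ob r) (\<lambda>i. unsh_blk i ;; R q \<otimes> R r) (bisplits n p q r)"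
    using mem RR by (subst hom_sum_cmp) auto
  also have "\<dots> = hom_sum C (ob n \<otimes>\<^sub>o ob p) (ob q \<otimes>\<^sub>o ob r)
      (\<lambda>i. S n \<otimes> S p ;; (unsh_blk i ;; R q \<otimes> R r)) (bisplits n p q r)"
    by (intro cmp_hom_sum cmp_Hom[OF mem RR] SS) auto
  also have "\<dots> = hom_sum C (ob n \<otimes>\<^sub>o ob p) (ob q \<otimes>\<^sub>o ob r)
    (\<lambda>(a, b, c, d). Del a b \<otimes> Del c d ;; \<i>\<d> (ob a) \<otimes> \<gamma> (ob b) (ob c) \<otimes> \<i>\<d> (ob d) ;; nab a c \<otimes> nab b d)
    (bisplits n p q r)"
  proof (rule hom_sum_cong)
    fix i assume i: "i \<in> bisplits n p q r"
    obtain a b c d where i': "i = (a, b, c, d)" by (cases i) auto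
    have *: "Del a b \<otimes> Del c d ;; \<i>\<d> (ob a) \<otimes> \<gamma> (ob b) (ob c) \<otimes> \<i>\<d> (ob d) ;; nab a c \<otimes> nab b d =
        S n \<otimes> S p ;; (unsh_blk (a, b, c, d) ;; R q \<otimes> R r)"
      using i bialgebra_summand[of a b c d] by (simp add: i' bisplits_iff)
    then show "S n \<otimes> S p ;; (unsh_blk i ;; R q \<otimes> R r) = (case i of (a, b, c, d) \<Rightarrow>
        Del a b \<otimes> Del c d ;; \<i>\<d> (ob a) \<otimes> \<gamma> (ob b) (ob c) \<otimes> \<i>\<d> (ob d) ;; nab a c \<otimes> nab b d)"
      by (simp add: i')
    show "(case i of (a, b, c, d) \<Rightarrow>
        Del a b \<otimes> Del c d ;; \<i>\<d> (ob a) \<otimes> \<gamma> (ob b) (ob c) \<otimes> \<i>\<d> (ob d) ;; nab a c \<otimes> nab b d)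
        \<in> Hom C (ob n \<otimes>\<^sub>o ob p) (ob q \<otimes>\<^sub>o ob r)"
      using cmp_Hom[OF SS cmp_Hom[OF mem[OF i] RR]] by (simp only: i' * prod.case)
  qed simp_all
  finally show ?thesis .
qed

end

lemma splitting_of_permutation_splitting:
  assumes "permutation_splitting C P" "A = psob P (Suc 0)"
  shows "splitting C A (psob P) (rr P) (ss P)"
proof -
  interpret permutation_splitting C P by fact
  interpret lin_power C A
    by unfold_locales (simp add: assms ps_obj)
  have A: "psob P 1 = A" by (simp add: assms)
  show ?thesis
  proof
    show "rr P n \<in> Hom C (pw n) (psob P n)" "ss P n \<in> Hom C (psob P n) (pw n)" for n
      using rr_Hom[of n] ss_Hom[of n] unfolding A pw_def by blast+
    show "rr P n ;;\<^bsub>C\<^esub> ss P n = (1 / fact n) \<cdot>\<^bsub>C\<^esub> psum n" for n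
      unfolding rr_ss A perm_sum_eq_psum ..
    show "psob P (Suc 0) = pw (Suc 0)" "rr P (Suc 0) = J (Suc 0)" "ss P (Suc 0) = J (Suc 0)"
      using rr_1 ss_1 unfolding pw_1 A by (simp_all add: A[simplified])
  qed (simp_all add: ps_obj ss_rr)
qed

lemma permutation_splitting_of_splitting:
  assumes "splitting C (psob P (Suc 0)) (psob P) (rr P) (ss P)"
  shows "permutation_splitting C P"
proof -
  define A where "A = psob P (Suc 0)"
  interpret splitting C A "psob P" "rr P" "ss P"
    using assms by (simp add: A_def)
  have A: "psob P 1 = A" by (simp add: A_def)
  show ?thesis
  proof
    show "rr P n ;;\<^bsub>C\<^esub> ss P n = (1 / fact n) \<cdot>\<^bsub>C\<^esub>
        hom_sum C (tpow_ob C (psob P 1) n) (tpow_ob C (psob P 1) n) (perm_map C (psob P 1) n)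
          {\<sigma>. \<sigma> permutes {..<n}}" for n
      unfolding A perm_sum_eq_psum by (rule R_S)
    show "rr P n \<in> Hom C (tpow_ob C (psob P 1) n) (psob P n)"
      "ss P n \<in> Hom C (psob P n) (tpow_ob C (psob P 1) n)" for n
      unfolding A pw_def[symmetric] by (rule R_Hom S_Hom)+
    show "rr P 1 = \<i>\<d>\<^bsub>C\<^esub> (psob P 1)" "ss P 1 = \<i>\<d>\<^bsub>C\<^esub> (psob P 1)"
      unfolding A by (simp_all add: R_1 S_1 pw_1)
  qed simp_all
qed

context splitting
begin

lemma Del_coassoc: "Del (n + p) q ;; Del n p \<otimes> \<i>\<d> (ob q) = Del n (p + q) ;; \<i>\<d> (ob n) \<otimes> Del p q"
proof -
  have "((n + p + q) choose (n + p)) * ((n + p) choose n) = ((n + p + q) choose n) * ((p + q) choose p)"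
    using choose_mult[of n "n + p" "n + p + q"] by (simp add: add.assoc)
  then show ?thesis
    unfolding Del_left Del_right by (simp add: add.assoc)
qed

lemma nab_counit: "nab 0 0 ;; S 0 = S 0 \<otimes> S 0" and unit_Del: "R 0 ;; Del 0 0 = R 0 \<otimes> R 0"
  using R_S_0 cmp_eq_ext[OF R_S_0, of "R 0 \<otimes> R 0"] by (simp_all add: nab_def Del_def)

lemma binomial_bimonoid_splitting:
  "binomial_bimonoid C \<lparr>bbob = ob, nabla = nab, Delta = Del, eta = R 0, eps = S 0\<rparr>"
  by unfold_locales
    (simp_all add: Hom_iff nab_unit nab_comm nab_left nab_right Del_counit Del_cocomm Del_coassoc
      nab_counit unit_Del R_S_0 Del_nab nab_Del bisplits_def del: tens_assoc, simp_all add: pw_0)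

text \<open>With \<open>Del_S\<close>, this is the recursion of the iterated operations; it lets the
  round trip from a splitting return \<open>R\<close> and \<open>S\<close>.\<close>

lemma nab_R: "R n \<otimes> J (Suc 0) ;; nab n (Suc 0) = R (Suc n)"
  using RS_Suc[of n] by (simp add: nab_def S_1)

lemma Del_S: "Del n (Suc 0) ;; S n \<otimes> J (Suc 0) = of_nat (Suc n) \<cdot> S (Suc n)"
proof -
  have "S (Suc n) ;; (R n \<otimes> J (Suc 0) ;; S n \<otimes> J (Suc 0)) = S (Suc n)"
    using S_RS_left[of n "Suc 0"] by (simp add: interchange)
  then show ?thesis
    by (simp add: Del_def R_1)
qed

end

section \<open>From binomial bimonoids to permutation splittings\<close>

locale bimonoid_power = binomial_bimonoid C B + lin_power C A
  for C :: "('o, 'a, 'x) lsmcat_scheme" (structure) and B :: "('o, 'a) bin_bimon" and A :: 'o +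
  assumes base_eq: "bbob B (Suc 0) = A"
begin

abbreviation ob :: "nat \<Rightarrow> 'o" where "ob \<equiv> bbob B"

lemma ob_1: "ob (Suc 0) = pw (Suc 0)"
  by (simp add: pw_1 base_eq)

declare bb_obj [simp]

lemma nabla_arr [simp]: "nabla B n p \<in> arrs C" "src C (nabla B n p) = ob n \<otimes>\<^sub>o ob p"
    "tgt C (nabla B n p) = ob (n + p)"
  using HomD[OF nabla_Hom] by auto

lemma Delta_arr [simp]: "Delta B n p \<in> arrs C" "tgt C (Delta B n p) = ob n \<otimes>\<^sub>o ob p"
    "src C (Delta B n p) = ob (n + p)"
  using HomD[OF Delta_Hom] by auto

lemma eta_arr [simp]: "eta B \<in> arrs C" "src C (eta B) = \<I>" "tgt C (eta B) = ob 0"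
  using HomD[OF eta_Hom] by auto

lemma eps_arr [simp]: "eps B \<in> arrs C" "src C (eps B) = ob 0" "tgt C (eps B) = \<I>"
  using HomD[OF eps_Hom] by auto

declare eta_eps [simp] eps_eta [simp] eta_eps[folded pw_0, simp]

text \<open>\<open>eta\<close> and \<open>eps\<close> are mutually inverse, so the unit law can be
  solved for the multiplication.\<close>

lemma nabla_0_left: "nabla B 0 n = eps B \<otimes> \<i>\<d> (ob n)"
proof -
  have "eps B \<otimes> \<i>\<d> (ob n) = eps B \<otimes> \<i>\<d> (ob n) ;; (eta B \<otimes> \<i>\<d> (ob n) ;; nabla B 0 n)"
    by (simp add: nabla_unit)
  also have "\<dots> = nabla B 0 n"
    by (simp add: ichg)
  finally show ?thesis ..
qed

lemma nabla_0_right: "nabla B n 0 = \<i>\<d> (ob n) \<otimes> eps B"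
  using symm_natural_arr[of "\<i>\<d> (ob n)" "eps B"] nabla_comm[of n 0] by (simp add: nabla_0_left)

lemma Delta_0_left: "Delta B 0 n = eta B \<otimes> \<i>\<d> (ob n)"
proof -
  have "eta B \<otimes> \<i>\<d> (ob n) = (Delta B 0 n ;; eps B \<otimes> \<i>\<d> (ob n)) ;; eta B \<otimes> \<i>\<d> (ob n)"
    by (subst Delta_counit) simp
  also have "\<dots> = Delta B 0 n"
    by (simp add: ichg)
  finally show ?thesis ..
qed

lemma Delta_0_right: "Delta B n 0 = \<i>\<d> (ob n) \<otimes> eta B"
  using symm_natural_arr[of "eta B" "\<i>\<d> (ob n)"] Delta_cocomm[of 0 n] by (simp add: Delta_0_left)

text \<open>Starting at \<open>eta\<close> gives one recursion for all \<open>n\<close>; the unit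
  law makes degree 1 the identity, in agreement with the case distinction of
  \<open>bb_to_ps\<close>.\<close>

primrec prod1 :: "nat \<Rightarrow> 'a" where
  "prod1 0 = eta B"
| "prod1 (Suc n) = prod1 n \<otimes> J (Suc 0) ;; nabla B n (Suc 0)"

primrec coprod1 :: "nat \<Rightarrow> 'a" where
  "coprod1 0 = eps B"
| "coprod1 (Suc n) = Delta B n (Suc 0) ;; coprod1 n \<otimes> J (Suc 0)"

lemma prod1_arr_aux: "prod1 n \<in> arrs C \<and> src C (prod1 n) = pw n \<and> tgt C (prod1 n) = ob n"
  by (induction n) (simp_all add: pw_0 ob_1)

lemma prod1_arr [simp]: "prod1 n \<in> arrs C" "src C (prod1 n) = pw n" "tgt C (prod1 n) = ob n"
  using prod1_arr_aux by auto

lemma coprod1_arr_aux: "coprod1 n \<in> arrs C \<and> src C (coprod1 n) = ob n \<and> tgt C (coprod1 n) = pw n"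
  by (induction n) (simp_all add: pw_0 ob_1)

lemma coprod1_arr [simp]: "coprod1 n \<in> arrs C" "src C (coprod1 n) = ob n" "tgt C (coprod1 n) = pw n"
  using coprod1_arr_aux by auto

lemma prod1_1: "prod1 (Suc 0) = J (Suc 0)"
  using nabla_unit[of "Suc 0"] by (simp add: ob_1)

lemma coprod1_1: "coprod1 (Suc 0) = J (Suc 0)"
  using Delta_counit[of "Suc 0"] by (simp add: ob_1)

lemma nabla_iter_1: "nabla_iter C B (\<lambda>_. 1) k = prod1 (Suc (Suc k))"
proof (induction k)
  case 0
  then show ?case
    using prod1_1 by (simp add: ob_1)
qed (simp add: ob_1)

lemma Delta_iter_1: "Delta_iter C B (\<lambda>_. 1) k = coprod1 (Suc (Suc k))"
proof (induction k)
  case 0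
  then show ?case
    using coprod1_1 by (simp add: ob_1)
qed (simp add: ob_1)

lemma rr_bb_to_ps: "rr (bb_to_ps C B) n = prod1 n"
  using prod1_1 nabla_iter_1
  by (auto simp: bb_to_ps_def ob_1 simp del: prod1.simps(2) split: nat.split)

lemma ss_bb_to_ps: "ss (bb_to_ps C B) n = (1 / fact n) \<cdot> coprod1 n"
  using coprod1_1 Delta_iter_1
  by (auto simp: bb_to_ps_def ob_1 simp del: coprod1.simps(2) fact_Suc split: nat.split)

lemma nabla_Delta_0_1: "nabla B 0 (Suc 0) ;; Delta B 0 (Suc 0) = \<i>\<d> (ob 0 \<otimes>\<^sub>o ob (Suc 0))"
  by (simp add: nabla_0_left Delta_0_left ichg)

text \<open>Splitting off one factor leaves two terms: the last factor goes straight through, or it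
  is exchanged with a factor of the first argument. In degree 0 there is nothing to exchange, hence
  \<open>nabla_Delta_0_1\<close>.\<close>

lemma nabla_Delta_Suc_1:
  "nabla B (Suc n) (Suc 0) ;; Delta B (Suc n) (Suc 0) =
     \<i>\<d> (ob (Suc n) \<otimes>\<^sub>o ob (Suc 0)) \<oplus>\<^sub>h
     (Delta B n (Suc 0) \<otimes> \<i>\<d> (ob (Suc 0)) ;;
      (\<i>\<d> (ob n) \<otimes> \<gamma> (ob (Suc 0)) (ob (Suc 0)) ;; nabla B n (Suc 0) \<otimes> \<i>\<d> (ob (Suc 0))))"
proof -
  let ?X = "ob (Suc n) \<otimes>\<^sub>o ob (Suc 0)"
  let ?T = "\<lambda>(a, b, c, d). Delta B a b \<otimes> Delta B c d ;;
     \<i>\<d> (ob a) \<otimes> \<gamma> (ob b) (ob c) \<otimes> \<i>\<d> (ob d) ;; nabla B a c \<otimes> nabla B b d"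
  have set: "{(a, b, c, d). a + b = Suc n \<and> c + d = Suc 0 \<and> a + c = Suc n \<and> b + d = Suc 0} =
      {(Suc n, 0, 0, Suc 0), (n, Suc 0, Suc 0, 0)}"
    by auto
  \<comment> \<open>\<open>ob 0\<close> is isomorphic to the unit object but need not be equal to
    it, so \<open>symm_tunit\<close> does not apply; naturality against \<open>eps\<close> removes
    the symmetry.\<close>
  have ee: "eta B \<otimes> eta B ;; (\<gamma> (ob 0) (ob 0) ;; eps B \<otimes> eps B) = \<i>\<d> \<I>"
  proof -
    have "\<gamma> (ob 0) (ob 0) ;; eps B \<otimes> eps B = eps B \<otimes> eps B"
      using symm_natural_arr[of "eps B" "eps B"] by simp
    then show ?thesis by (simp add: interchange)
  qed
  have 1: "?T (Suc n, 0, 0, Suc 0) = \<i>\<d> ?X"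
  proof -
    have "(\<i>\<d> (ob (Suc n)) \<otimes> eta B) \<otimes> (eta B \<otimes> \<i>\<d> (ob (Suc 0))) ;;
        (\<i>\<d> (ob (Suc n)) \<otimes> \<gamma> (ob 0) (ob 0) \<otimes> \<i>\<d> (ob (Suc 0)) ;;
        (\<i>\<d> (ob (Suc n)) \<otimes> eps B) \<otimes> (eps B \<otimes> \<i>\<d> (ob (Suc 0)))) =
        \<i>\<d> (ob (Suc n)) \<otimes> ((eta B \<otimes> eta B ;; (\<gamma> (ob 0) (ob 0) ;; eps B \<otimes> eps B)) \<otimes> \<i>\<d> (ob (Suc 0)))"
      by (simp add: whisker)
    then show ?thesis
      by (simp add: ee nabla_0_left nabla_0_right Delta_0_left Delta_0_right)
  qed
  have 2: "?T (n, Suc 0, Suc 0, 0) = Delta B n (Suc 0) \<otimes> \<i>\<d> (ob (Suc 0)) ;;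
      (\<i>\<d> (ob n) \<otimes> \<gamma> (ob (Suc 0)) (ob (Suc 0)) ;; nabla B n (Suc 0) \<otimes> \<i>\<d> (ob (Suc 0)))"
  proof -
    let ?G = "\<i>\<d> (ob n) \<otimes> \<gamma> (ob (Suc 0)) (ob (Suc 0))"
    have "?T (n, Suc 0, Suc 0, 0) = (Delta B n (Suc 0) \<otimes> \<i>\<d> (ob (Suc 0))) \<otimes> eta B ;;
        (?G \<otimes> \<i>\<d> (ob 0) ;; (nabla B n (Suc 0) \<otimes> \<i>\<d> (ob (Suc 0))) \<otimes> eps B)"
      by (simp add: nabla_0_right Delta_0_right)
    also have "\<dots> = (Delta B n (Suc 0) \<otimes> \<i>\<d> (ob (Suc 0)) ;; (?G ;; nabla B n (Suc 0) \<otimes> \<i>\<d> (ob (Suc 0))))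
        \<otimes> (eta B ;; eps B)"
      by (simp add: interchange del: tens_assoc eta_eps)
    finally show ?thesis by simp
  qed
  have "nabla B (Suc n) (Suc 0) ;; Delta B (Suc n) (Suc 0) =
      hom_sum C ?X ?X ?T {(Suc n, 0, 0, Suc 0), (n, Suc 0, Suc 0, 0)}"
    using nabla_Delta[of "Suc n" "Suc 0" "Suc n" "Suc 0"] by (simp only: set)
  also have "\<dots> = ?T (Suc n, 0, 0, Suc 0) \<oplus>\<^sub>h hom_sum C ?X ?X ?T {(n, Suc 0, Suc 0, 0)}"
  proof (rule hom_sum_insert)
    fix i assume "i \<in> {(Suc n, 0, 0, Suc 0), (n, Suc 0, Suc 0, 0)}"
    then show "?T i \<in> Hom C ?X ?X"
      using 1 2 by (auto simp: Hom_iff)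
  qed simp_all
  also have "hom_sum C ?X ?X ?T {(n, Suc 0, Suc 0, 0)} = ?T (n, Suc 0, Suc 0, 0)"
    by (rule hom_sum_singleton) (simp only: 2, simp add: Hom_iff)
  finally show ?thesis
    by (simp only: 1 2)
qed

text \<open>By induction the two terms of \<open>nabla_Delta_Suc_1\<close> turn into those of
  \<open>ins_sum_Suc\<close>, the exchange supplying \<open>tr n 0\<close>.\<close>

lemma nabla_coprod1: "nabla B n (Suc 0) ;; coprod1 (Suc n) = coprod1 n \<otimes> J (Suc 0) ;; ins_sum n"
proof (induction n)
  case 0
  have "nabla B 0 (Suc 0) ;; coprod1 (Suc 0) = (nabla B 0 (Suc 0) ;; Delta B 0 (Suc 0)) ;; eps B \<otimes> J (Suc 0)"
    by (simp add: ob_1)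
  then show ?case
    unfolding nabla_Delta_0_1 by (simp add: ob_1 ins_sum_0)
next
  case (Suc n)
  let ?D = "coprod1 (Suc n) \<otimes> J (Suc 0)"
  let ?G = "\<i>\<d> (ob n) \<otimes> \<gamma> (pw (Suc 0)) (pw (Suc 0))"
  have G: "?G ;; coprod1 n \<otimes> J (Suc (Suc 0)) = coprod1 n \<otimes> J (Suc (Suc 0)) ;; tr n 0"
    by (simp add: tr_def interchange)
  have "nabla B (Suc n) (Suc 0) ;; coprod1 (Suc (Suc n)) =
      (nabla B (Suc n) (Suc 0) ;; Delta B (Suc n) (Suc 0)) ;; ?D"
    by (simp add: ob_1)
  also have "\<dots> = ?D \<oplus>\<^sub>h (Delta B n (Suc 0) \<otimes> J (Suc 0) ;;
      (?G ;; (nabla B n (Suc 0) ;; coprod1 (Suc n)) \<otimes> J (Suc 0)))"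
    unfolding nabla_Delta_Suc_1 by (simp add: hadd_cmp_arr ob_1 whisker del: coprod1.simps)
  also have "Delta B n (Suc 0) \<otimes> J (Suc 0) ;; (?G ;; (nabla B n (Suc 0) ;; coprod1 (Suc n)) \<otimes> J (Suc 0)) =
      Delta B n (Suc 0) \<otimes> J (Suc 0) ;; ((?G ;; coprod1 n \<otimes> J (Suc (Suc 0))) ;; ins_sum n \<otimes> J (Suc 0))"
    unfolding Suc.IH by (simp add: whisker ob_1)
  also have "\<dots> = ?D ;; (tr n 0 ;; ins_sum n \<otimes> J (Suc 0))"
    unfolding G by (simp add: whisker ob_1)
  also have "?D \<oplus>\<^sub>h \<dots> = ?D ;; ins_sum (Suc n)"
    unfolding ins_sum_Suc by (simp add: cmp_hadd_arr del: coprod1.simps)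
  finally show ?case .
qed

lemma prod1_coprod1: "prod1 n ;; coprod1 n = psum n"
proof (induction n)
  case 0
  then show ?case by (simp add: psum_0 pw_0)
next
  case (Suc n)
  have "prod1 (Suc n) ;; coprod1 (Suc n) = prod1 n \<otimes> J (Suc 0) ;; (nabla B n (Suc 0) ;; coprod1 (Suc n))"
    by (simp add: ob_1)
  also have "\<dots> = (prod1 n ;; coprod1 n) \<otimes> J (Suc 0) ;; ins_sum n"
    unfolding nabla_coprod1 by (simp add: whisker)
  finally show ?case
    by (simp add: Suc.IH psum_Suc)
qed

text \<open>Each step contributes \<open>(n + 1) choose n = n + 1\<close> by
  \<open>Delta_nabla\<close>, which accounts for the normalization \<open>1 / n!\<close> of
  \<open>ss\<close>.\<close>

lemma coprod1_prod1: "coprod1 n ;; prod1 n = fact n \<cdot> \<i>\<d> (ob n)"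
proof (induction n)
  case 0
  then show ?case by simp
next
  case (Suc n)
  have "coprod1 (Suc n) ;; prod1 (Suc n) =
      Delta B n (Suc 0) ;; ((coprod1 n ;; prod1 n) \<otimes> J (Suc 0) ;; nabla B n (Suc 0))"
    by (simp add: ob_1 whisker)
  also have "\<dots> = fact n \<cdot> (Delta B n (Suc 0) ;; nabla B n (Suc 0))"
    unfolding Suc.IH by (simp add: ob_1)
  also have "\<dots> = fact (Suc n) \<cdot> \<i>\<d> (ob (Suc n))"
    using Delta_nabla[of n "Suc 0"] by (simp add: mult.commute)
  finally show ?case .
qed

lemma splitting_bb_to_ps: "splitting C A ob prod1 (\<lambda>n. (1 / fact n) \<cdot> coprod1 n)"
  by unfold_locales (simp_all add: Hom_iff prod1_coprod1 coprod1_prod1 ob_1 prod1_1 coprod1_1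
      del: prod1.simps(2) coprod1.simps(2))

lemma prod1_add: "prod1 n \<otimes> prod1 p ;; nabla B n p = prod1 (n + p)"
proof (induction p)
  case 0
  have "prod1 n \<otimes> eta B ;; nabla B n 0 = (prod1 n ;; \<i>\<d> (ob n)) \<otimes> (eta B ;; eps B)"
    unfolding nabla_0_right by (subst interchange) simp_all
  then show ?case by simp
next
  case (Suc p)
  have "prod1 n \<otimes> prod1 (Suc p) ;; nabla B n (Suc p) =
      prod1 n \<otimes> (prod1 p \<otimes> J (Suc 0)) ;; (\<i>\<d> (ob n) \<otimes> nabla B p (Suc 0) ;; nabla B n (p + Suc 0))"
    by (simp add: ob_1 ichg)
  also have "\<dots> = prod1 n \<otimes> (prod1 p \<otimes> J (Suc 0)) ;; (nabla B n p \<otimes> \<i>\<d> (ob (Suc 0)) ;; nabla B (n + p) (Suc 0))"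
    unfolding nabla_assoc ..
  also have "\<dots> = (prod1 n \<otimes> prod1 p ;; nabla B n p) \<otimes> J (Suc 0) ;; nabla B (n + p) (Suc 0)"
    by (simp add: ob_1 whisker)
  finally show ?case
    by (simp add: Suc.IH)
qed

lemma coprod1_add: "Delta B n p ;; coprod1 n \<otimes> coprod1 p = coprod1 (n + p)"
proof (induction p)
  case 0
  have "Delta B n 0 ;; coprod1 n \<otimes> eps B = (\<i>\<d> (ob n) ;; coprod1 n) \<otimes> (eta B ;; eps B)"
    unfolding Delta_0_right by (subst interchange) simp_all
  then show ?case by simp
next
  case (Suc p)
  have "Delta B n (Suc p) ;; coprod1 n \<otimes> coprod1 (Suc p) =
      (Delta B n (p + Suc 0) ;; \<i>\<d> (ob n) \<otimes> Delta B p (Suc 0)) ;; coprod1 n \<otimes> (coprod1 p \<otimes> J (Suc 0))"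
    by (simp add: ob_1 ichg)
  also have "\<dots> = (Delta B (n + p) (Suc 0) ;; Delta B n p \<otimes> \<i>\<d> (ob (Suc 0))) ;; coprod1 n \<otimes> (coprod1 p \<otimes> J (Suc 0))"
    unfolding Delta_coassoc ..
  also have "\<dots> = Delta B (n + p) (Suc 0) ;; (Delta B n p ;; coprod1 n \<otimes> coprod1 p) \<otimes> J (Suc 0)"
    by (simp add: ob_1 whisker)
  finally show ?case
    by (simp add: Suc.IH)
qed

text \<open>Expand \<open>prod1 (n + p)\<close> by \<open>prod1_add\<close>; the inner composites
  collapse to \<open>n!\<close> and \<open>p!\<close>, which the normalization cancels.\<close>

lemma nabla_eq: "(1 / fact n) \<cdot> coprod1 n \<otimes> (1 / fact p) \<cdot> coprod1 p ;; prod1 (n + p) = nabla B n p"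
proof -
  have "coprod1 n \<otimes> coprod1 p ;; prod1 n \<otimes> prod1 p = (fact n * fact p) \<cdot> \<i>\<d> (ob n \<otimes>\<^sub>o ob p)"
    by (simp add: interchange coprod1_prod1 mult.commute)
  from cmp_eq_ext[OF this, of "nabla B n p"]
  have "coprod1 n \<otimes> coprod1 p ;; prod1 (n + p) = (fact n * fact p) \<cdot> nabla B n p"
    by (simp add: prod1_add)
  then show ?thesis by simp
qed

text \<open>The same collapse leaves \<open>n! p! / (n + p)!\<close>, the inverse of the binomial
  coefficient in \<open>ps_to_bb\<close>.\<close>

lemma Delta_eq:
  "of_nat ((n + p) choose n) \<cdot> ((1 / fact (n + p)) \<cdot> coprod1 (n + p) ;; prod1 n \<otimes> prod1 p) = Delta B n p"
proof -
  have "coprod1 n \<otimes> coprod1 p ;; prod1 n \<otimes> prod1 p = (fact n * fact p) \<cdot> \<i>\<d> (ob n \<otimes>\<^sub>o ob p)"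
    by (simp add: interchange coprod1_prod1 mult.commute)
  then have "coprod1 (n + p) ;; prod1 n \<otimes> prod1 p = (fact n * fact p) \<cdot> Delta B n p"
    unfolding coprod1_add[symmetric] by simp
  moreover have "of_nat ((n + p) choose n) * (1 / fact (n + p)) * (fact n * fact p) = (1 :: rat)"
    by (simp add: binomial_fact)
  ultimately show ?thesis by (simp add: mult.assoc)
qed

end

lemma bimonoid_powerI:
  assumes "binomial_bimonoid C B" "A = bbob B (Suc 0)"
  shows "bimonoid_power C B A"
proof -
  interpret binomial_bimonoid C B by fact
  show ?thesis
    by unfold_locales (simp_all add: assms bb_obj)
qed

lemma permutation_splitting_bb_to_ps:
  assumes "binomial_bimonoid C B"
  shows "permutation_splitting C (bb_to_ps C B)"
proof (rule permutation_splitting_of_splitting)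
  interpret bimonoid_power C B "bbob B (Suc 0)"
    using assms by (rule bimonoid_powerI) (rule refl)
  have "psob (bb_to_ps C B) = bbob B" by (simp add: bb_to_ps_def)
  moreover have "rr (bb_to_ps C B) = prod1" "ss (bb_to_ps C B) = (\<lambda>n. (1 / fact n) \<cdot>\<^bsub>C\<^esub> coprod1 n)"
    by (rule ext, rule rr_bb_to_ps ss_bb_to_ps)+
  ultimately show "splitting C (psob (bb_to_ps C B) (Suc 0)) (psob (bb_to_ps C B))
      (rr (bb_to_ps C B)) (ss (bb_to_ps C B))"
    by (simp only: splitting_bb_to_ps)
qed

lemma ps_to_bb_eq:
  assumes "permutation_splitting C P" "A = psob P (Suc 0)"
  shows "ps_to_bb C P = \<lparr>bbob = psob P, nabla = splitting.nab C (rr P) (ss P),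
    Delta = splitting.Del C (rr P) (ss P), eta = rr P 0, eps = ss P 0\<rparr>"
proof -
  interpret splitting C A "psob P" "rr P" "ss P"
    using assms by (rule splitting_of_permutation_splitting)
  show ?thesis
    by (simp add: ps_to_bb_def nab_def Del_def fun_eq_iff)
qed

lemma binomial_bimonoid_ps_to_bb:
  assumes "permutation_splitting C P"
  shows "binomial_bimonoid C (ps_to_bb C P)"
proof -
  define A where "A = psob P (Suc 0)"
  interpret splitting C A "psob P" "rr P" "ss P"
    using assms A_def by (rule splitting_of_permutation_splitting)
  show ?thesis
    unfolding ps_to_bb_eq[OF assms A_def] by (rule binomial_bimonoid_splitting)
qed

lemma ps_to_bb_bb_to_ps:
  assumes "binomial_bimonoid C B"
  shows "ps_to_bb C (bb_to_ps C B) = B"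
proof -
  define A where "A = bbob B (Suc 0)"
  interpret bimonoid_power C B A
    using assms A_def by (rule bimonoid_powerI)
  have "psob (bb_to_ps C B) = bbob B" by (simp add: bb_to_ps_def)
  then show ?thesis
    by (simp add: ps_to_bb_def rr_bb_to_ps ss_bb_to_ps nabla_eq Delta_eq del: smul_cmp_arr smul_tens_arr)
qed

lemma bb_to_ps_ps_to_bb:
  assumes "permutation_splitting C P"
  shows "bb_to_ps C (ps_to_bb C P) = P"
proof -
  define A where "A = psob P (Suc 0)"
  interpret S: splitting C A "psob P" "rr P" "ss P"
    using assms A_def by (rule splitting_of_permutation_splitting)
  interpret B: bimonoid_power C "ps_to_bb C P" A
    using binomial_bimonoid_ps_to_bb[OF assms]
    by (rule bimonoid_powerI) (simp add: ps_to_bb_def A_def)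
  have sel: "nabla (ps_to_bb C P) = S.nab" "Delta (ps_to_bb C P) = S.Del"
    "eta (ps_to_bb C P) = rr P 0" "eps (ps_to_bb C P) = ss P 0"
    by (simp_all add: ps_to_bb_eq[OF assms A_def])
  have "B.prod1 n = rr P n" for n
    by (induction n) (simp_all add: sel S.nab_R)
  \<comment> \<open>Each comultiplication contributes the factor of \<open>Del_S\<close>; their
    product is the \<open>n!\<close> that \<open>bb_to_ps\<close> divides out.\<close>
  moreover have "B.coprod1 n = fact n \<cdot>\<^bsub>C\<^esub> ss P n" for n
    by (induction n) (simp_all add: sel S.Del_S S.ob_1 mult.commute)
  moreover have "psob (bb_to_ps C (ps_to_bb C P)) = psob P"
    by (simp add: bb_to_ps_def ps_to_bb_def)
  ultimately show ?thesis
    by (intro perm_split.equality) (simp_all add: B.rr_bb_to_ps B.ss_bb_to_ps fun_eq_iff)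
qed

section \<open>Morphisms and functors\<close>

lemma category_struct_cat:
  assumes "\<And>X. X \<in> Obs \<Longrightarrow> mor X X (idm X)"
    and "\<And>X Y Z f g. \<lbrakk>X \<in> Obs; Y \<in> Obs; Z \<in> Obs; mor X Y f; mor Y Z g\<rbrakk> \<Longrightarrow> mor X Z (cmpm f g)"
    and "\<And>X Y f. \<lbrakk>X \<in> Obs; Y \<in> Obs; mor X Y f\<rbrakk> \<Longrightarrow> cmpm (idm X) f = f"
    and "\<And>X Y f. \<lbrakk>X \<in> Obs; Y \<in> Obs; mor X Y f\<rbrakk> \<Longrightarrow> cmpm f (idm Y) = f"
    and "\<And>X Y Z W f g h. \<lbrakk>X \<in> Obs; Y \<in> Obs; Z \<in> Obs; W \<in> Obs; mor X Y f; mor Y Z g; mor Z W h\<rbrakk>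
      \<Longrightarrow> cmpm (cmpm f g) h = cmpm f (cmpm g h)"
  shows "category (struct_cat Obs mor idm cmpm)"
  by unfold_locales (use assms in \<open>auto simp: struct_cat_def Hom_def\<close>)

text \<open>Reduces an isomorphism of the built categories to conditions on the underlying maps, for
  use in all three cases.\<close>

lemma isomorphism_struct_functor:
  assumes C: "category (struct_cat Obs mor idm cmpm)" and D: "category (struct_cat Obs' mor' idm' cmpm')"
    and "\<And>X. X \<in> Obs \<Longrightarrow> \<Phi> X \<in> Obs'" "\<And>X. X \<in> Obs' \<Longrightarrow> \<Psi> X \<in> Obs"
    and "\<And>X Y f. \<lbrakk>X \<in> Obs; Y \<in> Obs; mor X Y f\<rbrakk> \<Longrightarrow> mor' (\<Phi> X) (\<Phi> Y) (\<phi> X Y f)"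
    and "\<And>X Y f. \<lbrakk>X \<in> Obs'; Y \<in> Obs'; mor' X Y f\<rbrakk> \<Longrightarrow> mor (\<Psi> X) (\<Psi> Y) (\<psi> X Y f)"
    and "\<And>X. X \<in> Obs \<Longrightarrow> \<phi> X X (idm X) = idm' (\<Phi> X)"
    and "\<And>X. X \<in> Obs' \<Longrightarrow> \<psi> X X (idm' X) = idm (\<Psi> X)"
    and "\<And>X Y Z f g. \<lbrakk>X \<in> Obs; Y \<in> Obs; Z \<in> Obs; mor X Y f; mor Y Z g\<rbrakk>
      \<Longrightarrow> \<phi> X Z (cmpm f g) = cmpm' (\<phi> X Y f) (\<phi> Y Z g)"
    and "\<And>X Y Z f g. \<lbrakk>X \<in> Obs'; Y \<in> Obs'; Z \<in> Obs'; mor' X Y f; mor' Y Z g\<rbrakk>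
      \<Longrightarrow> \<psi> X Z (cmpm' f g) = cmpm (\<psi> X Y f) (\<psi> Y Z g)"
    and "\<And>X. X \<in> Obs \<Longrightarrow> \<Psi> (\<Phi> X) = X" "\<And>X. X \<in> Obs' \<Longrightarrow> \<Phi> (\<Psi> X) = X"
    and "\<And>X Y f. \<lbrakk>X \<in> Obs; Y \<in> Obs; mor X Y f\<rbrakk> \<Longrightarrow> \<psi> (\<Phi> X) (\<Phi> Y) (\<phi> X Y f) = f"
    and "\<And>X Y f. \<lbrakk>X \<in> Obs'; Y \<in> Obs'; mor' X Y f\<rbrakk> \<Longrightarrow> \<phi> (\<Psi> X) (\<Psi> Y) (\<psi> X Y f) = f"
  shows "isomorphism_with_inverse (struct_cat Obs mor idm cmpm) (struct_cat Obs' mor' idm' cmpm')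
    (struct_functor \<Phi> \<phi>) (struct_functor \<Psi> \<psi>)"
proof -
  have "cat_functor (struct_cat Obs mor idm cmpm) (struct_cat Obs' mor' idm' cmpm') (struct_functor \<Phi> \<phi>)"
    by (intro cat_functor.intro cat_functor_axioms.intro C D)
      (use assms(3-10) in \<open>auto simp: struct_cat_def struct_functor_def Hom_def\<close>)
  moreover have "cat_functor (struct_cat Obs' mor' idm' cmpm') (struct_cat Obs mor idm cmpm) (struct_functor \<Psi> \<psi>)"
    by (intro cat_functor.intro cat_functor_axioms.intro C D)
      (use assms(3-10) in \<open>auto simp: struct_cat_def struct_functor_def Hom_def\<close>)
  ultimately show ?thesis
    unfolding isomorphism_with_inverse_def
    using assms(11-14) by (auto simp: struct_cat_def struct_functor_def)
qed

section \<open>Tensor powers of an arrow and the extension of degree-one morphisms\<close>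

locale lin_power_map = lin_power C A + T: lin_power C A'
  for C :: "('o, 'a, 'x) lsmcat_scheme" (structure) and A A' :: 'o +
  fixes f :: 'a
  assumes f_Hom: "f \<in> Hom C A A'"
begin

abbreviation fp :: "nat \<Rightarrow> 'a" where "fp n \<equiv> tpow C f n"

lemma f_arr [simp]: "f \<in> arrs C" "src C f = pw (Suc 0)" "tgt C f = T.pw (Suc 0)"
  using HomD[OF f_Hom] by (simp_all add: pw_1 T.pw_1)

lemma fp_arr_aux: "fp n \<in> arrs C \<and> src C (fp n) = pw n \<and> tgt C (fp n) = T.pw n"
  by (induction n) (simp_all add: pw_0 T.pw_0)

lemma fp_arr [simp]: "fp n \<in> arrs C" "src C (fp n) = pw n" "tgt C (fp n) = T.pw n"
  using fp_arr_aux by auto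

lemma fp_1: "fp (Suc 0) = f"
  by simp

lemma fp_add: "fp (m + n) = fp m \<otimes> fp n"
  by (induction n) simp_all

text \<open>The tensor power can be bracketed with the single \<open>f\<close> before or after the
  middle block; naturality of the symmetry links the two.\<close>

lemma cyc_fp: "cyc k m ;; fp (Suc (k + m)) = fp (Suc (k + m)) ;; T.cyc k m"
proof -
  have 1: "fp (Suc (k + m)) = fp k \<otimes> (f \<otimes> fp m)"
    using fp_add[of k "Suc 0 + m"] fp_add[of "Suc 0" m] by (simp del: tpow.simps(2) add: fp_1)
  have 2: "fp (Suc (k + m)) = fp k \<otimes> (fp m \<otimes> f)"
    by (simp add: fp_add)
  have "\<gamma> (pw m) (pw (Suc 0)) ;; f \<otimes> fp m = fp m \<otimes> f ;; \<gamma> (T.pw m) (T.pw (Suc 0))"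
    using symm_natural_arr[of "fp m" f] by simp
  then have "cyc k m ;; fp k \<otimes> (f \<otimes> fp m) = fp k \<otimes> (fp m \<otimes> f) ;; T.cyc k m"
    by (simp add: cyc_def T.cyc_def interchange)
  then show ?thesis
    by (simp only: 1[symmetric] 2[symmetric])
qed

lemma ins_sum_fp: "ins_sum n ;; fp (Suc n) = fp (Suc n) ;; T.ins_sum n"
proof -
  have "ins_sum n ;; fp (Suc n) =
      hom_sum C (pw (Suc n)) (T.pw (Suc n)) (\<lambda>k. cyc k (n - k) ;; fp (Suc n)) {..n}"
    unfolding ins_sum_def by (rule hom_sum_cmp) (auto simp: Hom_iff simp del: tpow.simps)
  also have "\<dots> = hom_sum C (pw (Suc n)) (T.pw (Suc n)) (\<lambda>k. fp (Suc n) ;; T.cyc k (n - k)) {..n}"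
  proof (rule hom_sum_cong)
    show "cyc k (n - k) ;; fp (Suc n) = fp (Suc n) ;; T.cyc k (n - k)" if "k \<in> {..n}" for k
      using cyc_fp[of k "n - k"] that by (simp del: tpow.simps)
  qed (auto simp: Hom_iff simp del: tpow.simps)
  also have "\<dots> = fp (Suc n) ;; T.ins_sum n"
    unfolding T.ins_sum_def by (rule cmp_hom_sum[symmetric]) (auto simp: Hom_iff simp del: tpow.simps)
  finally show ?thesis .
qed

text \<open>Through the recursion \<open>psum_Suc\<close>, naturality is needed for cycles only, not
  for arbitrary permutations.\<close>

lemma psum_fp: "psum n ;; fp n = fp n ;; T.psum n"
proof (induction n)
  case 0
  then show ?case by (simp add: psum_0 T.psum_0 pw_0 T.pw_0)
next
  case (Suc n)
  have "psum (Suc n) ;; fp (Suc n) = psum n \<otimes> J (Suc 0) ;; (fp (Suc n) ;; T.ins_sum n)"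
    by (simp add: psum_Suc ins_sum_fp del: tpow.simps)
  also have "\<dots> = (psum n ;; fp n) \<otimes> f ;; T.ins_sum n"
    by (simp add: ichg)
  also have "\<dots> = fp (Suc n) ;; T.psum (Suc n)"
    unfolding Suc.IH by (simp add: T.psum_Suc ichg)
  finally show ?case .
qed

end

locale splitting_map = splitting C A ob R S + T: splitting C A' ob' R' S' + lin_power_map C A A' f
  for C :: "('o, 'a, 'x) lsmcat_scheme" (structure) and A ob R S A' ob' R' S' f
begin

lemma RS_fp: "R n ;; (S n ;; fp n) = fp n ;; (R' n ;; S' n)"
  by (simp add: R_S_ext T.R_S psum_fp)

lemma extend_R: "R n ;; (S n ;; fp n ;; R' n) = fp n ;; R' n"
proof -
  have "R n ;; (S n ;; fp n ;; R' n) = (R n ;; (S n ;; fp n)) ;; R' n"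
    by simp
  then show ?thesis unfolding RS_fp by simp
qed

lemma extend_S: "S n ;; fp n ;; R' n ;; S' n = S n ;; fp n"
proof -
  have "S n ;; fp n ;; R' n ;; S' n = S n ;; (fp n ;; (R' n ;; S' n))"
    by simp
  then show ?thesis unfolding RS_fp[symmetric] by simp
qed

lemma extend_1: "S (Suc 0) ;; fp (Suc 0) ;; R' (Suc 0) = f"
  by (simp add: S_1 T.R_1)

end

lemma splitting_mapI:
  assumes "permutation_splitting C P" "permutation_splitting C Q"
    and "f \<in> Hom C (psob P (Suc 0)) (psob Q (Suc 0))"
    and "A = psob P (Suc 0)" "A' = psob Q (Suc 0)"
  shows "splitting_map C A (psob P) (rr P) (ss P) A' (psob Q) (rr Q) (ss Q) f"
proof -
  interpret splitting C A "psob P" "rr P" "ss P"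
    by (rule splitting_of_permutation_splitting) fact+
  interpret T: splitting C A' "psob Q" "rr Q" "ss Q"
    by (rule splitting_of_permutation_splitting) fact+
  show ?thesis
    by unfold_locales (use assms in simp)
qed

lemma perm_split_morphism_Hom:
  "perm_split_morphism C P Q f \<Longrightarrow> f n \<in> Hom C (psob P n) (psob Q n)"
  by (simp add: perm_split_morphism_def)

lemma bin_bimon_morphism_Hom:
  "bin_bimon_morphism C A B f \<Longrightarrow> f n \<in> Hom C (bbob A n) (bbob B n)"
  by (simp add: bin_bimon_morphism_def)

lemma perm_split_morphism_extend:
  assumes "permutation_splitting C P" "permutation_splitting C Q"
    and "f \<in> Hom C (psob P 1) (psob Q 1)"
  shows "perm_split_morphism C P Q (\<lambda>n. ss P n ;;\<^bsub>C\<^esub> tpow C f n ;;\<^bsub>C\<^esub> rr Q n)"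
proof -
  define A A' where "A = psob P (Suc 0)" and "A' = psob Q (Suc 0)"
  interpret splitting_map C A "psob P" "rr P" "ss P" A' "psob Q" "rr Q" "ss Q" f
    by (rule splitting_mapI) (use assms in \<open>simp_all add: A_def A'_def\<close>)
  have "ss P n ;;\<^bsub>C\<^esub> fp n ;;\<^bsub>C\<^esub> rr Q n \<in> Hom C (psob P n) (psob Q n)" for n
    by (simp add: Hom_iff)
  \<comment> \<open>\<open>extend_1\<close> identifies the component in degree 1 with
    \<open>f\<close>, so the conditions speak of tensor powers of \<open>f\<close> itself.\<close>
  then show ?thesis
    unfolding perm_split_morphism_def One_nat_def extend_1 extend_R extend_S by simp
qed

lemma perm_split_morphism_determined:
  assumes "permutation_splitting C P" "permutation_splitting C Q" "perm_split_morphism C P Q f"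
  shows "ss P n ;;\<^bsub>C\<^esub> tpow C (f 1) n ;;\<^bsub>C\<^esub> rr Q n = f n"
proof -
  interpret Q: permutation_splitting C Q by fact
  have "ss P n ;;\<^bsub>C\<^esub> tpow C (f 1) n = f n ;;\<^bsub>C\<^esub> ss Q n"
    using assms(3) by (simp add: perm_split_morphism_def)
  then show ?thesis
    using Q.cmp_assoc[OF perm_split_morphism_Hom[OF assms(3), of n] Q.ss_Hom[of n] Q.rr_Hom[of n]]
      Q.ss_rr[of n] Q.cmp_idt[OF perm_split_morphism_Hom[OF assms(3), of n]] by simp
qed

text \<open>Inductions along \<open>prod1\<close> and \<open>coprod1\<close>, each step using
  compatibility with the operations in degrees \<open>n\<close> and 1.\<close>

lemma perm_split_morphism_of_bin_bimon_morphism: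
  assumes "binomial_bimonoid C B" "binomial_bimonoid C B'" "bin_bimon_morphism C B B' f"
  shows "perm_split_morphism C (bb_to_ps C B) (bb_to_ps C B') f"
proof -
  define A A' where "A = bbob B (Suc 0)" and "A' = bbob B' (Suc 0)"
  interpret bimonoid_power C B A using assms(1) A_def by (rule bimonoid_powerI)
  interpret T: bimonoid_power C B' A' using assms(2) A'_def by (rule bimonoid_powerI)
  interpret lin_power_map C A A' "f (Suc 0)"
    by unfold_locales (use bin_bimon_morphism_Hom[OF assms(3)] in \<open>simp add: A_def A'_def\<close>)
  have [simp]: "f n \<in> arrs C" "src C (f n) = bbob B n" "tgt C (f n) = bbob B' n" for n
    using bin_bimon_morphism_Hom[OF assms(3), of n] by (simp_all add: Hom_iff)
  have f: "eta B ;;\<^bsub>C\<^esub> f 0 = eta B'" "f 0 ;;\<^bsub>C\<^esub> eps B' = eps B"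
    "f n \<otimes>\<^bsub>C\<^esub> f p ;;\<^bsub>C\<^esub> nabla B' n p = nabla B n p ;;\<^bsub>C\<^esub> f (n + p)"
    "Delta B n p ;;\<^bsub>C\<^esub> f n \<otimes>\<^bsub>C\<^esub> f p = f (n + p) ;;\<^bsub>C\<^esub> Delta B' n p" for n p
    using assms(3) by (simp_all add: bin_bimon_morphism_def)
  have R: "fp n ;;\<^bsub>C\<^esub> T.prod1 n = prod1 n ;;\<^bsub>C\<^esub> f n" for n
  proof (induction n)
    case (Suc n)
    have "fp (Suc n) ;;\<^bsub>C\<^esub> T.prod1 (Suc n) =
        (fp n ;;\<^bsub>C\<^esub> T.prod1 n) \<otimes>\<^bsub>C\<^esub> f (Suc 0) ;;\<^bsub>C\<^esub> nabla B' n (Suc 0)"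
      by (simp add: ichg T.ob_1)
    also have "\<dots> = prod1 n \<otimes>\<^bsub>C\<^esub> J (Suc 0) ;;\<^bsub>C\<^esub> (f n \<otimes>\<^bsub>C\<^esub> f (Suc 0) ;;\<^bsub>C\<^esub> nabla B' n (Suc 0))"
      unfolding Suc.IH by (simp add: ichg T.ob_1 ob_1)
    also have "\<dots> = prod1 (Suc n) ;;\<^bsub>C\<^esub> f (Suc n)"
      unfolding f by (simp add: ob_1)
    finally show ?case .
  qed (simp add: f)
  have S: "coprod1 n ;;\<^bsub>C\<^esub> fp n = f n ;;\<^bsub>C\<^esub> T.coprod1 n" for n
  proof (induction n)
    case (Suc n)
    have "coprod1 (Suc n) ;;\<^bsub>C\<^esub> fp (Suc n) =
        Delta B n (Suc 0) ;;\<^bsub>C\<^esub> (coprod1 n ;;\<^bsub>C\<^esub> fp n) \<otimes>\<^bsub>C\<^esub> f (Suc 0)"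
      by (simp add: ichg ob_1)
    also have "\<dots> = (Delta B n (Suc 0) ;;\<^bsub>C\<^esub> f n \<otimes>\<^bsub>C\<^esub> f (Suc 0)) ;;\<^bsub>C\<^esub> T.coprod1 n \<otimes>\<^bsub>C\<^esub> T.J (Suc 0)"
      unfolding Suc.IH by (simp add: ichg T.ob_1 ob_1)
    also have "\<dots> = f (Suc n) ;;\<^bsub>C\<^esub> T.coprod1 (Suc n)"
      unfolding f by (simp add: T.ob_1)
    finally show ?case .
  qed (simp add: f)
  have "psob (bb_to_ps C B) = bbob B" "psob (bb_to_ps C B') = bbob B'"
    by (simp_all add: bb_to_ps_def)
  then show ?thesis
    unfolding perm_split_morphism_def
    by (simp add: rr_bb_to_ps ss_bb_to_ps T.rr_bb_to_ps T.ss_bb_to_ps Hom_iff R S)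
qed

text \<open>Sliding past \<open>s\<close> or \<open>r\<close> exchanges a component of
  \<open>f\<close> for a tensor power of its degree-one component; between the two slides,
  \<open>fp_add\<close> joins or splits that power.\<close>

lemma bin_bimon_morphism_of_perm_split_morphism:
  assumes "permutation_splitting C P" "permutation_splitting C Q" "perm_split_morphism C P Q f"
  shows "bin_bimon_morphism C (ps_to_bb C P) (ps_to_bb C Q) f"
proof -
  define A A' where "A = psob P (Suc 0)" and "A' = psob Q (Suc 0)"
  interpret splitting_map C A "psob P" "rr P" "ss P" A' "psob Q" "rr Q" "ss Q" "f (Suc 0)"
    by (rule splitting_mapI)
      (use assms perm_split_morphism_Hom[OF assms(3)] in \<open>simp_all add: A_def A'_def\<close>)
  have [simp]: "f n \<in> arrs C" "src C (f n) = psob P n" "tgt C (f n) = psob Q n" for n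
    using perm_split_morphism_Hom[OF assms(3), of n] by (simp_all add: Hom_iff)
  have f: "fp n ;;\<^bsub>C\<^esub> rr Q n = rr P n ;;\<^bsub>C\<^esub> f n" "ss P n ;;\<^bsub>C\<^esub> fp n = f n ;;\<^bsub>C\<^esub> ss Q n" for n
    using assms(3) by (simp_all add: perm_split_morphism_def)
  have N: "f n \<otimes>\<^bsub>C\<^esub> f p ;;\<^bsub>C\<^esub> T.nab n p = nab n p ;;\<^bsub>C\<^esub> f (n + p)" for n p
  proof -
    have "f n \<otimes>\<^bsub>C\<^esub> f p ;;\<^bsub>C\<^esub> T.nab n p = (f n ;;\<^bsub>C\<^esub> ss Q n) \<otimes>\<^bsub>C\<^esub> (f p ;;\<^bsub>C\<^esub> ss Q p) ;;\<^bsub>C\<^esub> rr Q (n + p)"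
      by (simp add: T.nab_def ichg)
    also have "\<dots> = ss P n \<otimes>\<^bsub>C\<^esub> ss P p ;;\<^bsub>C\<^esub> (fp (n + p) ;;\<^bsub>C\<^esub> rr Q (n + p))"
      unfolding f(2)[symmetric] fp_add by (simp add: ichg)
    also have "\<dots> = nab n p ;;\<^bsub>C\<^esub> f (n + p)"
      unfolding f(1) by (simp add: nab_def)
    finally show ?thesis .
  qed
  have D: "Del n p ;;\<^bsub>C\<^esub> f n \<otimes>\<^bsub>C\<^esub> f p = f (n + p) ;;\<^bsub>C\<^esub> T.Del n p" for n p
  proof -
    have "rr P n \<otimes>\<^bsub>C\<^esub> rr P p ;;\<^bsub>C\<^esub> f n \<otimes>\<^bsub>C\<^esub> f p = (fp n ;;\<^bsub>C\<^esub> rr Q n) \<otimes>\<^bsub>C\<^esub> (fp p ;;\<^bsub>C\<^esub> rr Q p)"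
      unfolding f(1) by (simp add: interchange)
    also have "\<dots> = fp (n + p) ;;\<^bsub>C\<^esub> rr Q n \<otimes>\<^bsub>C\<^esub> rr Q p"
      unfolding fp_add by (simp add: interchange)
    finally have "ss P (n + p) ;;\<^bsub>C\<^esub> (rr P n \<otimes>\<^bsub>C\<^esub> rr P p ;;\<^bsub>C\<^esub> f n \<otimes>\<^bsub>C\<^esub> f p) =
        (ss P (n + p) ;;\<^bsub>C\<^esub> fp (n + p)) ;;\<^bsub>C\<^esub> rr Q n \<otimes>\<^bsub>C\<^esub> rr Q p"
      by simp
    then have "ss P (n + p) ;;\<^bsub>C\<^esub> (rr P n \<otimes>\<^bsub>C\<^esub> rr P p ;;\<^bsub>C\<^esub> f n \<otimes>\<^bsub>C\<^esub> f p) =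
        f (n + p) ;;\<^bsub>C\<^esub> (ss Q (n + p) ;;\<^bsub>C\<^esub> rr Q n \<otimes>\<^bsub>C\<^esub> rr Q p)"
      unfolding f(2) by simp
    then show ?thesis
      by (simp add: Del_def T.Del_def)
  qed
  have "rr P 0 ;;\<^bsub>C\<^esub> f 0 = rr Q 0" "f 0 ;;\<^bsub>C\<^esub> ss Q 0 = ss P 0"
    using f[of 0] by (simp_all add: pw_0 T.pw_0)
  then show ?thesis
    unfolding bin_bimon_morphism_def ps_to_bb_eq[OF assms(1) A_def] ps_to_bb_eq[OF assms(2) A'_def]
    by (simp add: N D Hom_iff)
qed

section \<open>The four categories and the three isomorphisms\<close>

context linear_symmetric_monoidal_category
begin

lemma perm_split_morphism_idt:
  assumes "permutation_splitting C P"
  shows "perm_split_morphism C P P (\<lambda>n. \<i>\<d> (psob P n))"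
proof -
  define A where "A = psob P (Suc 0)"
  interpret splitting_map C A "psob P" "rr P" "ss P" A "psob P" "rr P" "ss P" "\<i>\<d> A"
    by (rule splitting_mapI)
      (use assms permutation_splitting.ps_obj[OF assms] in \<open>simp_all add: A_def Hom_iff\<close>)
  have "\<i>\<d> A = J (Suc 0)" by (simp only: pw_1)
  then have "fp n = J n" for n
    by (induction n) (simp_all add: pw_0)
  then show ?thesis
    unfolding perm_split_morphism_def by (simp add: Hom_iff A_def[symmetric])
qed

lemma tpow_cmp:
  assumes "f \<in> Hom C X Y" "g \<in> Hom C Y Z"
  shows "tpow C (f ;; g) n = tpow C f n ;; tpow C g n"
proof -
  have objs: "X \<in> objs C" "Y \<in> objs C" "Z \<in> objs C" using assms HomD by auto
  interpret f: lin_power_map C X Y f by unfold_locales (use assms objs in auto)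
  interpret g: lin_power_map C Y Z g by unfold_locales (use assms objs in auto)
  show ?thesis
    by (induction n) (simp_all add: f.T.pw_0[symmetric] interchange)
qed

lemma perm_split_morphism_cmp:
  assumes P: "permutation_splitting C P" and Q: "permutation_splitting C Q"
    and R: "permutation_splitting C R"
    and f: "perm_split_morphism C P Q f" and g: "perm_split_morphism C Q R g"
  shows "perm_split_morphism C P R (\<lambda>n. f n ;; g n)"
proof -
  note fH = perm_split_morphism_Hom[OF f] and gH = perm_split_morphism_Hom[OF g]
  define A A' A'' where A: "A = psob P (Suc 0)" "A' = psob Q (Suc 0)" "A'' = psob R (Suc 0)"
  interpret f: splitting_map C A "psob P" "rr P" "ss P" A' "psob Q" "rr Q" "ss Q" "f (Suc 0)"
    by (rule splitting_mapI) (use P Q fH in \<open>simp_all add: A\<close>)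
  interpret g: splitting_map C A' "psob Q" "rr Q" "ss Q" A'' "psob R" "rr R" "ss R" "g (Suc 0)"
    by (rule splitting_mapI) (use R Q gH in \<open>simp_all add: A\<close>)
  have tp: "tpow C (f (Suc 0) ;; g (Suc 0)) n = f.fp n ;; g.fp n" for n
    using fH gH by (rule tpow_cmp)
  have f_eq: "f.fp n ;; rr Q n = rr P n ;; f n" "ss P n ;; f.fp n = f n ;; ss Q n" for n
    using f by (simp_all add: perm_split_morphism_def)
  have g_eq: "g.fp n ;; rr R n = rr Q n ;; g n" "ss Q n ;; g.fp n = g n ;; ss R n" for n
    using g by (simp_all add: perm_split_morphism_def)
  have [simp]: "f n \<in> arrs C" "src C (f n) = psob P n" "tgt C (f n) = psob Q n"
    "g n \<in> arrs C" "src C (g n) = psob Q n" "tgt C (g n) = psob R n" for n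
    using fH[of n] gH[of n] by (simp_all add: Hom_iff)
  have "f.fp n ;; g.fp n ;; rr R n = rr P n ;; (f n ;; g n)" for n
    using cmp_eq_ext[OF f_eq(1)[of n], of "g n"] by (simp add: g_eq)
  moreover have "ss P n ;; (f.fp n ;; g.fp n) = f n ;; g n ;; ss R n" for n
    using cmp_eq_ext[OF f_eq(2)[of n], of "g.fp n"] by (simp add: g_eq)
  ultimately show ?thesis
    unfolding perm_split_morphism_def using cmp_Hom[OF fH gH] by (simp add: tp)
qed

lemma category_graded:
  assumes hom: "\<And>X Y f n. mor X Y f \<Longrightarrow> f n \<in> Hom C (ob X n) (ob Y n)"
    and "\<And>X. X \<in> Obs \<Longrightarrow> mor X X (\<lambda>n. \<i>\<d> (ob X n))"
    and "\<And>X Y Z f g. \<lbrakk>X \<in> Obs; Y \<in> Obs; Z \<in> Obs; mor X Y f; mor Y Z g\<rbrakk> \<Longrightarrow> mor X Z (\<lambda>n. f n ;; g n)"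
  shows "category (struct_cat Obs mor (\<lambda>X n. \<i>\<d> (ob X n)) (\<lambda>f g n. f n ;; g n))"
proof (rule category_struct_cat)
  show "(\<lambda>n. \<i>\<d> (ob X n) ;; f n) = f" "(\<lambda>n. f n ;; \<i>\<d> (ob Y n)) = f" if "mor X Y f" for X Y f
    using idt_cmp[OF hom[OF that]] cmp_idt[OF hom[OF that]] by auto
  show "(\<lambda>n. (f n ;; g n) ;; h n) = (\<lambda>n. f n ;; (g n ;; h n))"
    if "mor X Y f" "mor Y Z g" "mor Z W h" for X Y Z W f g h
    using cmp_assoc[OF hom[OF that(1)] hom[OF that(2)] hom[OF that(3)]] by auto
qed (use assms in auto)

lemma category_PermSplit: "category (PermSplit C)"
  unfolding PermSplit_def
  by (rule category_graded)
    (auto intro: perm_split_morphism_idt perm_split_morphism_cmp perm_split_morphism_Hom)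

lemma bin_bimon_morphism_idt:
  assumes "binomial_bimonoid C B"
  shows "bin_bimon_morphism C B B (\<lambda>n. \<i>\<d> (bbob B n))"
proof -
  define A where "A = bbob B (Suc 0)"
  interpret bimonoid_power C B A using assms A_def by (rule bimonoid_powerI)
  show ?thesis
    by (simp add: bin_bimon_morphism_def Hom_iff)
qed

lemma bin_bimon_morphism_cmp:
  assumes "binomial_bimonoid C X" "binomial_bimonoid C Y" "binomial_bimonoid C Z"
    and f: "bin_bimon_morphism C X Y f" and g: "bin_bimon_morphism C Y Z g"
  shows "bin_bimon_morphism C X Z (\<lambda>n. f n ;; g n)"
proof -
  note fH = bin_bimon_morphism_Hom[OF f] and gH = bin_bimon_morphism_Hom[OF g]
  interpret X: bimonoid_power C X "bbob X (Suc 0)" using assms(1) refl by (rule bimonoid_powerI)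
  interpret Y: bimonoid_power C Y "bbob Y (Suc 0)" using assms(2) refl by (rule bimonoid_powerI)
  interpret Z: bimonoid_power C Z "bbob Z (Suc 0)" using assms(3) refl by (rule bimonoid_powerI)
  have [simp]: "f n \<in> arrs C" "src C (f n) = bbob X n" "tgt C (f n) = bbob Y n"
    "g n \<in> arrs C" "src C (g n) = bbob Y n" "tgt C (g n) = bbob Z n" for n
    using fH[of n] gH[of n] by (simp_all add: Hom_iff)
  have f_eq: "eta X ;; f 0 = eta Y" "f 0 ;; eps Y = eps X"
    "f n \<otimes> f p ;; nabla Y n p = nabla X n p ;; f (n + p)"
    "Delta X n p ;; f n \<otimes> f p = f (n + p) ;; Delta Y n p" for n p
    using f by (simp_all add: bin_bimon_morphism_def)
  have g_eq: "eta Y ;; g 0 = eta Z" "g 0 ;; eps Z = eps Y"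
    "g n \<otimes> g p ;; nabla Z n p = nabla Y n p ;; g (n + p)"
    "Delta Y n p ;; g n \<otimes> g p = g (n + p) ;; Delta Z n p" for n p
    using g by (simp_all add: bin_bimon_morphism_def)
  have "(f n ;; g n) \<otimes> (f p ;; g p) ;; nabla Z n p = nabla X n p ;; (f (n + p) ;; g (n + p))" for n p
  proof -
    have "(f n ;; g n) \<otimes> (f p ;; g p) ;; nabla Z n p = f n \<otimes> f p ;; (g n \<otimes> g p ;; nabla Z n p)"
      by (simp add: ichg)
    also have "\<dots> = nabla X n p ;; (f (n + p) ;; g (n + p))"
      unfolding g_eq using cmp_eq_ext[OF f_eq(3)[of n p], of "g (n + p)"] by simp
    finally show ?thesis .
  qed
  moreover have "Delta X n p ;; (f n ;; g n) \<otimes> (f p ;; g p) = f (n + p) ;; g (n + p) ;; Delta Z n p" for n p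
  proof -
    have "Delta X n p ;; (f n ;; g n) \<otimes> (f p ;; g p) = (Delta X n p ;; f n \<otimes> f p) ;; g n \<otimes> g p"
      by (simp add: interchange)
    also have "\<dots> = f (n + p) ;; (Delta Y n p ;; g n \<otimes> g p)"
      unfolding f_eq by simp
    also have "\<dots> = f (n + p) ;; g (n + p) ;; Delta Z n p"
      unfolding g_eq by simp
    finally show ?thesis .
  qed
  moreover have "eta X ;; (f 0 ;; g 0) = eta Z" "f 0 ;; g 0 ;; eps Z = eps X"
    using cmp_eq_ext[OF f_eq(1), of "g 0"] by (simp_all add: g_eq f_eq)
  ultimately show ?thesis
    unfolding bin_bimon_morphism_def using cmp_Hom[OF fH gH] by simp
qed

lemma category_BinBimon: "category (BinBimon C)"
  unfolding BinBimon_def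
  by (rule category_graded)
    (auto intro: bin_bimon_morphism_idt bin_bimon_morphism_cmp bin_bimon_morphism_Hom)

lemma category_PermSplit1: "category (PermSplit1 C)"
  unfolding PermSplit1_def
  by (rule category_struct_cat)
    (auto intro: idt_Hom cmp_Hom idt_cmp cmp_idt cmp_assoc permutation_splitting.ps_obj)

lemma category_BinBimon1: "category (BinBimon1 C)"
  unfolding BinBimon1_def
  by (rule category_struct_cat)
    (auto intro: idt_Hom cmp_Hom idt_cmp cmp_idt cmp_assoc binomial_bimonoid.bb_obj)

lemma psob_bb_to_ps [simp]: "psob (bb_to_ps C B) = bbob B"
  and bbob_ps_to_bb [simp]: "bbob (ps_to_bb C P) = psob P"
  by (simp_all add: bb_to_ps_def ps_to_bb_def)

lemma isomorphism_F1_G1: "isomorphism_with_inverse (BinBimon C) (PermSplit C) (F1 C) (G1 C)"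
  using category_BinBimon category_PermSplit
  unfolding BinBimon_def PermSplit_def F1_def G1_def
  by (rule isomorphism_struct_functor)
    (simp_all add: permutation_splitting_bb_to_ps binomial_bimonoid_ps_to_bb ps_to_bb_bb_to_ps
      bb_to_ps_ps_to_bb perm_split_morphism_of_bin_bimon_morphism
      bin_bimon_morphism_of_perm_split_morphism)

lemma isomorphism_F3_G3: "isomorphism_with_inverse (PermSplit1 C) (BinBimon1 C) (F3 C) (G3 C)"
  using category_PermSplit1 category_BinBimon1
  unfolding BinBimon1_def PermSplit1_def F3_def G3_def
  by (rule isomorphism_struct_functor)
    (simp_all add: permutation_splitting_bb_to_ps binomial_bimonoid_ps_to_bb ps_to_bb_bb_to_ps
      bb_to_ps_ps_to_bb)

text \<open>The identity family is a morphism, and every morphism is the extension of its degree-one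
  component.\<close>

lemma extend_idt:
  assumes "permutation_splitting C P"
  shows "ss P n ;; tpow C (\<i>\<d> (psob P 1)) n ;; rr P n = \<i>\<d> (psob P n)"
  using perm_split_morphism_determined[OF assms assms perm_split_morphism_idt[OF assms], of n] .

lemma extend_1:
  assumes "permutation_splitting C P" "permutation_splitting C Q" "f \<in> Hom C (psob P 1) (psob Q 1)"
  shows "ss P 1 ;; tpow C f 1 ;; rr Q 1 = f"
proof -
  define A A' where "A = psob P (Suc 0)" and "A' = psob Q (Suc 0)"
  interpret splitting_map C A "psob P" "rr P" "ss P" A' "psob Q" "rr Q" "ss Q" f
    by (rule splitting_mapI) (use assms in \<open>simp_all add: A_def A'_def\<close>)
  show ?thesis
    using extend_1 by simp
qed

text \<open>Functoriality from uniqueness: the composite of two extensions is a morphism with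
  degree-one component \<open>f ;; g\<close>, hence the extension of \<open>f ;; g\<close>.\<close>

lemma extend_cmp:
  assumes P: "permutation_splitting C P" and Q: "permutation_splitting C Q"
    and R: "permutation_splitting C R"
    and f: "f \<in> Hom C (psob P 1) (psob Q 1)" and g: "g \<in> Hom C (psob Q 1) (psob R 1)"
  shows "ss P n ;; tpow C (f ;; g) n ;; rr R n =
    (ss P n ;; tpow C f n ;; rr Q n) ;; (ss Q n ;; tpow C g n ;; rr R n)"
  using perm_split_morphism_determined[OF P R perm_split_morphism_cmp[OF P Q R
      perm_split_morphism_extend[OF P Q f] perm_split_morphism_extend[OF Q R g]], of n]
  unfolding extend_1[OF P Q f] extend_1[OF Q R g] .

lemma isomorphism_F2_G2: "isomorphism_with_inverse (PermSplit C) (PermSplit1 C) (F2 C) (G2 C)"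
  using category_PermSplit category_PermSplit1
  unfolding PermSplit_def PermSplit1_def F2_def G2_def
proof (rule isomorphism_struct_functor; (unfold mem_Collect_eq)?)
  show "(\<lambda>n. ss X n ;; tpow C (f ;; g) n ;; rr Z n) =
      (\<lambda>n. ss X n ;; tpow C f n ;; rr Y n ;; (ss Y n ;; tpow C g n ;; rr Z n))"
    if "permutation_splitting C X" "permutation_splitting C Y" "permutation_splitting C Z"
      "f \<in> Hom C (psob X 1) (psob Y 1)" "g \<in> Hom C (psob Y 1) (psob Z 1)" for X Y Z f g
    using that by (intro ext extend_cmp)
  show "(\<lambda>n. ss X n ;; tpow C (\<i>\<d> (psob X 1)) n ;; rr X n) = (\<lambda>n. \<i>\<d> (psob X n))"
    if "permutation_splitting C X" for X
    using that by (intro ext extend_idt)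
  show "(\<lambda>n. ss X n ;; tpow C (f 1) n ;; rr Y n) = f"
    if "permutation_splitting C X" "permutation_splitting C Y" "perm_split_morphism C X Y f" for X Y f
    using that by (intro ext perm_split_morphism_determined)
  show "perm_split_morphism C X Y (\<lambda>n. ss X n ;; tpow C f n ;; rr Y n)"
    if "permutation_splitting C X" "permutation_splitting C Y" "f \<in> Hom C (psob X 1) (psob Y 1)" for X Y f
    using that by (rule perm_split_morphism_extend)
  show "ss X 1 ;; tpow C f 1 ;; rr Y 1 = f"
    if "permutation_splitting C X" "permutation_splitting C Y" "f \<in> Hom C (psob X 1) (psob Y 1)" for X Y f
    using that by (rule extend_1)
qed (rule perm_split_morphism_Hom | assumption | rule refl)+

end

theorem theorem58:
  fixes C :: "('o, 'a, 'x) lsmcat_scheme"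
  assumes "linear_symmetric_monoidal_category C"
  shows "isomorphism_with_inverse (BinBimon C) (PermSplit C) (F1 C) (G1 C)
       \<and> isomorphism_with_inverse (PermSplit C) (PermSplit1 C) (F2 C) (G2 C)
       \<and> isomorphism_with_inverse (PermSplit1 C) (BinBimon1 C) (F3 C) (G3 C)"
proof -
  interpret linear_symmetric_monoidal_category C by fact
  show ?thesis
    using isomorphism_F1_G1 isomorphism_F2_G2 isomorphism_F3_G3 by blast
qed

end
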